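(* Assume: (1) $\inf_{t\in[0,1]}\psi(t)=\psi(1)=0$ and $\psi'(1)<0$, and $2<\kappa<\infty$; (2) there exists $\delta_1>0$ such that $\psi(t)<\infty$ for all $t\in[1-\delta_1,\lceil\kappa+\delta_1\rceil]$ and, for all $1\le j\le\lceil\kappa+\delta_1\rceil$ and all $\beta=(\beta_1,\dots,\beta_j)\in(\mathbb N^* )^j$ with $\sum_{i=1}^j\beta_i\le\lceil\kappa+\delta_1\rceil$, $c_j(\beta):=\mathbf E\big[\sum_{\mathbf x\in\Delta^j_1}e^{-\sum_{i=1}^j\beta_iV(x^{(i)})}\big]<\infty$; (3) there exists $\mathfrak h>0$ such that $\mathbf P\big(\inf_{x\in\mathbb T,x\ne e}(V(x)-V(x^* ))\ge-\mathfrak h\big)=1$; (4) $(\ell_n)$ and $(\mathfrak L_n)$ are sequences of positive integers with $\delta_0^{-1}\log n\le\ell_n\le\mathfrak L_n$ and, for some $l_0\in\mathbb N$, $\lim_{n\to\infty}\frac{\mathfrak L_n}{n^{1/2}}\Lambda_{l_0}(\mathfrak L_n)=0$. Let $L_n:=\mathfrak L_n-\ell_n+1$ and $R_n(l):=\sum_{|z|=l}\mathbf 1_{\{z\in\mathcal R_{T^{n^{1/2}}}\}}$. Then, in $\mathbb P^*$-probability, $$\frac1{n^{1/2}L_n}\sum_{l=\ell_n}^{\mathfrak L_n}R_n(l)\underset{n\to\infty}{\longrightarrow}c_\infty W_\infty.$$ As a consequence, if $\log n=o(\mathfrak L_n)$, then both $\big(R_n(\mathfrak L_n)/n^{1/2}\big)$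 and $\big(\sum_{l=\ell_n}^{\mathfrak L_n}R_n(l)/(n^{1/2}\mathfrak L_n)\big)$ converge in $\mathbb P^*$-probability to the same limit $c_\infty W_\infty$.
   Context: $\mathbb N=\{0,1,\dots\}$, $\mathbb N^*=\{1,2,\dots\}$. Environment. Under a probability $\mathbf P$ (expectation $\mathbf E$), $\mathcal P$ is a random finite sequence of reals of length $N$, with $\mathbf E[N]>1$. $(\mathbb T,(A_x)_{x\in\mathbb T})$ is the marked Galton–Watson tree with root $e$, $A_e=0$, where each vertex, independently of the others in its generation, has $N$-many marked children whose marks are distributed as $\mathcal P$. $|x|$ is the generation of $x$, $x^*$ its parent; $x\le y$ means $x$ is an ancestor of $y$ or $x=y$. $V(e)=0$, $V(x)=\sum_{e<z\le x}A_z$, $\mathcal E=(\mathbb T,(V(x))_{x\in\mathbb T})$. $\mathbf P^*=\mathbf P(\cdot\mid\text{non-extinction of }\mathbb T)$, with expectation $\mathbf E^*$. $\psi(t)=\log\mathbf E[\sum_{|x|=1}e^{-tV(x)}]$ and $\kappa=\inf\{t>1:\psi(t)=0\}$. $\Delta^j_1$ is the set of $j$-tuples $(x^{(1)},\dots,x^{(j)})$ of pairwise distinct vertices of generation 1. Walk. Add a parent $e^*$ to $e$. Given $\mathcal E$, under $\mathbb P^{\mathcal E}$, $(X_j)_{j\ge0}$ is the Markov chain on $\mathbb T\cup\{e^*\}$ with $X_0=e$, which from $x\in\mathbb T$ with children $x^1,\dots,x^{N_x}$ jumps to $x^*$ with probability $e^{-V(x)}/(e^{-V(x)}+\sum_ie^{-V(x^i)})$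 and to $x^j$ with probability $e^{-V(x^j)}/(e^{-V(x)}+\sum_ie^{-V(x^i)})$, and from $e^*$ jumps to $e$ with probability 1. $\mathbb P^*=\mathbf E^*[\mathbb P^{\mathcal E}(\cdot)]$. $T^0=0$, $T^j=\inf\{i>T^{j-1}:X_i=e^*\}$. $\mathcal R_T=\{u\in\mathbb T:\exists\,1\le j\le T,\ X_j=u\}$. When used as an index, $n^{1/2}$ means its integer part. $\delta_0>0$ is a constant fixed once and for all such that, for some $\rho_1>1/2$ and every positive integer $\zeta$, $\mathbf P(\min_{|z|=\lceil\delta_0^{-1}\zeta\rceil}V(z)\ge3\zeta)\ge1-e^{-\rho_1\zeta}$ (such a constant exists under (1)). $\Lambda_0(t)=t$ and $\Lambda_{i-1}(t)=e^{\Lambda_i(t)}$ for $i\ge1$ (iterated logarithms). $(S_j)_{j\ge0}$ is a random walk with i.i.d. increments, $S_0=0$, $\mathbf E[\mathfrak t(S_1)]=\mathbf E[\sum_{|x|=1}\mathfrak t(V(x))e^{-V(x)}]$ for bounded measurable $\mathfrak t$; $c_\infty=\mathbf E[(\sum_{j\ge0}e^{-S_j})^{-1}]$. $W_\infty$ is the almost sure limit of the martingale $W_n=\sum_{|x|=n}e^{-V(x)}$.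
   Formalization: The last convergence, of the sum divided by n^{1/2}𝔏_n, is stated under the additional assumption ℓ_n = o(𝔏_n); without it the claim fails, e.g. for ℓ_n = 𝔏_n = ⌈(log n)²⌉, where that quantity tends to 0. *)

theory Defs
  imports "HOL-Probability.Probability"
begin

section \<open>Marked trees\<close>

text \<open>
  Vertices are Ulam--Harris words, the root being \<open>[]\<close>; the children of \<open>x\<close> are \<open>x @ [i]\<close>.
  An environment assigns to every word \<open>x\<close> (in the tree or not) the finite sequence of the marks of
  the children of \<open>x\<close>; in particular \<open>length (e x)\<close> is the number of children of \<open>x\<close>.
\<close>

type_synonym vertex = "nat list"
type_synonym env = "vertex \<Rightarrow> real list"

definition tree :: "env \<Rightarrow> vertex set" where
  "tree e = {x. \<forall>k<length x. x ! k < length (e (take k x))}"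

definition gen :: "env \<Rightarrow> nat \<Rightarrow> vertex set" where
  "gen e n = {x \<in> tree e. length x = n}"

definition V :: "env \<Rightarrow> vertex \<Rightarrow> real" where
  "V e x = (\<Sum>k<length x. e (take k x) ! (x ! k))"

definition survives :: "env \<Rightarrow> bool" where
  "survives e \<longleftrightarrow> (\<forall>n. gen e n \<noteq> {})"

definition W :: "env \<Rightarrow> nat \<Rightarrow> real" where
  "W e n = (\<Sum>x\<in>gen e n. exp (- V e x))"

text \<open>
  \<open>W e\<close> converges for almost every environment, being a nonnegative martingale when \<open>psi\<close> (below)
  vanishes at \<open>1\<close>; elsewhere \<open>lim\<close> is an unspecified value.
\<close>

definition W_inf :: "env \<Rightarrow> real" where
  "W_inf e = lim (W e)"

lemma finite_gen: "finite (gen e n)"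
proof (induction n)
  case 0
  have "gen e 0 \<subseteq> {[]}" by (auto simp: gen_def)
  then show ?case by (rule finite_subset) simp
next
  case (Suc n)
  have "gen e (Suc n) \<subseteq> (\<Union>x\<in>gen e n. (\<lambda>i. x @ [i]) ` {..<length (e x)})"
  proof
    fix y assume y: "y \<in> gen e (Suc n)"
    then have l: "length y = Suc n" and t: "\<And>k. k < Suc n \<Longrightarrow> y ! k < length (e (take k y))"
      by (auto simp: gen_def tree_def)
    then obtain x i where yx: "y = x @ [i]"
      by (metis length_Suc_conv_rev)
    have "x \<in> gen e n"
      unfolding gen_def tree_def
    proof (intro CollectI conjI allI impI)
      show len: "length x = n" using l yx by simp
      fix k assume "k < length x"
      with t[of k] len show "x ! k < length (e (take k x))"
        by (simp add: yx nth_append)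
    qed
    moreover have "i < length (e x)"
      using l t[of n] unfolding yx by (simp add: nth_append)
    ultimately show "y \<in> (\<Union>x\<in>gen e n. (\<lambda>i. x @ [i]) ` {..<length (e x)})"
      using yx by auto
  qed
  then show ?case
    by (rule finite_subset) (use Suc in auto)
qed

section \<open>The branching environment\<close>

text \<open>Finite sequences of reals with the \<open>\<sigma>\<close>-algebra generated by the length and the coordinates.\<close>

definition real_seqs :: "real list measure" where
  "real_seqs = sigma UNIV
     ({{xs. length xs = n} | n. True} \<union>
      {{xs. i < length xs \<and> xs ! i \<in> B} | i B. B \<in> sets borel})"

text \<open>
  The mark sequences of distinct words are independent copies of one random finite sequence, whose
  law is that of the marks \<open>Env \<omega> []\<close> of the first generation.
\<close>

definition branching_env :: "'w measure \<Rightarrow> ('w \<Rightarrow> env) \<Rightarrow> bool" where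
  "branching_env M Env \<longleftrightarrow>
     prob_space M \<and>
     prob_space.indep_vars M (\<lambda>_. real_seqs) (\<lambda>x \<omega>. Env \<omega> x) UNIV \<and>
     (\<forall>x. distr M real_seqs (\<lambda>\<omega>. Env \<omega> x) = distr M real_seqs (\<lambda>\<omega>. Env \<omega> []))"

definition mean_offspring :: "'w measure \<Rightarrow> ('w \<Rightarrow> env) \<Rightarrow> ennreal" where
  "mean_offspring M Env = (\<integral>\<^sup>+\<omega>. of_nat (length (Env \<omega> [])) \<partial>M)"

definition laplace :: "'w measure \<Rightarrow> ('w \<Rightarrow> env) \<Rightarrow> real \<Rightarrow> ennreal" where
  "laplace M Env t = (\<integral>\<^sup>+\<omega>. (\<Sum>x\<in>gen (Env \<omega>) 1. ennreal (exp (- t * V (Env \<omega>) x))) \<partial>M)"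

definition psi :: "'w measure \<Rightarrow> ('w \<Rightarrow> env) \<Rightarrow> real \<Rightarrow> ereal" where
  "psi M Env t =
     (if laplace M Env t = \<infinity> then \<infinity>
      else if laplace M Env t = 0 then - \<infinity>
      else ereal (ln (enn2real (laplace M Env t))))"

definition kappa :: "'w measure \<Rightarrow> ('w \<Rightarrow> env) \<Rightarrow> ereal" where
  "kappa M Env = Inf (ereal ` {t. 1 < t \<and> psi M Env t = 0})"

definition Delta1 :: "env \<Rightarrow> nat \<Rightarrow> vertex list set" where
  "Delta1 e j = {xs. length xs = j \<and> distinct xs \<and> set xs \<subseteq> gen e 1}"

text \<open>The number \<open>j\<close> of the vertices is the length of \<open>\<beta>\<close>.\<close>

definition c_beta :: "'w measure \<Rightarrow> ('w \<Rightarrow> env) \<Rightarrow> nat list \<Rightarrow> ennreal" where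
  "c_beta M Env \<beta> =
     (\<integral>\<^sup>+\<omega>. (\<Sum>xs\<in>Delta1 (Env \<omega>) (length \<beta>).
        ennreal (exp (- (\<Sum>i<length \<beta>. real (\<beta> ! i) * V (Env \<omega>) (xs ! i))))) \<partial>M)"

definition P_star :: "'w measure \<Rightarrow> ('w \<Rightarrow> env) \<Rightarrow> 'w measure" where
  "P_star M Env = uniform_measure M {\<omega> \<in> space M. survives (Env \<omega>)}"

section \<open>The associated one-dimensional random walk\<close>

definition assoc_walk ::
    "'w measure \<Rightarrow> ('w \<Rightarrow> env) \<Rightarrow> 'v measure \<Rightarrow> (nat \<Rightarrow> 'v \<Rightarrow> real) \<Rightarrow> bool" where
  "assoc_walk M Env M' S \<longleftrightarrow>
     prob_space M' \<and>
     (\<forall>\<omega>\<in>space M'. S 0 \<omega> = 0) \<and>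
     prob_space.indep_vars M' (\<lambda>_. borel) (\<lambda>j \<omega>. S (Suc j) \<omega> - S j \<omega>) UNIV \<and>
     (\<forall>j. distr M' borel (\<lambda>\<omega>. S (Suc j) \<omega> - S j \<omega>) = distr M' borel (S 1)) \<and>
     (\<forall>f\<in>borel_measurable borel. bounded (range f) \<longrightarrow>
        (\<integral>\<omega>. f (S 1 \<omega>) \<partial>M') =
        (\<integral>\<omega>. (\<Sum>x\<in>gen (Env \<omega>) 1. f (V (Env \<omega>) x) * exp (- V (Env \<omega>) x)) \<partial>M))"

text \<open>The series is evaluated in \<open>[0, \<infinity>]\<close>, so that its inverse is \<open>0\<close> where it diverges.\<close>

definition c_inf :: "'v measure \<Rightarrow> (nat \<Rightarrow> 'v \<Rightarrow> real) \<Rightarrow> real" where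
  "c_inf M' S = enn2real (\<integral>\<^sup>+\<omega>. inverse (\<Sum>j. ennreal (exp (- S j \<omega>))) \<partial>M')"

section \<open>The walk in the environment\<close>

text \<open>
  States of the walk: \<open>Some x\<close> is the vertex \<open>x\<close>, and \<open>None\<close> is the extra parent of the root.
  As for the marks, the transition probabilities are defined at every word; the walk started at the
  root only visits vertices of the tree and \<open>None\<close>.
\<close>

definition parent :: "vertex \<Rightarrow> vertex option" where
  "parent x = (if x = [] then None else Some (butlast x))"

definition children :: "env \<Rightarrow> vertex \<Rightarrow> vertex set" where
  "children e x = (\<lambda>i. x @ [i]) ` {..<length (e x)}"

definition total_weight :: "env \<Rightarrow> vertex \<Rightarrow> real" where
  "total_weight e x = exp (- V e x) + (\<Sum>y\<in>children e x. exp (- V e y))"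

fun step_prob :: "env \<Rightarrow> vertex option \<Rightarrow> vertex option \<Rightarrow> real" where
  "step_prob e None t = (if t = Some [] then 1 else 0)"
| "step_prob e (Some x) t =
     (if t = parent x then exp (- V e x) / total_weight e x
      else if t \<in> Some ` children e x then exp (- V e (the t)) / total_weight e x
      else 0)"

definition step :: "env \<Rightarrow> vertex option \<Rightarrow> vertex option pmf" where
  "step e s = embed_pmf (step_prob e s)"

lemma finite_children [simp]: "finite (children e x)"
  by (simp add: children_def)

lemma parent_not_child [simp]: "parent x \<notin> Some ` children e x"
proof
  assume "parent x \<in> Some ` children e x"
  then obtain i where "butlast x = x @ [i]"
    by (auto simp: parent_def children_def split: if_splits)
  from arg_cong[OF this, of length] show False by simp
qed

lemma total_weight_pos [simp]: "total_weight e x > 0"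
  unfolding total_weight_def by (intro add_pos_nonneg sum_nonneg) auto

lemma pmf_step: "pmf (step e s) t = step_prob e s t"
  unfolding step_def
proof (rule pmf_embed_pmf)
  show nonneg: "0 \<le> step_prob e s t" for t
    by (cases s) (auto intro!: divide_nonneg_pos)
  show "(\<integral>\<^sup>+t. ennreal (step_prob e s t) \<partial>count_space UNIV) = 1"
  proof (cases s)
    case None
    have "(\<integral>\<^sup>+t. ennreal (step_prob e s t) \<partial>count_space UNIV) =
        (\<integral>\<^sup>+t. indicator {Some [] :: vertex option} t \<partial>count_space UNIV)"
      by (intro nn_integral_cong) (simp add: None indicator_def)
    then show ?thesis by simp
  next
    case (Some x)
    let ?F = "insert (parent x) (Some ` children e x)"
    have "(\<integral>\<^sup>+t. ennreal (step_prob e s t) \<partial>count_space UNIV) =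
        (\<Sum>t\<in>?F. ennreal (step_prob e s t))"
      by (rule nn_integral_count_space') (auto simp: Some)
    also have "\<dots> = ennreal (\<Sum>t\<in>?F. step_prob e s t)"
      by (rule sum_ennreal) (rule nonneg)
    also have "(\<Sum>t\<in>?F. step_prob e s t) = step_prob e s (parent x) +
        (\<Sum>t\<in>Some ` children e x. step_prob e s t)"
      by (rule sum.insert) auto
    also have "(\<Sum>t\<in>Some ` children e x. step_prob e s t) =
        (\<Sum>y\<in>children e x. step_prob e s (Some y))"
      by (simp add: sum.reindex)
    also have "\<dots> = (\<Sum>y\<in>children e x. exp (- V e y) / total_weight e x)"
    proof (rule sum.cong)
      fix y assume "y \<in> children e x"
      moreover from this have "Some y \<noteq> parent x"
        using parent_not_child[of x e] by (metis image_eqI)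
      ultimately show "step_prob e s (Some y) = exp (- V e y) / total_weight e x"
        by (simp add: Some)
    qed simp
    also have "step_prob e s (parent x) + \<dots> = total_weight e x / total_weight e x"
      by (simp add: Some total_weight_def flip: sum_divide_distrib add_divide_distrib)
    also have "\<dots> = 1"
      using total_weight_pos[of e x] by (metis divide_self less_irrefl)
    finally show ?thesis by simp
  qed
qed

text \<open>
  The quenched law on trajectories is the Ionescu--Tulcea measure for the kernels below: the first
  state is the root, the \<open>i\<close>-th one is drawn from the \<open>(i - 1)\<close>-th one according to \<open>step\<close>.
  The lemma \<open>emeasure_walk_law\<close> gives its finite-dimensional distributions.
\<close>

abbreviation path_space :: "(nat \<Rightarrow> vertex option) measure" where
  "path_space \<equiv> PiM UNIV (\<lambda>_. count_space UNIV)"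

definition walk_kernel :: "env \<Rightarrow> nat \<Rightarrow> (nat \<Rightarrow> vertex option) \<Rightarrow> vertex option measure" where
  "walk_kernel e i h =
     (if i = 0 then measure_pmf (return_pmf (Some [])) else measure_pmf (step e (h (i - 1))))"

definition walk_law :: "env \<Rightarrow> (nat \<Rightarrow> vertex option) measure" where
  "walk_law e =
     projective_family.lim UNIV
       (Ionescu_Tulcea.CI (walk_kernel e) (\<lambda>_. count_space UNIV)) (\<lambda>_. count_space UNIV)"

lemma walk_IT: "Ionescu_Tulcea (walk_kernel e) (\<lambda>_. count_space UNIV)"
  unfolding Ionescu_Tulcea_def
proof (intro conjI allI impI)
  fix i
  show "walk_kernel e i \<in>
      measurable (PiM {0..<i} (\<lambda>_. count_space UNIV)) (subprob_algebra (count_space UNIV))"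
  proof (cases "i = 0")
    case True
    have "walk_kernel e i = (\<lambda>_. measure_pmf (return_pmf (Some [] :: vertex option)))"
      by (auto simp: walk_kernel_def True)
    then show ?thesis by (simp add: measure_pmf_in_subprob_space)
  next
    case False
    have eq: "walk_kernel e i = (\<lambda>s. measure_pmf (step e s)) \<circ> (\<lambda>h. h (i - 1))"
      using False by (auto simp: walk_kernel_def)
    show ?thesis
      unfolding eq
      by (rule measurable_comp[of _ _ "count_space UNIV"])
        (use False in \<open>auto intro!: measurable_component_singleton
          simp: measure_pmf_in_subprob_space\<close>)
  qed
qed (simp add: walk_kernel_def measure_pmf.prob_space_axioms)

lemma sets_walk_law: "sets (walk_law e) = sets path_space"
proof -
  interpret Ionescu_Tulcea "walk_kernel e" "\<lambda>_. count_space UNIV" by (rule walk_IT)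
  show ?thesis unfolding walk_law_def by simp
qed

lemma prob_space_walk_law: "prob_space (walk_law e)"
proof -
  interpret Ionescu_Tulcea "walk_kernel e" "\<lambda>_. count_space UNIV" by (rule walk_IT)
  have "emeasure (walk_law e) (PF.emb UNIV {} (space (PiM {} (\<lambda>_. count_space UNIV)))) =
      emeasure (CI {}) (space (PiM {} (\<lambda>_. count_space UNIV)))"
    unfolding walk_law_def by (rule lim) auto
  also have "\<dots> = 1"
    using prob_space.emeasure_space_1[OF PF.prob_space_P[of "{}"]]
    by (simp add: PF.space_P)
  also have "PF.emb UNIV {} (space (PiM {} (\<lambda>_. count_space UNIV))) = space (walk_law e)"
    by (auto simp: prod_emb_def space_PiM sets_eq_imp_space_eq[OF sets_walk_law] restrict_def)
  finally show ?thesis by (rule prob_spaceI)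
qed

lemma emeasure_walk_law:
  "emeasure (walk_law e) {X. \<forall>i\<le>n. X i = x i} =
     (if x 0 = Some [] then \<Prod>i<n. ennreal (step_prob e (x i) (x (Suc i))) else 0)"
proof -
  interpret Ionescu_Tulcea "walk_kernel e" "\<lambda>_. count_space UNIV" by (rule walk_IT)
  let ?N = "\<lambda>_::nat. count_space (UNIV :: vertex option set)"
  define A where "A m = PiE {0..<m} (\<lambda>i. {x i})" for m
  define q where "q m = emeasure (walk_kernel e m x) {x m}" for m
  have A_sets [measurable]: "A m \<in> sets (PiM {0..<m} ?N)" for m
    unfolding A_def by (rule sets_PiM_I_finite) auto
  have C: "emeasure (C 0 m (\<lambda>_. undefined)) (A m) = (\<Prod>i<m. q i)" for m
  proof (induction m)
    case 0
    have "{\<lambda>_. undefined} \<in> sets (PiM {} ?N)" using A_sets[of 0] by (simp add: A_def)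
    then show ?case by (simp add: A_def emeasure_return)
  next
    case (Suc m)
    have u: "(\<lambda>_. undefined) \<in> space (PiM {0..<0} ?N)" by (simp add: space_PiM)
    have "emeasure (C 0 (Suc m) (\<lambda>_. undefined)) (A (Suc m)) =
        (\<integral>\<^sup>+h. emeasure (eP m h) (A (Suc m)) \<partial>C 0 m (\<lambda>_. undefined))"
      using prob_space.not_empty[OF prob_space_C[OF u, of m]] measurable_eP[of m]
      by (simp add: emeasure_bind[where N = "PiM {0..<Suc m} ?N"]
          measurable_cong_sets[OF sets_C[OF u, of m] refl])
    also have "\<dots> = (\<integral>\<^sup>+h. q m * indicator (A m) h \<partial>C 0 m (\<lambda>_. undefined))"
    proof (rule nn_integral_cong)
      fix h assume "h \<in> space (C 0 m (\<lambda>_. undefined))"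
      then have h: "h \<in> space (PiM {0..<m} ?N)" by (simp add: space_C[OF u])
      have hm: "h m = undefined" using h by (simp add: space_PiM PiE_iff extensional_def)
      have ext: "h \<in> extensional {0..<m}" using h by (simp add: space_PiM PiE_iff)
      have "emeasure (eP m h) (A (Suc m)) =
          emeasure (walk_kernel e m h) ((\<lambda>s. h(m := s)) -` A (Suc m) \<inter> UNIV)"
        using emeasure_eP[OF h A_sets] by simp
      also have "(\<lambda>s. h(m := s)) -` A (Suc m) \<inter> UNIV = (if h \<in> A m then {x m} else {})"
      proof -
        have "h(m := s) \<in> A (Suc m) \<longleftrightarrow> h \<in> A m \<and> s = x m" for s
          using ext unfolding A_def PiE_iff
          by (auto simp: extensional_def atLeastLessThanSuc)
        then show ?thesis by auto
      qed
      also have "emeasure (walk_kernel e m h) \<dots> = q m * indicator (A m) h"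
      proof (cases "h \<in> A m")
        case True
        then have "m = 0 \<or> h (m - 1) = x (m - 1)"
          unfolding A_def by (auto simp: PiE_iff)
        then have "walk_kernel e m h = walk_kernel e m x"
          by (auto simp: walk_kernel_def)
        then show ?thesis using True by (simp add: q_def)
      qed simp
      finally show "emeasure (eP m h) (A (Suc m)) = q m * indicator (A m) h" .
    qed
    also have "\<dots> = q m * emeasure (C 0 m (\<lambda>_. undefined)) (A m)"
      by (rule nn_integral_cmult_indicator) (use sets_C[OF u, of m] in simp)
    finally show ?case using Suc by (simp add: mult.commute)
  qed
  have "{X. \<forall>i\<le>n. X i = x i} = PF.emb UNIV {0..<Suc n} (A (Suc n))"
    by (auto simp: prod_emb_def A_def PiE_iff space_PiM)
  then have "emeasure (walk_law e) {X. \<forall>i\<le>n. X i = x i} = emeasure (CI {0..<Suc n}) (A (Suc n))"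
    unfolding walk_law_def using lim[of "{0..<Suc n}" "A (Suc n)"] by simp
  also have "\<dots> = emeasure (C 0 (Suc n) (\<lambda>_. undefined)) (A (Suc n))"
    using emeasure_CI[of "{0..<Suc n}" "Suc n" "A (Suc n)"]
      sets.sets_into_space[OF A_sets[of "Suc n"]]
    by (simp add: prod_emb_id space_PiM)
  also have "\<dots> = (\<Prod>i<Suc n. q i)" by (rule C)
  also have "\<dots> = q 0 * (\<Prod>i<n. q (Suc i))" by (rule prod.lessThan_Suc_shift)
  also have "q 0 = (if x 0 = Some [] then 1 else 0)"
    by (simp add: q_def walk_kernel_def indicator_def)
  also have "(\<Prod>i<n. q (Suc i)) = (\<Prod>i<n. ennreal (step_prob e (x i) (x (Suc i))))"
    by (simp add: q_def walk_kernel_def emeasure_pmf_single pmf_step)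
  finally show ?thesis by simp
qed

section \<open>The range\<close>

fun return_time :: "(nat \<Rightarrow> vertex option) \<Rightarrow> nat \<Rightarrow> enat" where
  "return_time X 0 = 0"
| "return_time X (Suc j) = Inf (enat ` {i. return_time X j < enat i \<and> X i = None})"

definition walk_range :: "env \<Rightarrow> (nat \<Rightarrow> vertex option) \<Rightarrow> enat \<Rightarrow> vertex set" where
  "walk_range e X T = {u \<in> tree e. \<exists>j\<ge>1. enat j \<le> T \<and> X j = Some u}"

text \<open>Number of vertices of generation \<open>l\<close> visited up to the \<open>\<lfloor>\<surd>n\<rfloor>\<close>-th visit to the extra parent.\<close>

definition R :: "env \<Rightarrow> (nat \<Rightarrow> vertex option) \<Rightarrow> nat \<Rightarrow> nat \<Rightarrow> real" where
  "R e X n l =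
     (\<Sum>z\<in>gen e l. indicator (walk_range e X (return_time X (nat \<lfloor>sqrt (real n)\<rfloor>))) z)"

section \<open>Annealed probability and convergence\<close>

text \<open>
  An event is a predicate of the sample point \<open>\<omega>\<close> carrying the environment and the trajectory
  \<open>X\<close>; its annealed probability is the mean of its quenched probability under \<open>P_star\<close>.
\<close>

definition annealed_prob ::
    "'w measure \<Rightarrow> ('w \<Rightarrow> env) \<Rightarrow> ('w \<Rightarrow> (nat \<Rightarrow> vertex option) \<Rightarrow> bool) \<Rightarrow> ennreal" where
  "annealed_prob M Env Q =
     (\<integral>\<^sup>+\<omega>. emeasure (walk_law (Env \<omega>)) {X \<in> space (walk_law (Env \<omega>)). Q \<omega> X} \<partial>P_star M Env)"

definition converges_in_annealed_prob ::
    "'w measure \<Rightarrow> ('w \<Rightarrow> env) \<Rightarrow> (nat \<Rightarrow> 'w \<Rightarrow> (nat \<Rightarrow> vertex option) \<Rightarrow> real) \<Rightarrow>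
      ('w \<Rightarrow> real) \<Rightarrow> bool" where
  "converges_in_annealed_prob M Env Y Z \<longleftrightarrow>
     (\<forall>\<epsilon>>0. (\<lambda>n. annealed_prob M Env (\<lambda>\<omega> X. \<bar>Y n \<omega> X - Z \<omega>\<bar> > \<epsilon>)) \<longlonglongrightarrow> 0)"

text \<open>
  Only used along arguments tending to infinity, so the totalised values of \<open>ln\<close> on \<open>(-\<infinity>, 0]\<close> play
  no role.
\<close>

fun iter_log :: "nat \<Rightarrow> real \<Rightarrow> real" where
  "iter_log 0 t = t"
| "iter_log (Suc i) t = ln (iter_log i t)"

end

theory Submission
  imports Defs "HOL-Real_Asymp.Real_Asymp"
begin

text \<open>
  Because \<open>2 < \<kappa>\<close>, the range has second moments of the right order, and the theorem is a law of large
  numbers that holds at every single level of the window; averaging over levels comes for free.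

  Give the edge that leads to a vertex \<open>v\<close> the resistance \<open>exp (V v)\<close>, and let \<open>res z\<close> be the resistance
  between the extra parent and \<open>z\<close>. An excursion from the extra parent visits \<open>z\<close> with probability
  \<open>1 / res z\<close>, so the first \<open>k = \<lfloor>\<surd>n\<rfloor>\<close> excursions discover on average about \<open>k * green l\<close> vertices of
  generation \<open>l\<close>, where \<open>green l\<close> is the sum of \<open>1 / res z\<close> over that generation. Two errors have to be
  controlled (\<open>quenched_second_moment\<close>). A vertex may be visited by several excursions; but beyond
  generation \<open>ln n / \<delta>\<^sub>0\<close> the potential is, with high probability, at least \<open>3 ln n\<close> up to rounding, so
  this is rare. And one excursion
  discovers a random number of vertices, whose second moment is at most twice the \<open>pair_energy\<close> of
  the level. Since \<open>\<kappa> > 2\<close> forces \<open>psi 2 < 0\<close>, the mean of \<open>pair_energy\<close> at generation \<open>l\<close> grows only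
  linearly in \<open>l\<close> (\<open>mean_pair_energy\<close>), and the variance of the range divided by \<open>k\<close> is of order
  \<open>l / k\<close>. This tends to \<open>0\<close> because \<open>L n = o(\<surd>n)\<close>, which is what the condition with iterated logarithms
  yields, an iterated logarithm of \<open>L n\<close> being unbounded.

  It remains to see that \<open>green l\<close> converges to \<open>c_inf * W_inf\<close> (\<open>green_tendsto\<close>). Along a line of
  descent the quantity \<open>pot = exp (- V) * res\<close> evolves by \<open>h \<mapsto> 1 + exp (- a) * h\<close>, and \<open>green l\<close> is the
  sum of \<open>exp (- V) / pot\<close>. Replacing, one generation at a time, the terminal function \<open>g\<close> by its
  one-step mean \<open>T g\<close> costs an error whose second moment decays geometrically in the generation. Hence
  \<open>green l\<close> is close to the sum over a fixed generation \<open>i\<close> of \<open>exp (- V) * (T ^^ (l - i)) (1 / h) pot\<close>. In terms of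
  the associated walk the iterates of \<open>T\<close> are means of \<open>1 / (\<Sum>j<n. exp (- S j) + exp (- S n) * h)\<close>, and
  they converge to \<open>c_inf\<close> whatever \<open>h\<close> is; so the sum is close to \<open>c_inf * W i\<close>.

  Exact hitting probabilities need recurrence of the walk (\<open>walk_recurrent\<close>). It follows from the
  boundedness of the additive martingale by an energy argument.
\<close>

section \<open>Supermartingales of the quenched walk\<close>

text \<open>
  The law of the initial path, built by appending one step at a time, so that the last step can be
  integrated out given the others.
\<close>

primrec path_pmf :: "env \<Rightarrow> nat \<Rightarrow> vertex option list pmf" where
  "path_pmf e 0 = return_pmf [Some []]"
| "path_pmf e (Suc n) =
     path_pmf e n \<bind> (\<lambda>xs. map_pmf (\<lambda>t. xs @ [t]) (step e (last xs)))"

abbreviation path_upto :: "nat \<Rightarrow> (nat \<Rightarrow> 'a) \<Rightarrow> 'a list" where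
  "path_upto n X \<equiv> map X [0..<Suc n]"

lemma space_walk_law [simp]: "space (walk_law e) = UNIV"
  using sets_eq_imp_space_eq[OF sets_walk_law[of e]] by (simp add: space_PiM)

lemma measurable_walk_coordinate [measurable]:
  "(\<lambda>X. X i) \<in> walk_law e \<rightarrow>\<^sub>M count_space UNIV"
  by (subst measurable_cong_sets[OF sets_walk_law refl]) measurable

lemma measurable_path_upto [measurable]: "path_upto n \<in> walk_law e \<rightarrow>\<^sub>M count_space UNIV"
proof (rule iffD2[OF measurable_count_space_eq_countable[OF countableI_type]], safe)
  fix xs :: "vertex option list"
  have "path_upto n -` {xs} \<inter> space (walk_law e) =
      {X \<in> space (walk_law e). length xs = Suc n \<and> (\<forall>i\<le>n. X i = xs ! i)}"
    by (auto simp: list_eq_iff_nth_eq less_Suc_eq_le simp del: upt_Suc)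
  also have "\<dots> \<in> sets (walk_law e)" by measurable
  finally show "path_upto n -` {xs} \<inter> space (walk_law e) \<in> sets (walk_law e)" .
qed auto

lemma pmf_path_pmf:
  "pmf (path_pmf e n) xs =
     (if length xs = Suc n \<and> xs ! 0 = Some [] then \<Prod>i<n. step_prob e (xs ! i) (xs ! Suc i) else 0)"
proof (induction n arbitrary: xs)
  case 0
  show ?case by (cases xs) (auto simp: pmf_return)
next
  case (Suc n)
  have eq: "ennreal (pmf (path_pmf e (Suc n)) xs) =
      (\<integral>\<^sup>+ys. ennreal (pmf (map_pmf (\<lambda>t. ys @ [t]) (step e (last ys))) xs) \<partial>path_pmf e n)"
    by (simp add: ennreal_pmf_bind)
  show ?case
  proof (cases xs rule: rev_cases)
    case Nil
    have "pmf (map_pmf (\<lambda>t. ys @ [t]) (step e (last ys))) xs = 0" for ys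
      by (rule pmf_map_outside) (auto simp: Nil)
    then show ?thesis using eq by (simp add: Nil)
  next
    case (snoc ys t)
    have "pmf (map_pmf (\<lambda>t. zs @ [t]) (step e (last zs))) xs =
        step_prob e (last ys) t * indicator {ys} zs" for zs
    proof (cases "zs = ys")
      case True
      have "pmf (map_pmf (\<lambda>t. ys @ [t]) (step e (last ys))) (ys @ [t]) = pmf (step e (last ys)) t"
        by (rule pmf_map_inj') (auto simp: inj_def)
      then show ?thesis by (simp add: True snoc pmf_step)
    next
      case False
      then show ?thesis by (intro trans[OF pmf_map_outside]) (auto simp: snoc)
    qed
    then have "ennreal (pmf (path_pmf e (Suc n)) xs) =
        (\<integral>\<^sup>+zs. ennreal (step_prob e (last ys) t) * indicator {ys} zs \<partial>path_pmf e n)"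
      unfolding eq by (intro nn_integral_cong) (simp add: indicator_def)
    also have "\<dots> = ennreal (step_prob e (last ys) t) * ennreal (pmf (path_pmf e n) ys)"
      by (subst nn_integral_cmult_indicator) (auto simp: emeasure_pmf_single)
    also have "\<dots> = ennreal (step_prob e (last ys) t * pmf (path_pmf e n) ys)"
      using pmf_nonneg[of "step e (last ys)" t] by (simp add: ennreal_mult' pmf_step)
    finally have "pmf (path_pmf e (Suc n)) xs = step_prob e (last ys) t * pmf (path_pmf e n) ys"
      using pmf_nonneg[of "step e (last ys)" t] by (simp add: pmf_step)
    moreover have "step_prob e (last ys) t = step_prob e (xs ! n) (xs ! Suc n)"
      if "length ys = Suc n"
      using that by (cases ys rule: rev_cases) (auto simp: snoc nth_append)
    moreover have "(\<Prod>i<n. step_prob e (ys ! i) (ys ! Suc i)) =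
        (\<Prod>i<n. step_prob e (xs ! i) (xs ! Suc i))" if "length ys = Suc n"
      using that by (intro prod.cong) (auto simp: snoc nth_append)
    ultimately show ?thesis
      unfolding Suc by (auto simp: snoc nth_append)
  qed
qed

lemma distr_path_upto: "distr (walk_law e) (count_space UNIV) (path_upto n) = measure_pmf (path_pmf e n)"
proof (rule measure_eqI_countable[OF _ _ countableI_type])
  fix xs :: "vertex option list"
  have "emeasure (distr (walk_law e) (count_space UNIV) (path_upto n)) {xs} =
      emeasure (walk_law e) (path_upto n -` {xs})"
    by (subst emeasure_distr) (auto simp del: upt_Suc)
  also have "\<dots> = ennreal (pmf (path_pmf e n) xs)"
  proof (cases "length xs = Suc n")
    case True
    then have "path_upto n -` {xs} = {X. \<forall>i\<le>n. X i = xs ! i}"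
      by (auto simp: list_eq_iff_nth_eq less_Suc_eq_le simp del: upt_Suc)
    then have "emeasure (walk_law e) (path_upto n -` {xs}) =
        (if xs ! 0 = Some [] then \<Prod>i<n. ennreal (step_prob e (xs ! i) (xs ! Suc i)) else 0)"
      by (simp only: emeasure_walk_law)
    also have "\<dots> = ennreal (pmf (path_pmf e n) xs)"
      using pmf_nonneg[of "step e s" t for s t]
      by (simp add: pmf_path_pmf True prod_ennreal pmf_step)
    finally show ?thesis .
  next
    case False
    then have "path_upto n -` {xs} = {}" by auto
    then show ?thesis using False by (simp add: pmf_path_pmf)
  qed
  finally show "emeasure (distr (walk_law e) (count_space UNIV) (path_upto n)) {xs} =
      emeasure (measure_pmf (path_pmf e n)) {xs}"
    by (simp add: emeasure_pmf_single)
qed auto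

definition adapted :: "nat \<Rightarrow> ((nat \<Rightarrow> 'a) \<Rightarrow> 'b) \<Rightarrow> bool" where
  "adapted n h \<longleftrightarrow> (\<forall>X Y. (\<forall>i\<le>n. X i = Y i) \<longrightarrow> h X = h Y)"

lemma adapted_eq_path_upto:
  assumes "adapted n h"
  shows "h X = h (\<lambda>i. path_upto n X ! i)"
  using assms unfolding adapted_def
  by (metis (no_types, lifting) add_0 diff_zero length_upt less_Suc_eq_le nth_map nth_upt)

lemma adapted_measurable:
  assumes "adapted n h" and "range h \<subseteq> space N"
  shows "h \<in> walk_law e \<rightarrow>\<^sub>M N"
proof -
  have "(\<lambda>X. h (\<lambda>i. path_upto n X ! i)) \<in> walk_law e \<rightarrow>\<^sub>M N"
    by (rule measurable_compose[OF measurable_path_upto]) (use assms in auto)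
  then show ?thesis using adapted_eq_path_upto[OF assms(1)] by (simp cong: measurable_cong)
qed

text \<open>
  The Markov property, in the form of a conditional expectation given all coordinates but the last.
\<close>

lemma walk_law_step:
  fixes h :: "(nat \<Rightarrow> vertex option) \<Rightarrow> ennreal"
  assumes "adapted (Suc n) h"
  shows "(\<integral>\<^sup>+X. h X \<partial>walk_law e) =
    (\<integral>\<^sup>+X. (\<integral>\<^sup>+t. h (X(Suc n := t)) \<partial>step e (X n)) \<partial>walk_law e)"
proof -
  have "(\<integral>\<^sup>+X. h X \<partial>walk_law e) = (\<integral>\<^sup>+X. h (\<lambda>i. path_upto (Suc n) X ! i) \<partial>walk_law e)"
    using adapted_eq_path_upto[OF assms] by (simp cong: nn_integral_cong)
  also have "\<dots> = (\<integral>\<^sup>+xs. h (\<lambda>i. xs ! i) \<partial>distr (walk_law e) (count_space UNIV) (path_upto (Suc n)))"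
    by (rule nn_integral_distr[symmetric]) (auto simp del: upt_Suc)
  also have "\<dots> = (\<integral>\<^sup>+xs. (\<integral>\<^sup>+t. h (\<lambda>i. (xs @ [t]) ! i) \<partial>step e (last xs)) \<partial>path_pmf e n)"
    unfolding distr_path_upto by simp
  also have "\<dots> = (\<integral>\<^sup>+X. (\<integral>\<^sup>+t. h (\<lambda>i. (path_upto n X @ [t]) ! i) \<partial>step e (last (path_upto n X)))
      \<partial>walk_law e)"
    unfolding distr_path_upto[symmetric] by (rule nn_integral_distr) (auto simp del: upt_Suc)
  also have "\<dots> = (\<integral>\<^sup>+X. (\<integral>\<^sup>+t. h (X(Suc n := t)) \<partial>step e (X n)) \<partial>walk_law e)"
  proof (intro nn_integral_cong)
    fix X :: "nat \<Rightarrow> vertex option"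
    have "h (\<lambda>i. (path_upto n X @ [t]) ! i) = h (X(Suc n := t))" for t
      by (rule assms[unfolded adapted_def, rule_format])
        (auto simp: nth_append less_Suc_eq_le le_Suc_eq simp del: upt_Suc)
    then show "(\<integral>\<^sup>+t. h (\<lambda>i. (path_upto n X @ [t]) ! i) \<partial>step e (last (path_upto n X))) =
        (\<integral>\<^sup>+t. h (X(Suc n := t)) \<partial>step e (X n))" by simp
  qed
  finally show ?thesis .
qed

lemma AE_walk_start: "AE X in walk_law e. X 0 = Some []"
proof -
  interpret prob_space "walk_law e" by (rule prob_space_walk_law)
  have "emeasure (walk_law e) {X. \<forall>i\<le>0. X i = Some []} = 1"
    using emeasure_walk_law[of e 0 "\<lambda>_. Some []"] by simp
  then show ?thesis by (subst AE_iff_emeasure_eq_1) auto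
qed

text \<open>
  The source of all bounds on quenched probabilities: to bound the probability of an event decided by time
  \<open>n\<close>, exhibit a supermartingale that is at least the indicator of the event at time \<open>n\<close>. Stopping is
  encoded in \<open>h\<close> itself, which becomes constant once the outcome is known.
\<close>

lemma walk_supermartingale:
  fixes h :: "nat \<Rightarrow> (nat \<Rightarrow> vertex option) \<Rightarrow> ennreal"
  assumes adapted: "\<And>n. adapted n (h n)"
    and super: "\<And>n X. (\<integral>\<^sup>+t. h (Suc n) (X(Suc n := t)) \<partial>step e (X n)) \<le> h n X"
    and start: "\<And>X. X 0 = Some [] \<Longrightarrow> h 0 X \<le> c"
  shows "(\<integral>\<^sup>+X. h n X \<partial>walk_law e) \<le> c"
proof -
  interpret prob_space "walk_law e" by (rule prob_space_walk_law)
  have "(\<integral>\<^sup>+X. h n X \<partial>walk_law e) \<le> (\<integral>\<^sup>+X. h 0 X \<partial>walk_law e)"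
  proof (induction n)
    case (Suc n)
    have "(\<integral>\<^sup>+X. h (Suc n) X \<partial>walk_law e) \<le> (\<integral>\<^sup>+X. h n X \<partial>walk_law e)"
      by (subst walk_law_step[OF adapted]) (intro nn_integral_mono super)
    also note Suc
    finally show ?case .
  qed simp
  also have "\<dots> \<le> (\<integral>\<^sup>+X. c \<partial>walk_law e)"
  proof (rule nn_integral_mono_AE)
    show "AE X in walk_law e. h 0 X \<le> c"
      using AE_walk_start by eventually_elim (rule start)
  qed
  finally show ?thesis using emeasure_space_1 by simp
qed

lemma nn_integral_step_Some:
  fixes \<phi> :: "vertex option \<Rightarrow> real"
  assumes "\<And>t. 0 \<le> \<phi> t"
  shows "(\<integral>\<^sup>+t. ennreal (\<phi> t) \<partial>step e (Some x)) =
    ennreal ((exp (- V e x) * \<phi> (parent x) +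
      (\<Sum>y\<in>children e x. exp (- V e y) * \<phi> (Some y))) / total_weight e x)"
proof -
  let ?F = "insert (parent x) (Some ` children e x)"
  have nonneg: "0 \<le> step_prob e (Some x) t" for t
    using pmf_nonneg[of "step e (Some x)" t] by (simp only: pmf_step)
  have notin: "Some y \<noteq> parent x" if "y \<in> children e x" for y
    using parent_not_child[of x e] that by (metis image_eqI)
  have "(\<integral>\<^sup>+t. ennreal (\<phi> t) \<partial>step e (Some x)) =
      (\<integral>\<^sup>+t. ennreal (step_prob e (Some x) t * \<phi> t) \<partial>count_space UNIV)"
    by (subst nn_integral_measure_pmf) (auto simp: pmf_step ennreal_mult' nonneg assms
        simp del: step_prob.simps)
  also have "\<dots> = (\<Sum>t\<in>?F. ennreal (step_prob e (Some x) t * \<phi> t))"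
    by (rule nn_integral_count_space') auto
  also have "\<dots> = ennreal (\<Sum>t\<in>?F. step_prob e (Some x) t * \<phi> t)"
    by (rule sum_ennreal) (intro mult_nonneg_nonneg nonneg assms)
  also have "(\<Sum>t\<in>?F. step_prob e (Some x) t * \<phi> t) =
      step_prob e (Some x) (parent x) * \<phi> (parent x) +
      (\<Sum>y\<in>children e x. step_prob e (Some x) (Some y) * \<phi> (Some y))"
    by (subst sum.insert) (auto simp: sum.reindex)
  also have "(\<Sum>y\<in>children e x. step_prob e (Some x) (Some y) * \<phi> (Some y)) =
      (\<Sum>y\<in>children e x. exp (- V e y) / total_weight e x * \<phi> (Some y))"
    by (intro sum.cong) (auto simp: notin)
  finally show ?thesis
    by (simp add: sum_divide_distrib add_divide_distrib)
qed

lemma nn_integral_step_None: "(\<integral>\<^sup>+t. \<phi> t \<partial>step e None) = \<phi> (Some [])"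
proof -
  have "step e None = return_pmf (Some [])"
    by (rule pmf_eqI) (simp add: pmf_step pmf_return indicator_def eq_commute)
  then show ?thesis by simp
qed

section \<open>Hitting probabilities and effective resistances\<close>

text \<open>
  The lengths of the common ancestors of two vertices. Working with this set avoids naming the most
  recent common ancestor.
\<close>

definition common :: "vertex \<Rightarrow> vertex \<Rightarrow> nat set" where
  "common x z = {k. k \<le> length x \<and> k \<le> length z \<and> take k x = take k z}"

text \<open>
  The resistance of the common part of the paths from the extra parent to \<open>x\<close> and to \<open>z\<close>, the edge that
  leads to \<open>v\<close> having resistance \<open>exp (V e v)\<close>.
\<close>

definition res_common :: "env \<Rightarrow> vertex \<Rightarrow> vertex \<Rightarrow> real" where
  "res_common e x z = (\<Sum>k\<in>common x z. exp (V e (take k x)))"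

definition res :: "env \<Rightarrow> vertex \<Rightarrow> real" where
  "res e x = (\<Sum>k\<le>length x. exp (V e (take k x)))"

text \<open>
  The voltage when \<open>z\<close> is held at \<open>1\<close> and the extra parent at \<open>0\<close>. It is the probability of visiting
  \<open>z\<close> before the extra parent; on a tree it is explicit, since it is constant off the path to \<open>z\<close>.
\<close>

fun hit :: "env \<Rightarrow> vertex \<Rightarrow> vertex option \<Rightarrow> real" where
  "hit e z None = 0"
| "hit e z (Some x) = res_common e x z / res e z"

lemma finite_common [simp]: "finite (common x z)"
  by (rule finite_subset[of _ "{..length x}"]) (auto simp: common_def)

lemma common_commute: "common x z = common z x"
  by (auto simp: common_def)

lemma res_common_commute: "res_common e x z = res_common e z x"
  unfolding res_common_def by (rule sum.cong[OF common_commute]) (auto simp: common_def)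

lemma common_self [simp]: "common x x = {..length x}"
  by (auto simp: common_def)

lemma res_common_self: "res_common e x x = res e x"
  by (simp add: res_common_def res_def)

lemma res_common_nonneg: "0 \<le> res_common e x z"
  by (simp add: res_common_def sum_nonneg)

lemma res_common_le: "res_common e x z \<le> res e z"
proof -
  have "res_common e z x \<le> res e z"
    unfolding res_common_def res_def by (rule sum_mono2) (auto simp: common_def)
  then show ?thesis by (simp add: res_common_commute)
qed

lemma exp_V_le_res: "exp (V e x) \<le> res e x"
  using member_le_sum[of "length x" "{..length x}" "\<lambda>k. exp (V e (take k x))"]
  by (simp add: res_def)

lemma res_pos [simp]: "0 < res e x"
  using exp_V_le_res[of e x] by (meson exp_gt_zero less_le_trans)

lemma V_Nil [simp]: "V e [] = 0"
  by (simp add: V_def)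

lemma V_snoc: "V e (x @ [i]) = V e x + e x ! i"
  by (simp add: V_def nth_append)

lemma res_Nil [simp]: "res e [] = 1"
  by (simp add: res_def)

lemma res_snoc: "res e (x @ [i]) = res e x + exp (V e (x @ [i]))"
  by (simp add: res_def)

lemma take_length_eq_iff: "take (length x) z = x \<longleftrightarrow> length x \<le> length z \<and> take (length x) x = take (length x) z"
  by (auto dest: arg_cong[of _ _ length])

lemma common_snoc:
  "common (x @ [i]) z =
     (if take (Suc (length x)) z = x @ [i] then insert (Suc (length x)) (common x z) else common x z)"
  using take_length_eq_iff[of "x @ [i]" z]
  by (auto simp: common_def le_Suc_eq)

lemma res_common_snoc:
  "res_common e (x @ [i]) z =
     res_common e x z + (if take (Suc (length x)) z = x @ [i] then exp (V e (x @ [i])) else 0)"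
proof -
  have "(\<Sum>k\<in>common x z. exp (V e (take k (x @ [i])))) = res_common e x z"
    unfolding res_common_def by (rule sum.cong) (auto simp: common_def)
  moreover have "Suc (length x) \<notin> common x z" by (simp add: common_def)
  ultimately show ?thesis
    unfolding res_common_def[of _ "x @ [i]"] common_snoc by simp
qed

lemma res_common_Nil [simp]: "res_common e [] z = 1"
proof -
  have "common [] z = {0}" by (auto simp: common_def)
  then show ?thesis by (simp add: res_common_def)
qed

lemma hit_nonneg: "0 \<le> hit e z s"
  by (cases s) (auto intro!: divide_nonneg_pos res_common_nonneg)

lemma hit_le_1: "hit e z s \<le> 1"
  by (cases s) (auto simp: res_common_le)

lemma hit_self [simp]: "hit e z (Some z) = 1"
  using res_pos[of e z] by (simp add: res_common_self del: res_pos)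

lemma hit_parent:
  "hit e z (parent x) = hit e z (Some x) - (if take (length x) z = x then exp (V e x) / res e z else 0)"
proof (cases x rule: rev_cases)
  case (snoc y i)
  then show ?thesis by (simp add: parent_def res_common_snoc add_divide_distrib)
qed (simp add: parent_def)

lemma hit_child:
  "hit e z (Some (x @ [i])) =
     hit e z (Some x) + (if take (Suc (length x)) z = x @ [i] then exp (V e (x @ [i])) / res e z else 0)"
  by (simp add: res_common_snoc add_divide_distrib)

lemma sum_children: "(\<Sum>y\<in>children e x. f y) = (\<Sum>i<length (e x). f (x @ [i]))"
  unfolding children_def by (subst sum.reindex) (auto simp: inj_on_def)

text \<open>
  Current balance: a current of strength \<open>1 / res e z\<close> flows along the path between \<open>z\<close> and the extra
  parent, so the voltage is harmonic at every vertex other than \<open>z\<close>.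
\<close>

lemma hit_average:
  assumes "z \<in> tree e"
  shows "(exp (- V e x) * hit e z (parent x) +
      (\<Sum>y\<in>children e x. exp (- V e y) * hit e z (Some y))) / total_weight e x =
    hit e z (Some x) - (if x = z then 1 / (res e z * total_weight e x) else 0)"
proof -
  define g where "g = hit e z (Some x)"
  define A :: real where "A = (if take (length x) z = x then 1 else 0)"
  define B :: real where "B = (\<Sum>i<length (e x). if take (Suc (length x)) z = x @ [i] then 1 else 0)"
  have 1: "exp (- V e x) * hit e z (parent x) = exp (- V e x) * g - A / res e z"
    by (simp add: hit_parent A_def g_def right_diff_distrib flip: exp_add del: hit.simps)
  have "(\<Sum>y\<in>children e x. exp (- V e y) * hit e z (Some y)) =
      (\<Sum>i<length (e x). exp (- V e (x @ [i])) * g +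
        (if take (Suc (length x)) z = x @ [i] then 1 else 0) / res e z)"
    unfolding sum_children hit_child
    by (intro sum.cong) (auto simp: g_def distrib_left simp flip: exp_add simp del: hit.simps)
  also have "\<dots> = (\<Sum>y\<in>children e x. exp (- V e y)) * g + B / res e z"
    by (simp add: sum.distrib sum_distrib_right sum_divide_distrib B_def sum_children)
  finally have 2: "(\<Sum>y\<in>children e x. exp (- V e y) * hit e z (Some y)) =
      (\<Sum>y\<in>children e x. exp (- V e y)) * g + B / res e z" .
  \<comment> \<open>The unit current leaves each ancestor of \<open>z\<close> through exactly one child, except \<open>z\<close> itself.\<close>
  have B: "B = (if length x < length z \<and> take (length x) z = x then 1 else 0)"
  proof (cases "length x < length z \<and> take (length x) z = x")
    case True
    then have eq: "take (Suc (length x)) z = x @ [z ! length x]"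
      by (simp add: take_Suc_conv_app_nth)
    have "z ! length x < length (e x)"
      using assms True by (force simp: tree_def)
    moreover have "B = (\<Sum>i<length (e x). if i = z ! length x then 1 else 0)"
      unfolding B_def eq by (intro sum.cong) auto
    ultimately show ?thesis using True by simp
  next
    case False
    have "take (Suc (length x)) z \<noteq> x @ [i]" for i
    proof
      assume eq: "take (Suc (length x)) z = x @ [i]"
      then have "length x < length z" by (auto dest: arg_cong[of _ _ length])
      moreover from eq have "take (length x) (take (Suc (length x)) z) = x" by simp
      ultimately show False using False by (simp add: min_def)
    qed
    then show ?thesis using False by (simp add: B_def)
  qed
  have AB: "A - B = (if x = z then 1 else 0)"
    unfolding A_def B by (auto simp: take_length_eq_iff intro: antisym)
  have "exp (- V e x) * hit e z (parent x) +
      (\<Sum>y\<in>children e x. exp (- V e y) * hit e z (Some y)) =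
      total_weight e x * g - (A - B) / res e z"
    unfolding 1 2 total_weight_def by (simp add: algebra_simps diff_divide_distrib)
  moreover have "total_weight e x \<noteq> 0" using total_weight_pos[of e x] by linarith
  ultimately show ?thesis unfolding AB g_def by (simp add: diff_divide_distrib)
qed

lemma hit_superharmonic:
  assumes "z \<in> tree e"
  shows "(\<integral>\<^sup>+t. ennreal (hit e z t) \<partial>step e (Some x)) \<le> ennreal (hit e z (Some x))"
proof -
  have "0 \<le> 1 / (res e z * total_weight e x)"
    using res_pos[of e z] total_weight_pos[of e x] by (simp add: order_less_imp_le)
  then show ?thesis
    unfolding nn_integral_step_Some[of "hit e z", OF hit_nonneg] hit_average[OF assms]
    by (intro ennreal_leI) auto
qed

lemma hit_affine_super:
  assumes "z \<in> tree e" "0 \<le> a" "0 \<le> b"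
  shows "(\<integral>\<^sup>+t. ennreal (hit e z t * a + b) \<partial>step e (Some x)) \<le> ennreal (hit e z (Some x) * a + b)"
proof -
  have "(\<integral>\<^sup>+t. ennreal (hit e z t * a + b) \<partial>step e (Some x)) =
      (\<integral>\<^sup>+t. ennreal (hit e z t) * ennreal a + ennreal b \<partial>step e (Some x))"
    using assms hit_nonneg by (intro nn_integral_cong) (simp add: ennreal_plus ennreal_mult)
  also have "\<dots> = (\<integral>\<^sup>+t. ennreal (hit e z t) \<partial>step e (Some x)) * ennreal a + ennreal b"
    by (subst nn_integral_add) (auto simp: nn_integral_multc measure_pmf.emeasure_space_1)
  also have "\<dots> \<le> ennreal (hit e z (Some x)) * ennreal a + ennreal b"
    by (intro add_right_mono mult_right_mono hit_superharmonic assms) auto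
  also have "\<dots> = ennreal (hit e z (Some x) * a + b)"
    using assms hit_nonneg[of e z "Some x"] by (simp add: ennreal_plus ennreal_mult del: hit.simps)
  finally show ?thesis .
qed

lemma hit_complement_harmonic:
  assumes "z \<in> tree e" "x \<noteq> z" "0 \<le> a"
  shows "(\<integral>\<^sup>+t. ennreal ((1 - hit e z t) * a) \<partial>step e (Some x)) = ennreal ((1 - hit e z (Some x)) * a)"
proof -
  have w: "total_weight e x \<noteq> 0" using total_weight_pos[of e x] by linarith
  have "(exp (- V e x) * ((1 - hit e z (parent x)) * a) +
      (\<Sum>y\<in>children e x. exp (- V e y) * ((1 - hit e z (Some y)) * a))) =
    (total_weight e x - (exp (- V e x) * hit e z (parent x) +
      (\<Sum>y\<in>children e x. exp (- V e y) * hit e z (Some y)))) * a"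
    by (simp add: total_weight_def algebra_simps sum_subtractf sum_distrib_left del: hit.simps)
  then have "(exp (- V e x) * ((1 - hit e z (parent x)) * a) +
      (\<Sum>y\<in>children e x. exp (- V e y) * ((1 - hit e z (Some y)) * a))) / total_weight e x =
    (1 - (exp (- V e x) * hit e z (parent x) +
      (\<Sum>y\<in>children e x. exp (- V e y) * hit e z (Some y))) / total_weight e x) * a"
    using w by (simp add: field_simps del: hit.simps)
  then show ?thesis
    using nn_integral_step_Some[of "\<lambda>t. (1 - hit e z t) * a" e x] hit_le_1[of e z] assms(3)
      hit_average[OF assms(1), of x] assms(2)
    by (simp del: hit.simps)
qed

section \<open>Visits during the first excursions\<close>

primrec returns :: "nat \<Rightarrow> (nat \<Rightarrow> vertex option) \<Rightarrow> nat" where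
  "returns 0 X = 0"
| "returns (Suc n) X = returns n X + (if X (Suc n) = None then 1 else 0)"

definition visited :: "nat \<Rightarrow> vertex \<Rightarrow> nat \<Rightarrow> (nat \<Rightarrow> vertex option) \<Rightarrow> bool" where
  "visited k z n X \<longleftrightarrow> (\<exists>i\<le>n. X i = Some z \<and> returns i X < k)"

definition visited2 :: "nat \<Rightarrow> vertex \<Rightarrow> vertex \<Rightarrow> nat \<Rightarrow> (nat \<Rightarrow> vertex option) \<Rightarrow> bool" where
  "visited2 k a b n X \<longleftrightarrow> (\<exists>i\<le>n. X i = Some b \<and> returns i X < k \<and> visited k a i X)"

text \<open>
  How many of the first \<open>k\<close> excursions have not begun at time \<open>n\<close>. At the extra parent the next excursion
  is still to begin; at a vertex one excursion is under way.
\<close>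

definition fresh :: "nat \<Rightarrow> nat \<Rightarrow> (nat \<Rightarrow> vertex option) \<Rightarrow> nat" where
  "fresh k n X = (if X n = None then k - returns n X else k - returns n X - 1)"

lemma returns_cong: "(\<And>i. i \<le> n \<Longrightarrow> X i = Y i) \<Longrightarrow> returns n X = returns n Y"
  by (induction n) auto

lemma returns_mono: "m \<le> n \<Longrightarrow> returns m X \<le> returns n X"
  by (induction n) (auto simp: le_Suc_eq)

lemma visited_cong: "(\<And>i. i \<le> n \<Longrightarrow> X i = Y i) \<Longrightarrow> visited k z n X = visited k z n Y"
  unfolding visited_def by (metis le_trans returns_cong)

lemma visited2_cong: "(\<And>i. i \<le> n \<Longrightarrow> X i = Y i) \<Longrightarrow> visited2 k a b n X = visited2 k a b n Y"
  unfolding visited2_def by (metis le_trans returns_cong visited_cong)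

lemma fresh_cong: "(\<And>i. i \<le> n \<Longrightarrow> X i = Y i) \<Longrightarrow> fresh k n X = fresh k n Y"
  unfolding fresh_def by (simp cong: returns_cong)

lemma visited_Suc:
  "visited k z (Suc n) X \<longleftrightarrow> visited k z n X \<or> (X (Suc n) = Some z \<and> returns n X < k)"
  by (auto simp: visited_def le_Suc_eq)

lemma visited2_Suc:
  "visited2 k a b (Suc n) X \<longleftrightarrow> visited2 k a b n X \<or>
     (X (Suc n) = Some b \<and> returns n X < k \<and> (visited k a n X \<or> a = b))"
  by (auto simp: visited2_def le_Suc_eq visited_Suc)

lemma upd_past [simp]:
  "returns n (X(Suc n := t)) = returns n X"
  "visited k z n (X(Suc n := t)) = visited k z n X"
  "visited2 k a b n (X(Suc n := t)) = visited2 k a b n X"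
  by (auto intro!: returns_cong visited_cong visited2_cong)

lemma fresh_upd:
  "fresh k (Suc n) (X(Suc n := t)) = k - returns n X - 1"
  by (simp add: fresh_def)

text \<open>
  While undecided, \<open>(1 - hit e z (X n)) * (1 - 1 / res e z) ^ fresh k n X\<close> is the conditional probability
  of missing \<open>z\<close> in the current excursion and in all the fresh ones. It is a martingale because \<open>hit\<close> is
  harmonic away from \<open>z\<close>, and the passage through the extra parent starts one fresh excursion.
\<close>

lemma prob_unvisited_le:
  assumes z: "z \<in> tree e"
  shows "emeasure (walk_law e) {X. \<not> visited k z n X \<and> k \<le> returns n X} \<le>
    ennreal ((1 - 1 / res e z) ^ k)"
proof (cases "k = 0")
  case True
  interpret prob_space "walk_law e" by (rule prob_space_walk_law)
  show ?thesis using True measure_le_1 by simp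
next
  case False
  define p where "p = 1 / res e z"
  have p: "0 \<le> p" "p \<le> 1" "hit e z (Some []) = p"
    using hit_nonneg[of e z "Some []"] hit_le_1[of e z "Some []"] by (auto simp: p_def)
  define h where "h n X = ennreal (if visited k z n X then 0 else if k \<le> returns n X then 1
    else (1 - hit e z (X n)) * (1 - p) ^ fresh k n X)" for n X
  have "emeasure (walk_law e) {X. \<not> visited k z n X \<and> k \<le> returns n X} =
      (\<integral>\<^sup>+X. indicator {X. \<not> visited k z n X \<and> k \<le> returns n X} X \<partial>walk_law e)"
  proof (rule nn_integral_indicator[symmetric])
    have "(\<lambda>X. \<not> visited k z n X \<and> k \<le> returns n X) \<in> walk_law e \<rightarrow>\<^sub>M count_space UNIV"
      by (rule adapted_measurable[of n])
        (auto simp: adapted_def cong: visited_cong returns_cong)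
    then show "{X. \<not> visited k z n X \<and> k \<le> returns n X} \<in> sets (walk_law e)"
      by (simp add: pred_def)
  qed
  also have "\<dots> \<le> (\<integral>\<^sup>+X. h n X \<partial>walk_law e)"
    by (intro nn_integral_mono) (auto simp: h_def indicator_def)
  also have "\<dots> \<le> ennreal ((1 - p) ^ k)"
  proof (rule walk_supermartingale)
    fix n show "adapted n (h n)"
      unfolding adapted_def h_def
      by (intro allI impI) (simp cong: visited_cong returns_cong fresh_cong)
  next
    fix n X
    show "(\<integral>\<^sup>+t. h (Suc n) (X(Suc n := t)) \<partial>step e (X n)) \<le> h n X"
    proof (cases "visited k z n X \<or> k \<le> returns n X")
      case True
      have "(\<integral>\<^sup>+t. h (Suc n) (X(Suc n := t)) \<partial>step e (X n)) \<le> (\<integral>\<^sup>+t. h n X \<partial>step e (X n))"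
        using True by (intro nn_integral_mono) (auto simp: h_def visited_Suc)
      then show ?thesis using measure_pmf.emeasure_space_1[of "step e (X n)"] by simp
    next
      case False
      let ?m = "k - returns n X - 1"
      have q: "0 \<le> (1 - p) ^ ?m" using p by simp
      have "(\<integral>\<^sup>+t. h (Suc n) (X(Suc n := t)) \<partial>step e (X n)) \<le>
          (\<integral>\<^sup>+t. ennreal ((1 - hit e z t) * (1 - p) ^ ?m) \<partial>step e (X n))"
      proof (intro nn_integral_mono)
        fix t
        show "h (Suc n) (X(Suc n := t)) \<le> ennreal ((1 - hit e z t) * (1 - p) ^ ?m)"
          using False q hit_le_1[of e z t] unfolding h_def fresh_upd
          by (cases t) (auto intro!: ennreal_leI mult_nonneg_nonneg simp: visited_Suc simp del: hit.simps(2))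
      qed
      also have "\<dots> \<le> h n X"
      proof (cases "X n")
        case None
        have "k - returns n X = Suc ?m" using False by linarith
        then show ?thesis
          using False p None unfolding h_def
          by (simp add: nn_integral_step_None fresh_def del: hit.simps(2))
      next
        case (Some x)
        have "x \<noteq> z" using False Some by (auto simp: visited_def)
        then show ?thesis
          using False Some hit_complement_harmonic[OF z, of x "(1 - p) ^ ?m"] q
          unfolding h_def by (simp add: fresh_def del: hit.simps(2))
      qed
      finally show ?thesis .
    qed
  next
    fix X :: "nat \<Rightarrow> vertex option" assume X: "X 0 = Some []"
    have "(1 - hit e z (X 0)) * (1 - p) ^ fresh k 0 X = (1 - p) ^ k"
      using False p(3) by (cases k) (auto simp: X fresh_def simp del: hit.simps)
    then show "h 0 X \<le> ennreal ((1 - p) ^ k)"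
      using p False by (auto simp: h_def)
  qed
  finally show ?thesis by (simp add: p_def)
qed

text \<open>
  Either \<open>b\<close> is found after \<open>a\<close> in the same excursion, which costs \<open>hit e b (Some a) / res e a\<close> for each
  of the \<open>k\<close> excursions, or in a later one, which costs \<open>1 / (res e a * res e b)\<close> for each pair of
  excursions. The supermartingale \<open>G\<close> carries this union bound along the path: its first argument
  tells whether \<open>a\<close> has been visited, its last one counts the fresh excursions.
\<close>

lemma prob_visited_in_order_le:
  assumes a: "a \<in> tree e" and b: "b \<in> tree e"
  shows "emeasure (walk_law e) {X. visited2 k a b n X} \<le>
    ennreal (real k * (res_common e a b / (res e a * res e b)) +
      real (k choose 2) / (res e a * res e b))"
proof -
  define pa pb q where "pa = 1 / res e a" and "pb = 1 / res e b" and "q = hit e b (Some a)"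
  have p: "0 \<le> pa" "pa = hit e a (Some [])" "0 \<le> pb" "pb = hit e b (Some [])" "0 \<le> q"
    by (auto simp: pa_def pb_def q_def simp del: hit.simps(2) intro: hit_nonneg)
      (auto simp: order_less_imp_le)
  define G where "G ph t m = (if ph then hit e b t + real m * pb
      else hit e a t * (q + real m * pb) + (real m * pa * q + real (m choose 2) * pa * pb))"
    for ph t and m :: nat
  have G_nonneg: "0 \<le> G ph t m" for ph t m
    unfolding G_def using p by (auto intro!: add_nonneg_nonneg mult_nonneg_nonneg hit_nonneg)
  have G_step: "(\<integral>\<^sup>+t. ennreal (G ph t m) \<partial>step e (Some x)) \<le> ennreal (G ph (Some x) m)" for ph x m
  proof (cases ph)
    case True
    then show ?thesis using hit_affine_super[OF b, of 1 "real m * pb" x] p by (simp add: G_def del: hit.simps)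
  next
    case False
    have "0 \<le> real m * pa * q + real (m choose 2) * pa * pb"
      using p by (intro add_nonneg_nonneg mult_nonneg_nonneg) auto
    then show ?thesis
      using False hit_affine_super[OF a, of "q + real m * pb" _ x] p by (simp add: G_def del: hit.simps)
  qed
  have G_None: "G ph (Some []) m \<le> G ph None (Suc m)" for ph m
  proof -
    have "real (Suc m choose 2) = real (m choose 2) + real m"
      by (simp add: numeral_2_eq_2)
    then show ?thesis using p by (simp add: G_def algebra_simps del: hit.simps(2))
  qed
  define h where "h n X = ennreal (if visited2 k a b n X then 1 else if k \<le> returns n X then 0
    else G (visited k a n X) (X n) (fresh k n X))" for n X
  have "emeasure (walk_law e) {X. visited2 k a b n X} =
      (\<integral>\<^sup>+X. indicator {X. visited2 k a b n X} X \<partial>walk_law e)"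
  proof (rule nn_integral_indicator[symmetric])
    have "(\<lambda>X. visited2 k a b n X) \<in> walk_law e \<rightarrow>\<^sub>M count_space UNIV"
      by (rule adapted_measurable[of n])
        (auto simp: adapted_def cong: visited2_cong)
    then show "{X. visited2 k a b n X} \<in> sets (walk_law e)" by (simp add: pred_def)
  qed
  also have "\<dots> \<le> (\<integral>\<^sup>+X. h n X \<partial>walk_law e)"
    by (intro nn_integral_mono) (auto simp: h_def indicator_def)
  also have "\<dots> \<le> ennreal (real k * pa * q + real (k choose 2) * pa * pb)"
  proof (rule walk_supermartingale)
    fix n show "adapted n (h n)"
      unfolding adapted_def h_def
      by (intro allI impI) (simp cong: visited_cong visited2_cong returns_cong fresh_cong)
  next
    fix n X
    show "(\<integral>\<^sup>+t. h (Suc n) (X(Suc n := t)) \<partial>step e (X n)) \<le> h n X"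
    proof (cases "visited2 k a b n X \<or> k \<le> returns n X")
      case True
      have "(\<integral>\<^sup>+t. h (Suc n) (X(Suc n := t)) \<partial>step e (X n)) \<le> (\<integral>\<^sup>+t. h n X \<partial>step e (X n))"
        using True by (intro nn_integral_mono) (auto simp: h_def visited2_Suc)
      then show ?thesis using measure_pmf.emeasure_space_1[of "step e (X n)"] by simp
    next
      case False
      let ?m = "k - returns n X - 1" and ?v = "visited k a n X"
      have "(\<integral>\<^sup>+t. h (Suc n) (X(Suc n := t)) \<partial>step e (X n)) \<le>
          (\<integral>\<^sup>+t. ennreal (G ?v t ?m) \<partial>step e (X n))"
      proof (intro nn_integral_mono)
        fix t
        have "1 \<le> G ?v t ?m" if "t = Some b" "?v \<or> a = b"
        proof (cases ?v)
          case True
          then show ?thesis using p that by (simp add: G_def del: hit.simps)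
        next
          case False
          then have "q = 1" "a = b" using that by (auto simp: q_def simp del: hit.simps)
          then show ?thesis using p that False by (simp add: G_def del: hit.simps)
        qed
        moreover have "G (?v \<or> t = Some a) t ?m \<le> G ?v t ?m"
          using p by (auto simp: G_def q_def simp del: hit.simps)
        ultimately show "h (Suc n) (X(Suc n := t)) \<le> ennreal (G ?v t ?m)"
          using False G_nonneg[of ?v t ?m] unfolding h_def fresh_upd
          by (cases "t = Some a"; cases "t = Some b")
            (auto intro!: ennreal_leI simp: visited_Suc visited2_Suc)
      qed
      also have "\<dots> \<le> h n X"
      proof (cases "X n")
        case None
        have "k - returns n X = Suc ?m" using False by linarith
        then show ?thesis
          using False None G_None[of ?v ?m] unfolding h_def
          by (simp add: nn_integral_step_None fresh_def ennreal_leI)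
      next
        case (Some x)
        then show ?thesis
          using False G_step[where ph = ?v and m = ?m and x = x] unfolding h_def by (simp add: fresh_def)
      qed
      finally show ?thesis .
    qed
  next
    fix X :: "nat \<Rightarrow> vertex option" assume X: "X 0 = Some []"
    show "h 0 X \<le> ennreal (real k * pa * q + real (k choose 2) * pa * pb)"
    proof (cases k)
      case 0
      then show ?thesis by (auto simp: h_def visited2_def)
    next
      case (Suc m)
      have c: "real (Suc m choose 2) = real (m choose 2) + real m"
        by (simp add: numeral_2_eq_2)
      have "(if visited2 k a b 0 X then 1 else if k \<le> returns 0 X then 0
          else G (visited k a 0 X) (X 0) (fresh k 0 X)) \<le> G False (Some []) m"
      proof -
        have *: "1 \<le> G False (Some []) m" if "a = []" "b = []"
          using that p by (simp add: G_def q_def del: hit.simps)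
        have **: "G True (Some []) m \<le> G False (Some []) m" if "a = []"
          using that p by (simp add: G_def q_def del: hit.simps)
        show ?thesis using * ** X Suc
          by (cases "a = []"; cases "b = []") (auto simp: visited_def visited2_def fresh_def)
      qed
      also have "\<dots> = real k * pa * q + real (k choose 2) * pa * pb"
        unfolding G_def p(2)[symmetric] Suc c by (simp add: algebra_simps)
      finally show ?thesis unfolding h_def by (rule ennreal_leI)
    qed
  qed
  finally show ?thesis by (simp add: pa_def pb_def q_def mult.commute)
qed

section \<open>Recurrence\<close>

lemma gen_0 [simp]: "gen e 0 = {[]}"
  by (auto simp: gen_def tree_def)

lemma snoc_in_gen_iff: "x @ [i] \<in> gen e (Suc n) \<longleftrightarrow> x \<in> gen e n \<and> i < length (e x)"
  by (auto simp: gen_def tree_def nth_append less_Suc_eq)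

lemma gen_Suc: "gen e (Suc n) = (\<Union>x\<in>gen e n. children e x)"
proof (intro set_eqI)
  fix y show "y \<in> gen e (Suc n) \<longleftrightarrow> y \<in> (\<Union>x\<in>gen e n. children e x)"
  proof (cases y rule: rev_cases)
    case (snoc x i)
    then show ?thesis by (auto simp: snoc_in_gen_iff children_def)
  qed (auto simp: gen_def children_def)
qed

lemma sum_gen_Suc: "(\<Sum>y\<in>gen e (Suc n). g y) = (\<Sum>x\<in>gen e n. \<Sum>y\<in>children e x. g y)"
  unfolding gen_Suc by (rule sum.UNION_disjoint) (auto simp: finite_gen children_def)

lemma tree_iff_gen: "x \<in> tree e \<longleftrightarrow> x \<in> gen e (length x)"
  by (simp add: gen_def)

lemma genD: "x \<in> gen e n \<Longrightarrow> x \<in> tree e" "x \<in> gen e n \<Longrightarrow> length x = n"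
  by (auto simp: gen_def)

lemma children_in_tree: "x \<in> tree e \<Longrightarrow> y \<in> children e x \<Longrightarrow> y \<in> tree e"
  by (auto simp: tree_iff_gen children_def snoc_in_gen_iff)

lemma parent_of_child: "y \<in> children e x \<Longrightarrow> parent y = Some x"
  by (auto simp: children_def parent_def)

lemma parent_in_tree: "x \<in> tree e \<Longrightarrow> parent x = Some y \<Longrightarrow> y \<in> tree e"
  by (cases x rule: rev_cases) (auto simp: tree_iff_gen snoc_in_gen_iff parent_def)

text \<open>
  If \<open>D n > 0\<close>, then from \<open>n\<close> on \<open>1 / D\<close> decreases by at least \<open>1 / C\<close> at every step and becomes negative.
\<close>

lemma bounded_square_increments_zero:
  fixes D :: "nat \<Rightarrow> real"
  assumes "0 < C" and nonneg: "\<And>n. 0 \<le> D n" and step: "\<And>n. (D (Suc n))\<^sup>2 \<le> C * (D (Suc n) - D n)"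
  shows "D n = 0"
proof (rule ccontr)
  assume "D n \<noteq> 0"
  then have pos: "0 < D n" using nonneg[of n] by simp
  have mono: "D m \<le> D (Suc m)" for m
  proof -
    have "0 \<le> C * (D (Suc m) - D m)" using step[of m] zero_le_power2[of "D (Suc m)"] by linarith
    then show ?thesis using \<open>0 < C\<close> by (simp add: zero_le_mult_iff)
  qed
  have *: "D n \<le> D (n + m) \<and> 1 / D (n + m) \<le> 1 / D n - real m / C" for m
  proof (induction m)
    case (Suc m)
    let ?a = "D (n + m)" and ?b = "D (Suc (n + m))"
    have ab: "0 < ?a" "?a \<le> ?b" using Suc pos mono[of "n + m"] by linarith+
    have "?b * ?b \<le> C * (?b - ?a)" using step[of "n + m"] by (simp add: power2_eq_square)
    moreover have "?a * ?b \<le> ?b * ?b" using ab by (intro mult_right_mono) auto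
    ultimately have "?a * ?b \<le> C * (?b - ?a)" by linarith
    then have "1 / C \<le> 1 / ?a - 1 / ?b"
      using ab \<open>0 < C\<close> by (simp add: field_simps)
    moreover have "real (Suc m) / C = real m / C + 1 / C" by (simp add: add_divide_distrib)
    ultimately show ?case using Suc ab by auto
  qed simp
  obtain m :: nat where "C / D n < real m" using reals_Archimedean2 by blast
  then have "1 / D n < real m / C" using pos \<open>0 < C\<close> by (simp add: field_simps)
  with *[of m] have "1 / D (n + m) < 0" by linarith
  then show False using nonneg[of "n + m"] by (simp add: divide_less_0_iff)
qed

text \<open>
  The current \<open>exp (- V x) * (f x - f (parent x))\<close> is conserved from a vertex to its children, so the energy
  \<open>D n\<close> dissipated in the generations up to \<open>n\<close> equals the boundary term of generation \<open>n\<close>. As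
  \<open>\<bar>f\<bar> \<le> 1\<close>, the Cauchy--Schwarz inequality bounds the square of this term by \<open>W n * (D n - D (n - 1))\<close>.
  With \<open>W\<close> bounded this is impossible unless all energies vanish.
\<close>

lemma bounded_harmonic_zero:
  fixes f :: "vertex option \<Rightarrow> real"
  assumes W: "\<And>n. W e n \<le> C"
    and f: "f None = 0" "\<And>s. \<bar>f s\<bar> \<le> 1"
    and harm: "\<And>x. x \<in> tree e \<Longrightarrow> total_weight e x * f (Some x) =
      exp (- V e x) * f (parent x) + (\<Sum>y\<in>children e x. exp (- V e y) * f (Some y))"
    and x: "x \<in> tree e"
  shows "f (Some x) = 0"
proof -
  define d where "d x = f (Some x) - f (parent x)" for x
  define E where "E n = (\<Sum>x\<in>gen e n. exp (- V e x) * (d x)\<^sup>2)" for n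
  define D where "D n = (\<Sum>j\<le>n. E j)" for n
  have E: "0 \<le> E n" for n unfolding E_def by (intro sum_nonneg) auto
  have flow: "exp (- V e x) * d x = (\<Sum>y\<in>children e x. exp (- V e y) * d y)" if "x \<in> tree e" for x
  proof -
    have "(\<Sum>y\<in>children e x. exp (- V e y) * d y) =
        (\<Sum>y\<in>children e x. exp (- V e y) * f (Some y) - exp (- V e y) * f (Some x))"
      by (intro sum.cong) (auto simp: d_def parent_of_child right_diff_distrib)
    also have "\<dots> = (total_weight e x * f (Some x) - exp (- V e x) * f (parent x)) -
        (\<Sum>y\<in>children e x. exp (- V e y)) * f (Some x)"
      using harm[OF that] by (simp add: sum_subtractf sum_distrib_right)
    also have "\<dots> = exp (- V e x) * d x"
      by (simp add: total_weight_def d_def algebra_simps)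
    finally show ?thesis by simp
  qed
  have D_eq: "D n = (\<Sum>x\<in>gen e n. exp (- V e x) * d x * f (Some x))" for n
  proof (induction n)
    case 0
    show ?case by (simp add: D_def E_def d_def parent_def f power2_eq_square)
  next
    case (Suc n)
    have "D (Suc n) = D n + E (Suc n)" by (simp add: D_def)
    also have "D n = (\<Sum>x\<in>gen e n. \<Sum>y\<in>children e x. exp (- V e y) * d y * f (parent y))"
      unfolding Suc using flow
      by (intro sum.cong) (auto simp: sum_distrib_right parent_of_child dest: genD)
    also have "\<dots> = (\<Sum>y\<in>gen e (Suc n). exp (- V e y) * d y * f (parent y))"
      by (rule sum_gen_Suc[symmetric])
    also have "\<dots> + E (Suc n) = (\<Sum>y\<in>gen e (Suc n). exp (- V e y) * d y * f (Some y))"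
      unfolding E_def by (simp add: sum.distrib[symmetric] d_def power2_eq_square algebra_simps)
    finally show ?case .
  qed
  have step: "(D n)\<^sup>2 \<le> max 1 C * E n" for n
  proof -
    have "D n = (\<Sum>x\<in>gen e n. (sqrt (exp (- V e x)) * d x) * (sqrt (exp (- V e x)) * f (Some x)))"
      unfolding D_eq by (intro sum.cong) (auto simp: mult_ac)
    also have "\<dots>\<^sup>2 \<le> (\<Sum>x\<in>gen e n. (sqrt (exp (- V e x)) * d x)\<^sup>2) *
        (\<Sum>x\<in>gen e n. (sqrt (exp (- V e x)) * f (Some x))\<^sup>2)"
      by (rule Cauchy_Schwarz_ineq_sum)
    also have "(\<Sum>x\<in>gen e n. (sqrt (exp (- V e x)) * d x)\<^sup>2) = E n"
      unfolding E_def by (intro sum.cong) (auto simp: power_mult_distrib)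
    also have "E n * (\<Sum>x\<in>gen e n. (sqrt (exp (- V e x)) * f (Some x))\<^sup>2) \<le> E n * max 1 C"
    proof (intro mult_left_mono E)
      have "(\<Sum>x\<in>gen e n. (sqrt (exp (- V e x)) * f (Some x))\<^sup>2) \<le> W e n"
        unfolding W_def
      proof (intro sum_mono)
        fix x
        have "(f (Some x))\<^sup>2 \<le> 1" using f(2)[of "Some x"] by (simp add: abs_square_le_1)
        then show "(sqrt (exp (- V e x)) * f (Some x))\<^sup>2 \<le> exp (- V e x)"
          by (simp add: power_mult_distrib mult_left_le)
      qed
      then show "(\<Sum>x\<in>gen e n. (sqrt (exp (- V e x)) * f (Some x))\<^sup>2) \<le> max 1 C"
        using W[of n] by linarith
    qed
    finally show ?thesis by (simp add: mult.commute)
  qed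
  have "D n = 0" for n
  proof (rule bounded_square_increments_zero[of "max 1 C"])
    show "0 \<le> D n" for n unfolding D_def by (intro sum_nonneg E)
    show "(D (Suc n))\<^sup>2 \<le> max 1 C * (D (Suc n) - D n)" for n
      using step[of "Suc n"] by (simp add: D_def)
  qed simp
  then have E0: "E n = 0" for n
    using E by (auto simp: D_def sum_nonneg_eq_0_iff)
  have d0: "d x = 0" if "x \<in> tree e" for x
  proof -
    have "\<forall>y\<in>gen e (length x). exp (- V e y) * (d y)\<^sup>2 = 0"
      using E0[of "length x"] unfolding E_def
      by (subst (asm) sum_nonneg_eq_0_iff) (auto simp: finite_gen)
    then show ?thesis using that by (simp add: tree_iff_gen)
  qed
  show ?thesis using x
  proof (induction x rule: rev_induct)
    case Nil
    then show ?case using d0[of "[]"] f by (simp add: d_def parent_def)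
  next
    case (snoc i x)
    have "x \<in> tree e" using snoc.prems by (simp add: tree_iff_gen snoc_in_gen_iff)
    then show ?case using d0[OF snoc.prems] snoc.IH by (simp add: d_def parent_def)
  qed
qed

text \<open>
  The probability of not visiting the extra parent at times \<open>0, \<dots>, n\<close>.
\<close>

primrec stay :: "env \<Rightarrow> nat \<Rightarrow> vertex option \<Rightarrow> real" where
  "stay e 0 s = (if s = None then 0 else 1)"
| "stay e (Suc n) s = (case s of None \<Rightarrow> 0 | Some x \<Rightarrow>
     (exp (- V e x) * stay e n (parent x) + (\<Sum>y\<in>children e x. exp (- V e y) * stay e n (Some y)))
       / total_weight e x)"

lemma stay_None [simp]: "stay e n None = 0"
  by (cases n) auto

lemma stay_nonneg: "0 \<le> stay e n s"
proof (induction n arbitrary: s)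
  case (Suc n)
  then show ?case
    by (cases s) (auto intro!: divide_nonneg_pos add_nonneg_nonneg sum_nonneg)
qed auto

lemma total_weight_gt_0: "0 < total_weight e x" by simp

lemma stay_Suc_le: "stay e (Suc n) s \<le> stay e n s"
proof (induction n arbitrary: s)
  case 0
  show ?case
  proof (cases s)
    case (Some x)
    have "exp (- V e x) * stay e 0 (parent x) + (\<Sum>y\<in>children e x. exp (- V e y) * stay e 0 (Some y))
        \<le> total_weight e x"
      unfolding total_weight_def by (intro add_mono sum_mono) auto
    then show ?thesis using total_weight_gt_0[of e x] by (simp add: Some pos_divide_le_eq del: total_weight_pos)
  qed simp
next
  case (Suc n)
  show ?case
  proof (cases s)
    case (Some x)
    have "exp (- V e x) * stay e (Suc n) (parent x) + (\<Sum>y\<in>children e x. exp (- V e y) * stay e (Suc n) (Some y))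
        \<le> exp (- V e x) * stay e n (parent x) + (\<Sum>y\<in>children e x. exp (- V e y) * stay e n (Some y))"
      by (intro add_mono sum_mono mult_left_mono Suc) auto
    then show ?thesis unfolding Some stay.simps(2)[of _ "Suc n"] stay.simps(2)[of _ n] option.case
      by (intro divide_right_mono) (auto intro: less_imp_le)
  qed simp
qed

lemma stay_le_1: "stay e n s \<le> 1"
proof (induction n)
  case (Suc n)
  then show ?case using stay_Suc_le[of e n s] by linarith
qed simp

lemma stay_tendsto_0:
  assumes W: "\<And>n. W e n \<le> C" and x: "x \<in> tree e"
  shows "(\<lambda>n. stay e n (Some x)) \<longlonglongrightarrow> 0"
proof -
  define f where "f s = lim (\<lambda>n. stay e n s)" for s
  have lim: "(\<lambda>n. stay e n s) \<longlonglongrightarrow> f s" for s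
  proof -
    have "decseq (\<lambda>n. stay e n s)" by (intro decseq_SucI stay_Suc_le)
    then obtain L where "(\<lambda>n. stay e n s) \<longlonglongrightarrow> L"
      by (rule decseq_convergent[of "\<lambda>n. stay e n s" 0]) (simp_all only: stay_nonneg simp_thms)
    then have "convergent (\<lambda>n. stay e n s)" by (rule convergentI)
    then show ?thesis by (simp add: f_def convergent_LIMSEQ_iff)
  qed
  have "f (Some x) = 0"
  proof (rule bounded_harmonic_zero[OF W _ _ _ x])
    show "f None = 0" by (simp add: f_def)
    have "0 \<le> f s" "f s \<le> 1" for s
      by (rule LIMSEQ_le_const[OF lim], simp add: stay_nonneg)
        (rule LIMSEQ_le_const2[OF lim], simp add: stay_le_1)
    then show "\<bar>f s\<bar> \<le> 1" for s by (metis abs_of_nonneg)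
  next
    fix x
    have "(\<lambda>n. stay e (Suc n) (Some x)) \<longlonglongrightarrow>
        (exp (- V e x) * f (parent x) + (\<Sum>y\<in>children e x. exp (- V e y) * f (Some y))) / total_weight e x"
      unfolding stay.simps option.case using total_weight_gt_0[of e x]
      by (intro tendsto_intros lim) linarith
    moreover have "(\<lambda>n. stay e (Suc n) (Some x)) \<longlonglongrightarrow> f (Some x)"
      using lim by (rule LIMSEQ_Suc)
    ultimately have "f (Some x) = (exp (- V e x) * f (parent x) +
        (\<Sum>y\<in>children e x. exp (- V e y) * f (Some y))) / total_weight e x"
      by (rule LIMSEQ_unique[rotated])
    then show "total_weight e x * f (Some x) =
      exp (- V e x) * f (parent x) + (\<Sum>y\<in>children e x. exp (- V e y) * f (Some y))"
      using total_weight_gt_0[of e x] by (simp del: total_weight_pos)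
  qed
  then show ?thesis using lim[of "Some x"] by simp
qed

lemma AE_walk_in_tree: "AE X in walk_law e. X n \<in> insert None (Some ` tree e)"
proof -
  define h :: "nat \<Rightarrow> (nat \<Rightarrow> vertex option) \<Rightarrow> ennreal"
    where "h n X = indicator (- insert None (Some ` tree e)) (X n)" for n X
  have "(\<integral>\<^sup>+X. h n X \<partial>walk_law e) \<le> 0"
  proof (rule walk_supermartingale)
    show "adapted n (h n)" for n by (auto simp: adapted_def h_def)
    show "h 0 X \<le> 0" if "X 0 = Some []" for X
      using that by (auto simp: h_def tree_def)
    fix n X
    show "(\<integral>\<^sup>+t. h (Suc n) (X(Suc n := t)) \<partial>step e (X n)) \<le> h n X"
    proof (cases "X n \<in> insert None (Some ` tree e)")
      case True
      have "AE t in step e (X n). t \<in> insert None (Some ` tree e)"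
      proof (rule AE_pmfI)
        fix t assume "t \<in> set_pmf (step e (X n))"
        then have ne: "step_prob e (X n) t \<noteq> 0" by (simp add: set_pmf_iff pmf_step)
        show "t \<in> insert None (Some ` tree e)"
        proof (cases "X n")
          case None
          then show ?thesis using ne by (auto simp: tree_def split: if_splits)
        next
          case (Some x)
          then have "x \<in> tree e" using True by auto
          moreover have "t = parent x \<or> t \<in> Some ` children e x"
            using ne Some by (auto split: if_splits)
          ultimately show ?thesis
            using children_in_tree[of x e] by (cases t) (auto dest: parent_in_tree[OF _ sym])
        qed
      qed
      then have "AE t in step e (X n). h (Suc n) (X(Suc n := t)) = 0"
        by eventually_elim (auto simp: h_def)
      then show ?thesis by (subst nn_integral_0_iff_AE[THEN iffD2]) auto
    next
      case False
      then have "h n X = 1" by (simp add: h_def)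
      have "(\<integral>\<^sup>+t. h (Suc n) (X(Suc n := t)) \<partial>step e (X n)) \<le> (\<integral>\<^sup>+t. 1 \<partial>step e (X n))"
        by (intro nn_integral_mono) (auto simp: h_def indicator_def)
      then show ?thesis using \<open>h n X = 1\<close> measure_pmf.emeasure_space_1[of "step e (X n)"] by simp
    qed
  qed
  then have "(\<integral>\<^sup>+X. h n X \<partial>walk_law e) = 0" by simp
  moreover have "h n \<in> borel_measurable (walk_law e)"
    unfolding h_def by (rule measurable_compose[OF measurable_walk_coordinate]) simp
  ultimately have "AE X in walk_law e. h n X = 0" by (simp add: nn_integral_0_iff_AE)
  then show ?thesis by eventually_elim (auto simp: h_def indicator_def split: if_splits)
qed

lemma walk_law_avoid_None_le:
  "emeasure (walk_law e) {X. \<forall>i\<in>{m..m + j}. X i \<noteq> None} \<le> (\<integral>\<^sup>+X. ennreal (stay e j (X m)) \<partial>walk_law e)"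
proof -
  define I where "I j N = (\<integral>\<^sup>+X. indicator {X. \<forall>i\<in>{m..m + j}. X i \<noteq> None} X * ennreal (stay e N (X (m + j)))
    \<partial>walk_law e)" for j N
  have of_bool_le: "(of_bool P :: ennreal) \<le> of_bool Q" if "P \<longrightarrow> Q" for P Q
    using that by (cases P; cases Q) auto
  have I_Suc: "I (Suc j) N \<le> I j (Suc N)" for j N
    unfolding I_def
  proof (subst walk_law_step[of "m + j"])
    show "adapted (Suc (m + j)) (\<lambda>X. indicator {X. \<forall>i\<in>{m..m + Suc j}. X i \<noteq> None} X *
        ennreal (stay e N (X (m + Suc j))))"
      by (auto simp: adapted_def indicator_def)
    show "(\<integral>\<^sup>+X. (\<integral>\<^sup>+t. indicator {X. \<forall>i\<in>{m..m + Suc j}. X i \<noteq> None} (X(Suc (m + j) := t)) *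
          ennreal (stay e N ((X(Suc (m + j) := t)) (m + Suc j))) \<partial>step e (X (m + j))) \<partial>walk_law e)
      \<le> (\<integral>\<^sup>+X. indicator {X. \<forall>i\<in>{m..m + j}. X i \<noteq> None} X * ennreal (stay e (Suc N) (X (m + j))) \<partial>walk_law e)"
    proof (intro nn_integral_mono)
      fix X
      have "(\<integral>\<^sup>+t. indicator {X. \<forall>i\<in>{m..m + Suc j}. X i \<noteq> None} (X(Suc (m + j) := t)) *
          ennreal (stay e N ((X(Suc (m + j) := t)) (m + Suc j))) \<partial>step e (X (m + j)))
        \<le> (\<integral>\<^sup>+t. indicator {X. \<forall>i\<in>{m..m + j}. X i \<noteq> None} X * ennreal (stay e N t) \<partial>step e (X (m + j)))"
      proof (intro nn_integral_mono)
        fix t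
        have imp: "(\<forall>i\<in>{m..m + Suc j}. (X(Suc (m + j) := t)) i \<noteq> None) \<longrightarrow>
            (\<forall>i\<in>{m..m + j}. X i \<noteq> None)"
        proof (intro impI ballI)
          fix i assume "\<forall>i\<in>{m..m + Suc j}. (X(Suc (m + j) := t)) i \<noteq> None" "i \<in> {m..m + j}"
          then show "X i \<noteq> None" using bspec[of "{m..m + Suc j}" "\<lambda>i. (X(Suc (m + j) := t)) i \<noteq> None" i] by auto
        qed
        have "indicator {X. \<forall>i\<in>{m..m + Suc j}. X i \<noteq> None} (X(Suc (m + j) := t)) \<le>
            (indicator {X. \<forall>i\<in>{m..m + j}. X i \<noteq> None} X :: ennreal)"
          unfolding indicator_def mem_Collect_eq by (rule of_bool_le[OF imp])
        then show "indicator {X. \<forall>i\<in>{m..m + Suc j}. X i \<noteq> None} (X(Suc (m + j) := t)) *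
            ennreal (stay e N ((X(Suc (m + j) := t)) (m + Suc j))) \<le>
          indicator {X. \<forall>i\<in>{m..m + j}. X i \<noteq> None} X * ennreal (stay e N t)"
          by (intro mult_mono) auto
      qed
      also have "\<dots> = indicator {X. \<forall>i\<in>{m..m + j}. X i \<noteq> None} X * (\<integral>\<^sup>+t. ennreal (stay e N t) \<partial>step e (X (m + j)))"
        by (rule nn_integral_cmult) simp
      also have "\<dots> \<le> indicator {X. \<forall>i\<in>{m..m + j}. X i \<noteq> None} X * ennreal (stay e (Suc N) (X (m + j)))"
      proof (cases "X (m + j)")
        case (Some x)
        then show ?thesis using nn_integral_step_Some[where \<phi> = "stay e N" and e = e and x = x] stay_nonneg by simp
      qed (auto simp: indicator_def)
      finally show "(\<integral>\<^sup>+t. indicator {X. \<forall>i\<in>{m..m + Suc j}. X i \<noteq> None} (X(Suc (m + j) := t)) *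
          ennreal (stay e N ((X(Suc (m + j) := t)) (m + Suc j))) \<partial>step e (X (m + j)))
        \<le> indicator {X. \<forall>i\<in>{m..m + j}. X i \<noteq> None} X * ennreal (stay e (Suc N) (X (m + j)))" .
    qed
  qed
  have "I j N \<le> I 0 (j + N)" for j N
  proof (induction j arbitrary: N)
    case (Suc j)
    then show ?case using order_trans[OF I_Suc[of j N] Suc[of "Suc N"]] by simp
  qed simp
  note this[of j 0]
  also have "I 0 (j + 0) \<le> (\<integral>\<^sup>+X. ennreal (stay e j (X m)) \<partial>walk_law e)"
    unfolding I_def by (intro nn_integral_mono) (auto simp: indicator_def)
  also have "I j 0 = (\<integral>\<^sup>+X. indicator {X. \<forall>i\<in>{m..m + j}. X i \<noteq> None} X \<partial>walk_law e)"
    unfolding I_def by (intro nn_integral_cong) (auto simp: indicator_def)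
  also have "\<dots> = emeasure (walk_law e) {X. \<forall>i\<in>{m..m + j}. X i \<noteq> None}"
  proof (rule nn_integral_indicator)
    have "{X \<in> space (walk_law e). \<forall>i\<in>{m..m + j}. X i \<noteq> None} \<in> sets (walk_law e)" by measurable
    then show "{X. \<forall>i\<in>{m..m + j}. X i \<noteq> None} \<in> sets (walk_law e)" by simp
  qed
  finally show ?thesis .
qed

text \<open>
  The probability of never visiting the extra parent again is a bounded harmonic function that vanishes
  there, hence zero.
\<close>

lemma walk_recurrent:
  assumes W: "\<And>n. W e n \<le> C"
  shows "AE X in walk_law e. \<forall>m. \<exists>i\<ge>m. X i = None"
proof (subst AE_all_countable, intro allI)
  fix m
  interpret prob_space "walk_law e" by (rule prob_space_walk_law)
  have "(\<lambda>j. \<integral>\<^sup>+X. ennreal (stay e j (X m)) \<partial>walk_law e) \<longlonglongrightarrow> (\<integral>\<^sup>+X. 0 \<partial>walk_law e)"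
  proof (rule nn_integral_dominated_convergence[where w = "\<lambda>_. 1"])
    show "AE X in walk_law e. (\<lambda>j. ennreal (stay e j (X m))) \<longlonglongrightarrow> 0"
      using AE_walk_in_tree[where n = m]
    proof eventually_elim
      case (elim X)
      then have "(\<lambda>j. stay e j (X m)) \<longlonglongrightarrow> 0"
        using stay_tendsto_0[OF W] by auto
      then show ?case using tendsto_ennrealI by fastforce
    qed
    show "(\<lambda>X. ennreal (stay e j (X m))) \<in> borel_measurable (walk_law e)" for j
      by (rule measurable_compose[OF measurable_walk_coordinate]) simp
  qed (auto simp: stay_le_1 emeasure_space_1[simplified])
  moreover have "emeasure (walk_law e) {X. \<forall>i\<ge>m. X i \<noteq> None} \<le> (\<integral>\<^sup>+X. ennreal (stay e j (X m)) \<partial>walk_law e)"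
    for j
  proof -
    have "{X \<in> space (walk_law e). \<forall>i\<in>{m..m + j}. X i \<noteq> None} \<in> sets (walk_law e)" by measurable
    then have "emeasure (walk_law e) {X. \<forall>i\<ge>m. X i \<noteq> None} \<le>
        emeasure (walk_law e) {X. \<forall>i\<in>{m..m + j}. X i \<noteq> None}"
      by (intro emeasure_mono) auto
    also note walk_law_avoid_None_le
    finally show ?thesis .
  qed
  ultimately have "emeasure (walk_law e) {X. \<forall>i\<ge>m. X i \<noteq> None} \<le> 0"
    by (intro LIMSEQ_le_const[of "\<lambda>j. \<integral>\<^sup>+X. ennreal (stay e j (X m)) \<partial>walk_law e"]) auto
  moreover have "{X \<in> space (walk_law e). \<forall>i\<ge>m. X i \<noteq> None} \<in> sets (walk_law e)" by measurable
  ultimately show "AE X in walk_law e. \<exists>i\<ge>m. X i = None"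
    by (intro AE_I'[of "{X. \<forall>i\<ge>m. X i \<noteq> None}"]) (auto simp: null_sets_def)
qed

section \<open>Quenched second moment of the range\<close>

lemma le_returns_Suc_iff:
  "Suc k \<le> returns n X \<longleftrightarrow> (\<exists>i<n. X (Suc i) = None \<and> k \<le> returns i X)"
proof (induction n)
  case (Suc n)
  show ?case
  proof (cases "X (Suc n) = None \<and> k \<le> returns n X")
    case True
    then show ?thesis by auto
  next
    case False
    then have "Suc k \<le> returns (Suc n) X \<longleftrightarrow> Suc k \<le> returns n X" by auto
    then show ?thesis using Suc False by (auto simp: less_Suc_eq)
  qed
qed simp

lemma Inf_enat_le_iff: "Inf (enat ` A) \<le> enat n \<longleftrightarrow> (\<exists>i\<in>A. i \<le> n)"
proof
  assume le: "Inf (enat ` A) \<le> enat n"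
  then have "A \<noteq> {}" by (auto simp: top_enat_def)
  then have "Inf (enat ` A) \<in> enat ` A" by (intro wellorder_InfI[of "enat (SOME i. i \<in> A)"] imageI) (simp add: some_in_eq)
  then show "\<exists>i\<in>A. i \<le> n" using le by auto
next
  assume "\<exists>i\<in>A. i \<le> n"
  then obtain i where "i \<in> A" "i \<le> n" by auto
  then show "Inf (enat ` A) \<le> enat n" by (intro Inf_lower2[of "enat i"]) auto
qed

text \<open>
  Translates return times into the counter \<open>returns\<close>, which is determined by the initial path.
\<close>

lemma return_time_le_iff: "return_time X k \<le> enat n \<longleftrightarrow> k \<le> returns n X"
proof (induction k arbitrary: n)
  case 0
  then show ?case by (simp flip: zero_enat_def)
next
  case (Suc k)
  have "return_time X k < enat i \<longleftrightarrow> i \<noteq> 0 \<and> k \<le> returns (i - 1) X" for i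
  proof (cases i)
    case (Suc j)
    have "return_time X k < enat (Suc j) \<longleftrightarrow> return_time X k \<le> enat j"
      by (cases "return_time X k") auto
    then show ?thesis using Suc.IH Suc by simp
  qed (simp flip: zero_enat_def)
  then have "return_time X (Suc k) \<le> enat n \<longleftrightarrow>
      (\<exists>i. i \<noteq> 0 \<and> k \<le> returns (i - 1) X \<and> X i = None \<and> i \<le> n)"
    by (auto simp: Inf_enat_le_iff)
  also have "\<dots> \<longleftrightarrow> (\<exists>i<n. X (Suc i) = None \<and> k \<le> returns i X)"
  proof
    assume "\<exists>i. i \<noteq> 0 \<and> k \<le> returns (i - 1) X \<and> X i = None \<and> i \<le> n"
    then obtain i where "i \<noteq> 0" "k \<le> returns (i - 1) X" "X i = None" "i \<le> n" by auto
    then show "\<exists>i<n. X (Suc i) = None \<and> k \<le> returns i X"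
      by (intro exI[of _ "i - 1"]) auto
  next
    assume "\<exists>i<n. X (Suc i) = None \<and> k \<le> returns i X"
    then show "\<exists>i. i \<noteq> 0 \<and> k \<le> returns (i - 1) X \<and> X i = None \<and> i \<le> n"
      by (metis Suc_leI diff_Suc_1 nat.distinct(1))
  qed
  finally show ?case by (simp only: le_returns_Suc_iff)
qed

lemma walk_range_iff_visited:
  assumes "X 0 = Some []" "0 < k" "z \<in> tree e" "z \<noteq> []"
  shows "z \<in> walk_range e X (return_time X k) \<longleftrightarrow> (\<exists>n. visited k z n X)"
proof
  assume "z \<in> walk_range e X (return_time X k)"
  then obtain j where j: "1 \<le> j" "enat j \<le> return_time X k" "X j = Some z"
    by (auto simp: walk_range_def)
  then obtain i where i: "j = Suc i" by (cases j) auto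
  have "\<not> return_time X k \<le> enat i"
    using j(2) unfolding i by (metis enat_ord_simps(1) not_less_eq_eq order.refl order_trans)
  then have "returns j X < k"
    unfolding return_time_le_iff using i j(3) by simp
  then show "\<exists>n. visited k z n X" using j(3) by (auto simp: visited_def)
next
  assume "\<exists>n. visited k z n X"
  then obtain j where j: "X j = Some z" "returns j X < k" by (auto simp: visited_def)
  have "enat j \<le> return_time X k"
    using j(2) return_time_le_iff[of X k j] by (metis linorder_le_cases not_less)
  moreover have "1 \<le> j" using j(1) assms by (cases j) auto
  ultimately show "z \<in> walk_range e X (return_time X k)"
    using j(1) assms(3) by (auto simp: walk_range_def)
qed

lemma ex_le_returns:
  assumes "\<forall>m. \<exists>i\<ge>m. X i = None"
  shows "\<exists>n. k \<le> returns n X"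
proof (induction k)
  case (Suc k)
  then obtain n where n: "k \<le> returns n X" by auto
  obtain i where "i \<ge> Suc n" "X i = None" using assms by blast
  then have "k \<le> returns (i - 1) X" using n returns_mono[of n "i - 1" X] by linarith
  then have "Suc k \<le> returns i X"
    unfolding le_returns_Suc_iff using \<open>i \<ge> Suc n\<close> \<open>X i = None\<close>
    by (intro exI[of _ "i - 1"]) auto
  then show ?case by blast
qed auto

lemma measurable_visited [measurable]: "Measurable.pred (walk_law e) (visited k z n)"
  by (rule adapted_measurable[of n]) (auto simp: adapted_def cong: visited_cong)

lemma measurable_visited2 [measurable]: "Measurable.pred (walk_law e) (visited2 k a b n)"
  by (rule adapted_measurable[of n]) (auto simp: adapted_def cong: visited2_cong)

lemma measurable_returns [measurable]: "returns n \<in> walk_law e \<rightarrow>\<^sub>M count_space UNIV"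
  by (rule adapted_measurable[of n]) (auto simp: adapted_def cong: returns_cong)

definition found :: "nat \<Rightarrow> vertex \<Rightarrow> (nat \<Rightarrow> vertex option) set" where
  "found k z = {X. \<exists>n. visited k z n X}"

lemma sets_found [measurable]: "found k z \<in> sets (walk_law e)"
proof -
  have "{X \<in> space (walk_law e). \<exists>n. visited k z n X} \<in> sets (walk_law e)" by measurable
  then show ?thesis by (simp add: found_def)
qed

text \<open>
  By recurrence the \<open>k\<close> excursions are almost surely completed, so the event is the increasing union of its
  finite-time versions.
\<close>

lemma prob_not_found_le:
  assumes W: "\<And>n. W e n \<le> C" and z: "z \<in> tree e"
  shows "emeasure (walk_law e) (- found k z) \<le> ennreal ((1 - 1 / res e z) ^ k)"
proof -
  define A where "A n = {X. \<not> visited k z n X \<and> k \<le> returns n X}" for n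
  have A: "A n \<in> sets (walk_law e)" for n
  proof -
    have "{X \<in> space (walk_law e). \<not> visited k z n X \<and> k \<le> returns n X} \<in> sets (walk_law e)" by measurable
    then show ?thesis by (simp add: A_def)
  qed
  have "A n \<subseteq> A (Suc n)" for n
    by (auto simp: A_def visited_Suc)
  then have "incseq A" by (rule incseq_SucI)
  have "emeasure (walk_law e) (- found k z) \<le> emeasure (walk_law e) (\<Union>n. A n)"
  proof (rule emeasure_mono_AE)
    show "AE X in walk_law e. X \<in> - found k z \<longrightarrow> X \<in> (\<Union>n. A n)"
      using walk_recurrent[OF W]
      by eventually_elim (use ex_le_returns in \<open>auto simp: found_def A_def\<close>)
  qed (use A in auto)
  also have "\<dots> = (SUP n. emeasure (walk_law e) (A n))"
    by (rule SUP_emeasure_incseq[symmetric]) (use A \<open>incseq A\<close> in auto)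
  also have "\<dots> \<le> ennreal ((1 - 1 / res e z) ^ k)"
    unfolding A_def by (intro SUP_least prob_unvisited_le z)
  finally show ?thesis .
qed

lemma prob_found_both_le:
  assumes a: "a \<in> tree e" and b: "b \<in> tree e"
  shows "emeasure (walk_law e) (found k a \<inter> found k b) \<le>
    ennreal (real k * (2 * res_common e a b / (res e a * res e b)) + (real k)\<^sup>2 / (res e a * res e b))"
proof -
  let ?Q = "walk_law e"
  define B where "B n = {X. visited2 k a b n X} \<union> {X. visited2 k b a n X}" for n
  define c where "c = real k * (res_common e a b / (res e a * res e b)) +
      real (k choose 2) / (res e a * res e b)"
  have B1: "{X. visited2 k a b n X} \<in> sets ?Q" for a b n
  proof -
    have "{X \<in> space ?Q. visited2 k a b n X} \<in> sets ?Q" by measurable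
    then show ?thesis by simp
  qed
  have B: "B n \<in> sets ?Q" for n unfolding B_def by (intro sets.Un B1)
  have "B n \<subseteq> B (Suc n)" for n by (auto simp: B_def visited2_Suc)
  then have "incseq B" by (rule incseq_SucI)
  have "found k a \<inter> found k b \<subseteq> (\<Union>n. B n)"
  proof
    fix X assume "X \<in> found k a \<inter> found k b"
    then obtain i j where i: "X i = Some a" "returns i X < k" and j: "X j = Some b" "returns j X < k"
      by (auto simp: found_def visited_def)
    show "X \<in> (\<Union>n. B n)"
    proof (cases "i \<le> j")
      case True
      then have "visited2 k a b j X" using i j by (auto simp: visited2_def visited_def)
      then show ?thesis by (auto simp: B_def)
    next
      case False
      then have "visited2 k b a i X" using i j
        unfolding visited2_def visited_def by (metis linear order_refl)
      then show ?thesis by (auto simp: B_def)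
    qed
  qed
  then have "emeasure ?Q (found k a \<inter> found k b) \<le> emeasure ?Q (\<Union>n. B n)"
    by (rule emeasure_mono) (use B in auto)
  also have "\<dots> = (SUP n. emeasure ?Q (B n))"
    by (rule SUP_emeasure_incseq[symmetric]) (use \<open>incseq B\<close> B in auto)
  also have "\<dots> \<le> ennreal c + ennreal c"
  proof (rule SUP_least)
    fix n
    have "emeasure ?Q (B n) \<le> emeasure ?Q {X. visited2 k a b n X} + emeasure ?Q {X. visited2 k b a n X}"
      unfolding B_def by (rule emeasure_subadditive) (auto simp: B1)
    also have "\<dots> \<le> ennreal c + ennreal c"
      using prob_visited_in_order_le[OF a b, of k n] prob_visited_in_order_le[OF b a, of k n]
      by (intro add_mono) (simp_all add: c_def res_common_commute mult.commute)
    finally show "emeasure ?Q (B n) \<le> ennreal c + ennreal c" .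
  qed
  also have "\<dots> \<le> ennreal (real k * (2 * res_common e a b / (res e a * res e b)) + (real k)\<^sup>2 / (res e a * res e b))"
  proof -
    have pos: "0 < res e a * res e b" by simp
    have c0: "0 \<le> c" unfolding c_def
      using pos by (intro add_nonneg_nonneg mult_nonneg_nonneg divide_nonneg_pos res_common_nonneg) auto
    have "2 * real (k choose 2) \<le> (real k)\<^sup>2"
      by (induction k) (auto simp: numeral_2_eq_2 algebra_simps)
    then have "2 * real (k choose 2) / (res e a * res e b) \<le> (real k)\<^sup>2 / (res e a * res e b)"
      by (rule divide_right_mono[OF _ less_imp_le[OF pos]])
    then have "c + c \<le> real k * (2 * res_common e a b / (res e a * res e b)) + (real k)\<^sup>2 / (res e a * res e b)"
      unfolding c_def by (simp add: mult_ac)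
    then show ?thesis using c0 by (simp flip: ennreal_plus add: ennreal_leI)
  qed
  finally show ?thesis .
qed

text \<open>
  The quenched mean number of vertices of generation \<open>l\<close> visited by one excursion.
\<close>

definition green :: "env \<Rightarrow> nat \<Rightarrow> real" where
  "green e l = (\<Sum>z\<in>gen e l. 1 / res e z)"

text \<open>
  Twice this sum bounds the quenched second moment of the number of vertices of generation \<open>l\<close> visited by
  one excursion; the factors \<open>1 / res\<close> of the two-point bound are replaced by the simpler
  \<open>exp (- V)\<close>.
\<close>

definition pair_energy :: "env \<Rightarrow> nat \<Rightarrow> real" where
  "pair_energy e l =
     (\<Sum>(y, z)\<in>gen e l \<times> gen e l. res_common e y z * exp (- V e y) * exp (- V e z))"

definition W2 :: "env \<Rightarrow> nat \<Rightarrow> real" where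
  "W2 e l = (\<Sum>z\<in>gen e l. exp (- 2 * V e z))"

lemma inverse_res_le: "1 / res e z \<le> exp (- V e z)"
proof -
  have "1 / res e z \<le> 1 / exp (V e z)" by (rule divide_left_mono[OF exp_V_le_res]) auto
  then show ?thesis by (simp add: exp_minus field_simps)
qed

lemma inverse_res_nonneg: "0 \<le> 1 / res e z"
  using res_pos[of e z] by (simp add: order_less_imp_le)

lemma green_nonneg: "0 \<le> green e l"
  unfolding green_def by (intro sum_nonneg inverse_res_nonneg)

lemma pair_energy_nonneg: "0 \<le> pair_energy e l"
  unfolding pair_energy_def by (intro sum_nonneg) (auto intro!: mult_nonneg_nonneg res_common_nonneg)

lemma W2_nonneg: "0 \<le> W2 e l"
  unfolding W2_def by (intro sum_nonneg) auto

lemma power_complement_le: "0 \<le> p \<Longrightarrow> p \<le> (1::real) \<Longrightarrow> (1 - p) ^ k \<le> 1 - real k * p + (real k * p)\<^sup>2"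
proof (induction k)
  case (Suc k)
  have "(1 - p) ^ Suc k \<le> (1 - p) * (1 - real k * p + (real k * p)\<^sup>2)"
    using Suc by (simp add: mult_left_mono)
  also have "\<dots> = 1 - real (Suc k) * p + (real k * p)\<^sup>2 + real k * p\<^sup>2 - p * (real k * p)\<^sup>2"
    by (simp add: algebra_simps power2_eq_square)
  also have "\<dots> \<le> 1 - real (Suc k) * p + (real k * p)\<^sup>2 + real k * p\<^sup>2"
    using Suc by simp
  also have "\<dots> \<le> 1 - real (Suc k) * p + (real (Suc k) * p)\<^sup>2"
    using Suc by (simp add: algebra_simps power2_eq_square)
  finally show ?case .
qed simp

text \<open>
  The two-point bounds give \<open>2 * k * pair_energy + (k * green)\<^sup>2\<close> for the second moment of the number of
  discovered vertices, and \<open>1 - (1 - p) ^ k \<ge> k * p - (k * p)\<^sup>2\<close> bounds its mean from below by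
  \<open>k * green - k\<^sup>2 * W2\<close>.
\<close>

lemma quenched_second_moment:
  fixes e :: env and k l :: nat
  assumes W: "\<And>n. W e n \<le> C" and k: "0 < k"
  defines "N \<equiv> \<lambda>X. (\<Sum>z\<in>gen e l. indicator (found k z) X :: real)"
  shows "(\<integral>X. (N X / real k - green e l)\<^sup>2 \<partial>walk_law e) \<le>
    2 * pair_energy e l / real k + 2 * green e l * real k * W2 e l"
proof -
  interpret prob_space "walk_law e" by (rule prob_space_walk_law)
  let ?G = "gen e l" and ?m = "green e l" and ?k = "real k"
  have ind: "integrable (walk_law e) (\<lambda>X. indicator (found k z) X :: real)" for z
    by (rule integrable_const_bound[where B = 1]) (auto simp: indicator_def)
  have ind2: "integrable (walk_law e) (\<lambda>X. indicator (found k y) X * indicator (found k z) X :: real)" for y z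
    by (rule integrable_const_bound[where B = 1]) (auto simp: indicator_def)
  have N_sq: "(N X)\<^sup>2 = (\<Sum>(y, z)\<in>?G \<times> ?G. indicator (found k y) X * indicator (found k z) X)" for X
    unfolding N_def power2_eq_square sum_product sum.cartesian_product ..
  have "(\<integral>X. (N X / ?k - ?m)\<^sup>2 \<partial>walk_law e) =
      (\<integral>X. (N X)\<^sup>2 / ?k\<^sup>2 - 2 * ?m / ?k * N X + ?m\<^sup>2 \<partial>walk_law e)"
    by (intro Bochner_Integration.integral_cong) (auto simp: power2_diff power_divide)
  also have "\<dots> = (\<integral>X. (N X)\<^sup>2 \<partial>walk_law e) / ?k\<^sup>2 - 2 * ?m / ?k * (\<integral>X. N X \<partial>walk_law e) + ?m\<^sup>2"
  proof -
    have "integrable (walk_law e) N" unfolding N_def using ind by simp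
    moreover have "integrable (walk_law e) (\<lambda>X. (N X)\<^sup>2)"
      unfolding N_sq using ind2 by (intro Bochner_Integration.integrable_sum) auto
    ultimately show ?thesis by (simp add: prob_space[simplified])
  qed
  also have "(\<integral>X. (N X)\<^sup>2 \<partial>walk_law e) \<le> 2 * ?k * pair_energy e l + ?k\<^sup>2 * ?m\<^sup>2"
  proof -
    have "(\<integral>X. (N X)\<^sup>2 \<partial>walk_law e) = (\<Sum>(y, z)\<in>?G \<times> ?G. prob (found k y \<inter> found k z))"
      unfolding N_sq using ind2
      by (subst Bochner_Integration.integral_sum) (auto simp: split_beta simp flip: indicator_inter_arith)
    also have "\<dots> \<le> (\<Sum>(y, z)\<in>?G \<times> ?G. 2 * ?k * (res_common e y z * exp (- V e y) * exp (- V e z)) +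
        ?k\<^sup>2 * (1 / res e y * (1 / res e z)))"
    proof (intro sum_mono, clarify)
      fix y z assume yz: "y \<in> ?G" "z \<in> ?G"
      let ?c = "?k * (2 * res_common e y z / (res e y * res e z)) + ?k\<^sup>2 / (res e y * res e z)"
      have pos: "0 < res e y * res e z" by simp
      have "0 \<le> ?c"
        using pos by (intro add_nonneg_nonneg mult_nonneg_nonneg divide_nonneg_pos res_common_nonneg) auto
      then have "prob (found k y \<inter> found k z) \<le> ?c"
        using prob_found_both_le[of y e z k] yz by (simp add: emeasure_eq_measure genD)
      moreover have "1 / res e y * (1 / res e z) \<le> exp (- V e y) * exp (- V e z)"
        by (intro mult_mono inverse_res_le inverse_res_nonneg) auto
      then have "2 * ?k * res_common e y z * (1 / res e y * (1 / res e z)) \<le>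
          2 * ?k * res_common e y z * (exp (- V e y) * exp (- V e z))"
        by (intro mult_left_mono mult_nonneg_nonneg res_common_nonneg) auto
      ultimately show "prob (found k y \<inter> found k z) \<le>
          2 * ?k * (res_common e y z * exp (- V e y) * exp (- V e z)) + ?k\<^sup>2 * (1 / res e y * (1 / res e z))"
        by (simp add: mult_ac)
    qed
    also have "\<dots> = 2 * ?k * pair_energy e l + ?k\<^sup>2 * ?m\<^sup>2"
      unfolding pair_energy_def green_def power2_eq_square[of "sum _ _"] sum_product sum.cartesian_product
      by (simp add: sum.distrib sum_distrib_left split_beta)
    finally show ?thesis .
  qed
  also have "(2 * ?k * pair_energy e l + ?k\<^sup>2 * ?m\<^sup>2) / ?k\<^sup>2 = 2 * pair_energy e l / ?k + ?m\<^sup>2"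
    using k by (simp add: field_simps power2_eq_square)
  finally have 1: "(\<integral>X. (N X / ?k - ?m)\<^sup>2 \<partial>walk_law e) \<le>
      2 * pair_energy e l / ?k + ?m\<^sup>2 - 2 * ?m / ?k * (\<integral>X. N X \<partial>walk_law e) + ?m\<^sup>2"
    by (simp add: divide_right_mono)
  have 2: "?k * ?m - ?k\<^sup>2 * W2 e l \<le> (\<integral>X. N X \<partial>walk_law e)"
  proof -
    have "?k * ?m - ?k\<^sup>2 * W2 e l = (\<Sum>z\<in>?G. ?k * (1 / res e z) - ?k\<^sup>2 * exp (- 2 * V e z))"
      unfolding green_def W2_def by (simp add: sum_subtractf sum_distrib_left)
    also have "\<dots> \<le> (\<Sum>z\<in>?G. prob (found k z))"
    proof (intro sum_mono)
      fix z assume z: "z \<in> ?G"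
      define p where "p = 1 / res e z"
      have p: "0 \<le> p" "p \<le> 1" "p \<le> exp (- V e z)"
        using hit_le_1[of e z "Some []"] inverse_res_nonneg inverse_res_le by (auto simp: p_def)
      have "1 - prob (found k z) = prob (- found k z)"
        using prob_compl[OF sets_found, of k z] by (simp add: Compl_eq_Diff_UNIV)
      also have "\<dots> \<le> (1 - p) ^ k"
        using prob_not_found_le[OF W, of z k] z p by (simp add: emeasure_eq_measure genD p_def)
      also have "\<dots> \<le> 1 - ?k * p + (?k * p)\<^sup>2" by (rule power_complement_le) (use p in auto)
      also have "(?k * p)\<^sup>2 \<le> ?k\<^sup>2 * exp (- 2 * V e z)"
      proof -
        have "p\<^sup>2 \<le> (exp (- V e z))\<^sup>2" using p by (intro power_mono) auto
        also have "\<dots> = exp (- 2 * V e z)" by (simp add: power2_eq_square flip: exp_add)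
        finally show ?thesis by (simp add: power_mult_distrib mult_left_mono)
      qed
      finally show "?k * (1 / res e z) - ?k\<^sup>2 * exp (- 2 * V e z) \<le> prob (found k z)"
        by (simp add: p_def)
    qed
    also have "\<dots> = (\<integral>X. N X \<partial>walk_law e)"
      unfolding N_def using ind by simp
    finally show ?thesis .
  qed
  have "2 * ?m / ?k * (?k * ?m - ?k\<^sup>2 * W2 e l) \<le> 2 * ?m / ?k * (\<integral>X. N X \<partial>walk_law e)"
    by (intro mult_left_mono 2) (auto simp: green_nonneg)
  moreover have "2 * ?m / ?k * (?k * ?m - ?k\<^sup>2 * W2 e l) = 2 * ?m\<^sup>2 - 2 * ?m * ?k * W2 e l"
    using k by (simp add: field_simps power2_eq_square)
  ultimately show ?thesis using 1 by linarith
qed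

lemma measurable_R [measurable]: "(\<lambda>X. R e X n l) \<in> borel_measurable (walk_law e)"
proof -
  have rt: "{X. X j = Some z \<and> enat j \<le> return_time X k} \<in> sets (walk_law e)" for j z k
  proof -
    have "enat j \<le> return_time X k \<longleftrightarrow> (j = 0 \<or> \<not> k \<le> returns (j - 1) X)" for X
    proof (cases j)
      case (Suc i)
      have "enat (Suc i) \<le> return_time X k \<longleftrightarrow> \<not> return_time X k \<le> enat i"
        by (cases "return_time X k") auto
      then show ?thesis by (simp add: return_time_le_iff Suc)
    qed (simp flip: zero_enat_def)
    then have "{X. X j = Some z \<and> enat j \<le> return_time X k} =
        {X \<in> space (walk_law e). X j = Some z \<and> (j = 0 \<or> \<not> k \<le> returns (j - 1) X)}" by simp
    also have "\<dots> \<in> sets (walk_law e)" by measurable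
    finally show ?thesis .
  qed
  have "(\<lambda>X. indicator (walk_range e X (return_time X k)) z :: real) \<in> borel_measurable (walk_law e)" for k z
  proof -
    have "{X. z \<in> walk_range e X (return_time X k)} =
        (if z \<in> tree e then \<Union>j\<in>{1..}. {X. X j = Some z \<and> enat j \<le> return_time X k} else {})"
      by (auto simp: walk_range_def)
    also have "\<dots> \<in> sets (walk_law e)" using rt by (auto intro!: sets.countable_UN')
    finally have m: "{X. z \<in> walk_range e X (return_time X k)} \<in> sets (walk_law e)" .
    have "(\<lambda>X. indicator (walk_range e X (return_time X k)) z :: real) =
        indicator {X. z \<in> walk_range e X (return_time X k)}"
      by (auto simp: indicator_def)
    then show ?thesis using m by simp
  qed
  then show ?thesis unfolding R_def by simp
qed

text \<open>
  A form of the second moment bound that is linear in \<open>green\<close>, \<open>pair_energy\<close> and \<open>W2\<close>, so that it can be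
  averaged over the environment term by term: \<open>\<bar>y\<bar> \<le> (a + y\<^sup>2 / a) / 2\<close> with \<open>a = \<eta> * (1 + green)\<close> removes the
  product \<open>green * W2\<close>.
\<close>

lemma quenched_L1_bound:
  fixes e :: env and n l :: nat
  assumes W: "\<And>n. W e n \<le> C" and n: "0 < n" and l: "0 < l" and \<eta>: "0 < \<eta>"
  defines "k \<equiv> nat \<lfloor>sqrt (real n)\<rfloor>"
  shows "(\<integral>\<^sup>+X. ennreal \<bar>R e X n l / real k - green e l\<bar> \<partial>walk_law e) \<le>
    ennreal (\<eta> * (1 + green e l) + (pair_energy e l / real k + real k * W2 e l) / \<eta>)"
proof -
  interpret prob_space "walk_law e" by (rule prob_space_walk_law)
  define N where "N X = (\<Sum>z\<in>gen e l. indicator (found k z) X :: real)" for X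
  define Y where "Y X = \<bar>N X / real k - green e l\<bar>" for X
  define a where "a = \<eta> * (1 + green e l)"
  have a: "0 < a" using \<eta> green_nonneg[of e l] by (auto simp: a_def)
  have k: "0 < k" using n by (auto simp: k_def)
  have "integrable (walk_law e) (\<lambda>X. indicator (found k z) X :: real)" for z
    by (rule integrable_const_bound[where B = 1]) (auto simp: indicator_def)
  then have Y_int: "integrable (walk_law e) Y" unfolding Y_def N_def
    by (intro integrable_abs Bochner_Integration.integrable_diff Bochner_Integration.integrable_divide
        Bochner_Integration.integrable_sum) auto
  have N_le: "\<bar>N X\<bar> \<le> real (card (gen e l))" for X
    unfolding N_def using sum_bounded_above[of "gen e l" "\<lambda>z. indicator (found k z) X" "1::real"]
    by (auto simp: sum_nonneg indicator_def)
  have Y2_int: "integrable (walk_law e) (\<lambda>X. (Y X)\<^sup>2)"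
  proof (rule integrable_const_bound[where B = "(real (card (gen e l)) / real k + green e l)\<^sup>2"])
    show "AE X in walk_law e. norm ((Y X)\<^sup>2) \<le> (real (card (gen e l)) / real k + green e l)\<^sup>2"
    proof (intro AE_I2)
      fix X
      have "\<bar>N X / real k - green e l\<bar> \<le> \<bar>N X\<bar> / real k + green e l"
        using green_nonneg[of e l] abs_triangle_ineq4[of "N X / real k" "green e l"] by simp
      also have "\<dots> \<le> real (card (gen e l)) / real k + green e l"
        using N_le[of X] by (simp add: divide_right_mono)
      finally have "(Y X)\<^sup>2 \<le> (real (card (gen e l)) / real k + green e l)\<^sup>2"
        unfolding Y_def by (rule power_mono) simp
      then show "norm ((Y X)\<^sup>2) \<le> (real (card (gen e l)) / real k + green e l)\<^sup>2"
        by simp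
    qed
    show "(\<lambda>X. (Y X)\<^sup>2) \<in> borel_measurable (walk_law e)" unfolding Y_def N_def by measurable
  qed
  have "(\<integral>\<^sup>+X. ennreal \<bar>R e X n l / real k - green e l\<bar> \<partial>walk_law e) = (\<integral>\<^sup>+X. ennreal (Y X) \<partial>walk_law e)"
  proof (rule nn_integral_cong_AE)
    show "AE X in walk_law e. ennreal \<bar>R e X n l / real k - green e l\<bar> = ennreal (Y X)"
      using AE_walk_start
    proof eventually_elim
      case (elim X)
      have "R e X n l = N X"
        unfolding R_def N_def k_def[symmetric]
      proof (intro sum.cong refl)
        fix z assume "z \<in> gen e l"
        then have "z \<in> tree e" "z \<noteq> []" using l by (auto dest: genD)
        then show "indicator (walk_range e X (return_time X k)) z = (indicator (found k z) X :: real)"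
          using walk_range_iff_visited[of X k z e] elim k by (auto simp: indicator_def found_def)
      qed
      then show ?case by (simp add: Y_def)
    qed
  qed
  also have "\<dots> = ennreal (\<integral>X. Y X \<partial>walk_law e)"
    by (rule nn_integral_eq_integral[OF Y_int]) (auto simp: Y_def)
  also have "\<dots> \<le> ennreal (a + (pair_energy e l / real k + real k * W2 e l) / \<eta>)"
  proof (rule ennreal_leI)
    have "(\<integral>X. Y X \<partial>walk_law e) \<le> (\<integral>X. (a + (Y X)\<^sup>2 / a) / 2 \<partial>walk_law e)"
    proof (rule integral_mono[OF Y_int])
      show "integrable (walk_law e) (\<lambda>X. (a + (Y X)\<^sup>2 / a) / 2)" using Y2_int by simp
      fix X
      have "0 \<le> (Y X - a)\<^sup>2" by simp
      then have "2 * a * Y X \<le> a * a + (Y X)\<^sup>2" by (simp add: power2_eq_square algebra_simps)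
      then show "Y X \<le> (a + (Y X)\<^sup>2 / a) / 2" using a by (simp add: field_simps)
    qed
    also have "\<dots> = (a + (\<integral>X. (Y X)\<^sup>2 \<partial>walk_law e) / a) / 2"
      using Y2_int by (simp add: prob_space[simplified])
    also have "(\<integral>X. (Y X)\<^sup>2 \<partial>walk_law e) \<le> 2 * (1 + green e l) * (pair_energy e l / real k + real k * W2 e l)"
    proof -
      have "(\<integral>X. (Y X)\<^sup>2 \<partial>walk_law e) \<le> 2 * pair_energy e l / real k + 2 * green e l * real k * W2 e l"
        unfolding Y_def N_def power2_abs by (rule quenched_second_moment[OF W k])
      also have "\<dots> \<le> 2 * (1 + green e l) * (pair_energy e l / real k + real k * W2 e l)"
        using green_nonneg[of e l] pair_energy_nonneg[of e l] W2_nonneg[of e l] by (simp add: algebra_simps)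
      finally show ?thesis .
    qed
    also have "(a + 2 * (1 + green e l) * (pair_energy e l / real k + real k * W2 e l) / a) / 2 =
        a / 2 + (pair_energy e l / real k + real k * W2 e l) / \<eta>"
    proof -
      have "1 + green e l \<noteq> 0" using green_nonneg[of e l] by linarith
      moreover have "(a + 2 * b * t / (\<eta> * b)) / 2 = a / 2 + t / \<eta>" if "b \<noteq> 0" for b t
        using \<eta> that by (simp add: field_simps)
      ultimately show ?thesis unfolding a_def by blast
    qed
    finally show "(\<integral>X. Y X \<partial>walk_law e) \<le> a + (pair_energy e l / real k + real k * W2 e l) / \<eta>"
      using a by (simp add: divide_right_mono)
  qed
  finally show ?thesis by (simp add: a_def)
qed

section \<open>Measurability in the environment\<close>

lemma space_real_seqs [simp]: "space real_seqs = UNIV"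
  by (simp add: real_seqs_def)

lemma measurable_length_real_seqs [measurable]: "length \<in> real_seqs \<rightarrow>\<^sub>M count_space UNIV"
proof (rule iffD2[OF measurable_count_space_eq_countable[OF countableI_type]], safe)
  fix n
  have "length -` {n} = {xs :: real list. length xs = n}" by auto
  also have "\<dots> \<in> sets real_seqs"
    unfolding real_seqs_def by (subst sets_measure_of) (auto intro!: sigma_sets.Basic)
  finally show "length -` {n} \<inter> space real_seqs \<in> sets real_seqs" by simp
qed auto

text \<open>
  Out of range \<open>xs ! i\<close> depends on the length of \<open>xs\<close> only, so it is measurable there too.
\<close>

lemma nth_ge_length: "length xs \<le> i \<Longrightarrow> xs ! i = [] ! (i - length xs)"
proof (induction xs arbitrary: i)
  case (Cons x xs)
  then show ?case by (cases i) auto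
qed simp

lemma measurable_nth_real_seqs [measurable]: "(\<lambda>xs. xs ! i) \<in> borel_measurable real_seqs"
proof (rule measurableI)
  fix B :: "real set" assume B: "B \<in> sets borel"
  have 1: "{xs. i < length xs \<and> xs ! i \<in> B} \<in> sets real_seqs"
    unfolding real_seqs_def using B by (subst sets_measure_of) (auto intro!: sigma_sets.Basic)
  have 2: "{xs \<in> space real_seqs. length xs \<le> i \<and> ([] :: real list) ! (i - length xs) \<in> B} \<in> sets real_seqs"
    by measurable
  have "(\<lambda>xs. xs ! i) -` B \<inter> space real_seqs = {xs. i < length xs \<and> xs ! i \<in> B} \<union>
      {xs \<in> space real_seqs. length xs \<le> i \<and> ([] :: real list) ! (i - length xs) \<in> B}"
  proof (rule set_eqI)
    fix xs :: "real list"
    show "xs \<in> (\<lambda>xs. xs ! i) -` B \<inter> space real_seqs \<longleftrightarrow> xs \<in> {xs. i < length xs \<and> xs ! i \<in> B} \<union>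
        {xs \<in> space real_seqs. length xs \<le> i \<and> ([] :: real list) ! (i - length xs) \<in> B}"
      using nth_ge_length[of xs i] by (cases "i < length xs") auto
  qed
  also have "\<dots> \<in> sets real_seqs" using 1 2 by (rule sets.Un)
  finally show "(\<lambda>xs. xs ! i) -` B \<inter> space real_seqs \<in> sets real_seqs" .
qed simp

abbreviation env_space :: "env measure" where
  "env_space \<equiv> PiM UNIV (\<lambda>_. real_seqs)"

lemma measurable_env_coordinate [measurable (raw)]:
  assumes [measurable]: "f \<in> N \<rightarrow>\<^sub>M env_space"
  shows "(\<lambda>w. f w u) \<in> N \<rightarrow>\<^sub>M real_seqs"
  by (rule measurable_compose[OF assms measurable_component_singleton]) auto

lemma measurable_V [measurable (raw)]:
  assumes [measurable]: "f \<in> N \<rightarrow>\<^sub>M env_space"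
  shows "(\<lambda>w. V (f w) u) \<in> borel_measurable N"
  unfolding V_def by measurable

lemma measurable_res [measurable (raw)]:
  assumes [measurable]: "f \<in> N \<rightarrow>\<^sub>M env_space"
  shows "(\<lambda>w. res (f w) u) \<in> borel_measurable N"
  unfolding res_def by measurable

lemma measurable_res_common [measurable (raw)]:
  assumes [measurable]: "f \<in> N \<rightarrow>\<^sub>M env_space"
  shows "(\<lambda>w. res_common (f w) u v) \<in> borel_measurable N"
  unfolding res_common_def by measurable

text \<open>
  A generation takes countably many values, so it may be frozen when measurability is checked.
\<close>

lemma measurable_gen_functional:
  assumes f [measurable]: "f \<in> N \<rightarrow>\<^sub>M env_space"
    and \<Phi>: "\<And>G. finite G \<Longrightarrow> \<Phi> G \<in> N \<rightarrow>\<^sub>M K"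
  shows "(\<lambda>w. \<Phi> (gen (f w) r) w) \<in> N \<rightarrow>\<^sub>M K"
proof (rule measurable_compose_countable'[where I = "{G. finite G}"])
  show "countable {G :: vertex set. finite G}" by (rule countable_Collect_finite)
  then show "(\<lambda>w. gen (f w) r) \<in> N \<rightarrow>\<^sub>M count_space {G. finite G}"
  proof (subst measurable_count_space_eq_countable, safe)
    fix G :: "vertex set"
    have "{w \<in> space N. \<forall>u. (length u = r \<and> (\<forall>k<length u. u ! k < length (f w (take k u)))) \<longleftrightarrow> u \<in> G} \<in> sets N"
      by measurable
    also have "{w \<in> space N. \<forall>u. (length u = r \<and> (\<forall>k<length u. u ! k < length (f w (take k u)))) \<longleftrightarrow> u \<in> G} =
        (\<lambda>w. gen (f w) r) -` {G} \<inter> space N"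
      by (auto simp: gen_def tree_def set_eq_iff)
    finally show "(\<lambda>w. gen (f w) r) -` {G} \<inter> space N \<in> sets N" .
  qed (auto simp: finite_gen)
qed (use \<Phi> in auto)

lemma measurable_gen_sum [measurable (raw)]:
  fixes \<phi> :: "'w \<Rightarrow> vertex \<Rightarrow> real"
  assumes "f \<in> N \<rightarrow>\<^sub>M env_space" "\<And>u. (\<lambda>w. \<phi> w u) \<in> borel_measurable N"
  shows "(\<lambda>w. \<Sum>u\<in>gen (f w) r. \<phi> w u) \<in> borel_measurable N"
  by (rule measurable_gen_functional[where \<Phi> = "\<lambda>G w. \<Sum>u\<in>G. \<phi> w u"]) (use assms in measurable)

lemma measurable_gen_sum_ennreal [measurable (raw)]:
  fixes \<phi> :: "'w \<Rightarrow> vertex \<Rightarrow> ennreal"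
  assumes "f \<in> N \<rightarrow>\<^sub>M env_space" "\<And>u. (\<lambda>w. \<phi> w u) \<in> borel_measurable N"
  shows "(\<lambda>w. \<Sum>u\<in>gen (f w) r. \<phi> w u) \<in> borel_measurable N"
  by (rule measurable_gen_functional[where \<Phi> = "\<lambda>G w. \<Sum>u\<in>G. \<phi> w u"]) (use assms in measurable)

lemma measurable_W [measurable (raw)]:
  assumes [measurable]: "f \<in> N \<rightarrow>\<^sub>M env_space"
  shows "(\<lambda>w. W (f w) r) \<in> borel_measurable N"
  unfolding W_def by measurable

lemma measurable_W2 [measurable (raw)]:
  assumes [measurable]: "f \<in> N \<rightarrow>\<^sub>M env_space"
  shows "(\<lambda>w. W2 (f w) r) \<in> borel_measurable N"
  unfolding W2_def by measurable

lemma measurable_green [measurable (raw)]: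
  assumes [measurable]: "f \<in> N \<rightarrow>\<^sub>M env_space"
  shows "(\<lambda>w. green (f w) r) \<in> borel_measurable N"
  unfolding green_def by measurable

lemma measurable_pair_energy [measurable (raw)]:
  assumes [measurable]: "f \<in> N \<rightarrow>\<^sub>M env_space"
  shows "(\<lambda>w. pair_energy (f w) r) \<in> borel_measurable N"
  unfolding pair_energy_def sum.cartesian_product[symmetric] by measurable

section \<open>The branching property\<close>

lemma (in prob_space) nn_integral_indep_restrict:
  assumes ind: "indep_vars N X I" and AB: "A \<inter> B = {}" "A \<subseteq> I" "B \<subseteq> I"
    and F: "case_prod F \<in> borel_measurable (PiM A N \<Otimes>\<^sub>M PiM B N)"
  shows "(\<integral>\<^sup>+\<omega>. F (\<lambda>i\<in>A. X i \<omega>) (\<lambda>i\<in>B. X i \<omega>) \<partial>M) =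
    (\<integral>\<^sup>+\<omega>. (\<integral>\<^sup>+\<omega>'. F (\<lambda>i\<in>A. X i \<omega>) (\<lambda>i\<in>B. X i \<omega>') \<partial>M) \<partial>M)"
proof -
  let ?X = "\<lambda>\<omega>. \<lambda>i\<in>A. X i \<omega>" and ?Y = "\<lambda>\<omega>. \<lambda>i\<in>B. X i \<omega>"
  let ?S = "PiM A N" and ?T = "PiM B N"
  have rv: "random_variable ?S ?X" "random_variable ?T ?Y"
    and eq: "distr M ?S ?X \<Otimes>\<^sub>M distr M ?T ?Y = distr M (?S \<Otimes>\<^sub>M ?T) (\<lambda>\<omega>. (?X \<omega>, ?Y \<omega>))"
    using indep_var_restrict[OF ind AB] unfolding indep_var_distribution_eq by auto
  note [measurable] = rv F
  interpret Y: prob_space "distr M ?T ?Y" by (rule prob_space_distr) (rule rv)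
  have "(\<integral>\<^sup>+\<omega>. F (?X \<omega>) (?Y \<omega>) \<partial>M) = (\<integral>\<^sup>+p. case_prod F p \<partial>distr M (?S \<Otimes>\<^sub>M ?T) (\<lambda>\<omega>. (?X \<omega>, ?Y \<omega>)))"
    by (subst nn_integral_distr) auto
  also have "\<dots> = (\<integral>\<^sup>+x. (\<integral>\<^sup>+y. F x y \<partial>distr M ?T ?Y) \<partial>distr M ?S ?X)"
  proof -
    have "sets (distr M ?S ?X \<Otimes>\<^sub>M distr M ?T ?Y) = sets (?S \<Otimes>\<^sub>M ?T)"
      by (intro sets_pair_measure_cong) auto
    then have "case_prod F \<in> borel_measurable (distr M ?S ?X \<Otimes>\<^sub>M distr M ?T ?Y)"
      using F measurable_cong_sets[OF _ refl] by blast
    from Y.nn_integral_fst[OF this] show ?thesis by (simp add: eq)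
  qed
  also have "\<dots> = (\<integral>\<^sup>+\<omega>. (\<integral>\<^sup>+y. F (?X \<omega>) y \<partial>distr M ?T ?Y) \<partial>M)"
    by (rule nn_integral_distr) auto
  also have "\<dots> = (\<integral>\<^sup>+\<omega>. (\<integral>\<^sup>+\<omega>'. F (?X \<omega>) (?Y \<omega>') \<partial>M) \<partial>M)"
  proof (rule nn_integral_cong)
    fix \<omega> assume "\<omega> \<in> space M"
    then have "?X \<omega> \<in> space ?S" by (rule measurable_space[OF rv(1)])
    then have "F (?X \<omega>) \<in> borel_measurable ?T" by measurable
    then show "(\<integral>\<^sup>+y. F (?X \<omega>) y \<partial>distr M ?T ?Y) = (\<integral>\<^sup>+\<omega>'. F (?X \<omega>) (?Y \<omega>') \<partial>M)"
      by (intro nn_integral_distr) auto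
  qed
  finally show ?thesis .
qed

definition agree_below :: "nat \<Rightarrow> env \<Rightarrow> env \<Rightarrow> bool" where
  "agree_below r x y \<longleftrightarrow> (\<forall>u. length u < r \<longrightarrow> x u = y u)"

definition agree_from :: "nat \<Rightarrow> env \<Rightarrow> env \<Rightarrow> bool" where
  "agree_from r x y \<longleftrightarrow> (\<forall>u. r \<le> length u \<longrightarrow> x u = y u)"

lemma agree_below_V: "agree_below r x y \<Longrightarrow> length u \<le> r \<Longrightarrow> V x u = V y u"
  unfolding V_def agree_below_def by (intro sum.cong) auto

lemma agree_below_gen: "agree_below r x y \<Longrightarrow> n \<le> r \<Longrightarrow> gen x n = gen y n"
  unfolding gen_def tree_def agree_below_def by auto

lemma agree_below_res: "agree_below r x y \<Longrightarrow> length u \<le> r \<Longrightarrow> res x u = res y u"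
  unfolding res_def by (intro sum.cong refl arg_cong[of _ _ exp] agree_below_V[of r]) auto

lemma agree_below_res_common:
  "agree_below r x y \<Longrightarrow> length u \<le> r \<Longrightarrow> res_common x u v = res_common y u v"
  unfolding res_common_def by (intro sum.cong refl arg_cong[of _ _ exp] agree_below_V[of r]) auto

definition mass :: "real list \<Rightarrow> real" where
  "mass xs = (\<Sum>i<length xs. exp (- (xs ! i)))"

definition mass2 :: "real list \<Rightarrow> real" where
  "mass2 xs = (\<Sum>i<length xs. exp (- 2 * (xs ! i)))"

lemma mass_nonneg: "0 \<le> mass xs" and mass2_nonneg: "0 \<le> mass2 xs"
  unfolding mass_def mass2_def by (auto intro: sum_nonneg)

lemma measurable_list_sum [measurable (raw)]:
  fixes g :: "nat \<Rightarrow> 'w \<Rightarrow> real"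
  assumes [measurable]: "f \<in> N \<rightarrow>\<^sub>M real_seqs" "\<And>i. g i \<in> borel_measurable N"
  shows "(\<lambda>w. \<Sum>i<length (f w). g i w) \<in> borel_measurable N"
  by (rule measurable_compose_countable[where g = "\<lambda>w. length (f w)"
        and f = "\<lambda>n w. \<Sum>i<n. g i w"]) measurable

lemma measurable_mass [measurable]: "mass \<in> borel_measurable real_seqs"
  unfolding mass_def by measurable

lemma measurable_mass2 [measurable]: "mass2 \<in> borel_measurable real_seqs"
  unfolding mass2_def by measurable

text \<open>
  The moments on which the proof rests: \<open>W\<close> has mean one, the analogous sum with exponent \<open>2\<close> has mean
  \<open>q < 1\<close>, and \<open>\<sigma>\<close> bounds the second moment of \<open>W 1\<close>.
\<close>

locale branching_walk = prob_space M for M :: "'w measure" +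
  fixes Env :: "'w \<Rightarrow> env" and q \<sigma> :: real
  assumes indep: "indep_vars (\<lambda>_. real_seqs) (\<lambda>u \<omega>. Env \<omega> u) UNIV"
    and ident: "\<And>u. distr M real_seqs (\<lambda>\<omega>. Env \<omega> u) = distr M real_seqs (\<lambda>\<omega>. Env \<omega> [])"
    and mean_mass: "(\<integral>\<^sup>+\<omega>. ennreal (mass (Env \<omega> [])) \<partial>M) = 1"
    and mean_mass2: "(\<integral>\<^sup>+\<omega>. ennreal (mass2 (Env \<omega> [])) \<partial>M) = ennreal q"
    and q: "0 < q" "q < 1"
    and mean_mass_sq: "(\<integral>\<^sup>+\<omega>. ennreal ((mass (Env \<omega> []))\<^sup>2) \<partial>M) \<le> ennreal \<sigma>"
    and \<sigma>: "0 \<le> \<sigma>"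
begin

lemma measurable_Env_coordinate [measurable]: "(\<lambda>\<omega>. Env \<omega> u) \<in> M \<rightarrow>\<^sub>M real_seqs"
  using indep by (simp add: indep_vars_def)

lemma measurable_Env [measurable]: "Env \<in> M \<rightarrow>\<^sub>M env_space"
  by (rule measurable_PiM_single') auto

lemma nn_integral_coordinate:
  assumes [measurable]: "\<phi> \<in> borel_measurable real_seqs"
  shows "(\<integral>\<^sup>+\<omega>. \<phi> (Env \<omega> u) \<partial>M) = (\<integral>\<^sup>+\<omega>. \<phi> (Env \<omega> []) \<partial>M)"
proof -
  have "(\<integral>\<^sup>+\<omega>. \<phi> (Env \<omega> v) \<partial>M) = (\<integral>\<^sup>+xs. \<phi> xs \<partial>distr M real_seqs (\<lambda>\<omega>. Env \<omega> v))" for v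
    by (rule nn_integral_distr[symmetric]) auto
  then show ?thesis by (simp add: ident[of u])
qed

text \<open>
  The marks below generation \<open>r\<close> are independent of the others, so the two occurrences of the environment may
  be decoupled.
\<close>

lemma nn_integral_past_future:
  assumes F: "case_prod F \<in> borel_measurable (env_space \<Otimes>\<^sub>M env_space)"
    and past: "\<And>x x' y. agree_below r x x' \<Longrightarrow> F x y = F x' y"
    and future: "\<And>x y y'. agree_from r y y' \<Longrightarrow> F x y = F x y'"
  shows "(\<integral>\<^sup>+\<omega>. F (Env \<omega>) (Env \<omega>) \<partial>M) = (\<integral>\<^sup>+\<omega>. (\<integral>\<^sup>+\<omega>'. F (Env \<omega>) (Env \<omega>') \<partial>M) \<partial>M)"
proof -
  let ?A = "{u :: vertex. length u < r}" and ?B = "{u :: vertex. r \<le> length u}"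
  have eq: "F (\<lambda>i\<in>?A. x i) (\<lambda>i\<in>?B. y i) = F x y" for x y
    using past[of "\<lambda>i\<in>?A. x i" x "\<lambda>i\<in>?B. y i"] future[of "\<lambda>i\<in>?B. y i" y x]
    by (simp add: agree_below_def agree_from_def)
  have emb: "(\<lambda>x. x) \<in> PiM C (\<lambda>_. real_seqs) \<rightarrow>\<^sub>M env_space" for C :: "vertex set"
  proof (rule measurable_PiM_single')
    fix u :: vertex
    show "(\<lambda>x. x u) \<in> PiM C (\<lambda>_. real_seqs) \<rightarrow>\<^sub>M real_seqs"
    proof (cases "u \<in> C")
      case False
      then have "(\<lambda>x. x u) \<in> PiM C (\<lambda>_. real_seqs) \<rightarrow>\<^sub>M real_seqs \<longleftrightarrow>
          (\<lambda>x. undefined) \<in> PiM C (\<lambda>_. real_seqs) \<rightarrow>\<^sub>M real_seqs"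
        by (intro measurable_cong) (auto simp: space_PiM PiE_iff extensional_def)
      then show ?thesis by simp
    qed (rule measurable_component_singleton)
  qed auto
  have "case_prod F \<in> borel_measurable (PiM ?A (\<lambda>_. real_seqs) \<Otimes>\<^sub>M PiM ?B (\<lambda>_. real_seqs))"
  proof -
    have "(\<lambda>p. (fst p, snd p)) \<in> PiM ?A (\<lambda>_. real_seqs) \<Otimes>\<^sub>M PiM ?B (\<lambda>_. real_seqs) \<rightarrow>\<^sub>M
        env_space \<Otimes>\<^sub>M env_space"
      by (intro measurable_Pair measurable_compose[OF measurable_fst emb]
          measurable_compose[OF measurable_snd emb])
    from measurable_compose[OF this F] show ?thesis by simp
  qed
  moreover have "?A \<inter> ?B = {}" by auto
  ultimately show ?thesis
    using nn_integral_indep_restrict[OF indep, of ?A ?B F] unfolding eq by simp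
qed

text \<open>
  The many-to-one step: integrate out the offspring of generation \<open>r\<close> given the past.
\<close>

lemma nn_integral_gen_step:
  fixes \<alpha> :: "env \<Rightarrow> vertex \<Rightarrow> ennreal"
  assumes \<alpha> [measurable]: "\<And>u. (\<lambda>x. \<alpha> x u) \<in> borel_measurable env_space"
    and past: "\<And>x y u. agree_below r x y \<Longrightarrow> length u = r \<Longrightarrow> \<alpha> x u = \<alpha> y u"
    and \<kappa> [measurable]: "\<kappa> \<in> borel_measurable real_seqs"
  shows "(\<integral>\<^sup>+\<omega>. (\<Sum>u\<in>gen (Env \<omega>) r. \<alpha> (Env \<omega>) u * \<kappa> (Env \<omega> u)) \<partial>M) =
    (\<integral>\<^sup>+\<omega>. (\<Sum>u\<in>gen (Env \<omega>) r. \<alpha> (Env \<omega>) u) \<partial>M) * (\<integral>\<^sup>+\<omega>. \<kappa> (Env \<omega> []) \<partial>M)"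
proof -
  define K where "K = (\<integral>\<^sup>+\<omega>. \<kappa> (Env \<omega> []) \<partial>M)"
  have K: "(\<integral>\<^sup>+\<omega>. \<kappa> (Env \<omega> u) \<partial>M) = K" for u
    unfolding K_def by (rule nn_integral_coordinate[OF \<kappa>])
  have \<alpha>' [measurable]: "(\<lambda>p. \<alpha> (fst p) u) \<in> borel_measurable (env_space \<Otimes>\<^sub>M env_space)" for u
    by (rule measurable_compose[OF measurable_fst \<alpha>])
  have "(\<integral>\<^sup>+\<omega>. (\<Sum>u\<in>gen (Env \<omega>) r. \<alpha> (Env \<omega>) u * \<kappa> (Env \<omega> u)) \<partial>M) =
      (\<integral>\<^sup>+\<omega>. (\<integral>\<^sup>+\<omega>'. (\<Sum>u\<in>gen (Env \<omega>) r. \<alpha> (Env \<omega>) u * \<kappa> (Env \<omega>' u)) \<partial>M) \<partial>M)"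
  proof (rule nn_integral_past_future[where r = r and F = "\<lambda>x y. \<Sum>u\<in>gen x r. \<alpha> x u * \<kappa> (y u)"])
    show "(\<lambda>(x, y). \<Sum>u\<in>gen x r. \<alpha> x u * \<kappa> (y u)) \<in> borel_measurable (env_space \<Otimes>\<^sub>M env_space)"
      unfolding split_beta by measurable
    show "(\<Sum>u\<in>gen x r. \<alpha> x u * \<kappa> (y u)) = (\<Sum>u\<in>gen x' r. \<alpha> x' u * \<kappa> (y u))" if "agree_below r x x'" for x x' y
      using agree_below_gen[OF that order_refl] past[OF that] by (intro sum.cong) (auto dest: genD)
    show "(\<Sum>u\<in>gen x r. \<alpha> x u * \<kappa> (y u)) = (\<Sum>u\<in>gen x r. \<alpha> x u * \<kappa> (y' u))" if "agree_from r y y'" for x y y'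
      using that by (intro sum.cong) (auto simp: agree_from_def dest: genD)
  qed
  also have "\<dots> = (\<integral>\<^sup>+\<omega>. (\<Sum>u\<in>gen (Env \<omega>) r. \<alpha> (Env \<omega>) u) * K \<partial>M)"
    by (intro nn_integral_cong) (simp add: nn_integral_sum nn_integral_cmult K sum_distrib_right)
  also have "\<dots> = (\<integral>\<^sup>+\<omega>. (\<Sum>u\<in>gen (Env \<omega>) r. \<alpha> (Env \<omega>) u) \<partial>M) * (\<integral>\<^sup>+\<omega>. \<kappa> (Env \<omega> []) \<partial>M)"
    unfolding K_def by (rule nn_integral_multc) measurable
  finally show ?thesis .
qed

end

section \<open>Moments of the additive martingale and of the pair energy\<close>

lemma sum_children_exp:
  "(\<Sum>y\<in>children e x. exp (- V e y)) = exp (- V e x) * mass (e x)"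
  unfolding sum_children mass_def sum_distrib_left
  by (intro sum.cong refl) (simp add: V_snoc flip: exp_add)

lemma W_Suc: "W e (Suc r) = (\<Sum>u\<in>gen e r. exp (- V e u) * mass (e u))"
  by (simp add: W_def sum_gen_Suc sum_children_exp)

lemma W2_Suc: "W2 e (Suc r) = (\<Sum>u\<in>gen e r. exp (- 2 * V e u) * mass2 (e u))"
  unfolding W2_def sum_gen_Suc sum_children mass2_def sum_distrib_left
  by (intro sum.cong refl) (simp add: V_snoc algebra_simps flip: exp_add)

definition res_W2 :: "env \<Rightarrow> nat \<Rightarrow> real" where
  "res_W2 e l = (\<Sum>z\<in>gen e l. res e z * exp (- 2 * V e z))"

lemma measurable_res_W2 [measurable (raw)]:
  assumes [measurable]: "f \<in> N \<rightarrow>\<^sub>M env_space"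
  shows "(\<lambda>w. res_W2 (f w) r) \<in> borel_measurable N"
  unfolding res_W2_def by measurable

lemma res_W2_Suc:
  "res_W2 e (Suc r) = (\<Sum>u\<in>gen e r. res e u * exp (- 2 * V e u) * mass2 (e u)) + W e (Suc r)"
proof -
  have "(\<Sum>y\<in>children e u. res e y * exp (- 2 * V e y)) =
      res e u * exp (- 2 * V e u) * mass2 (e u) + exp (- V e u) * mass (e u)" for u
  proof -
    have "res e (u @ [i]) * exp (- 2 * V e (u @ [i])) =
        res e u * exp (- 2 * V e u) * exp (- 2 * (e u ! i)) + exp (- V e u) * exp (- (e u ! i))" for i
      by (simp add: res_snoc V_snoc distrib_right mult.assoc flip: exp_add)
    then show ?thesis
      by (simp add: sum_children mass_def mass2_def sum.distrib sum_distrib_left)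
  qed
  then show ?thesis by (simp add: res_W2_def W_Suc sum_gen_Suc sum.distrib)
qed

lemma res_common_siblings:
  assumes "length u = length u'"
  shows "res_common e (u @ [i]) (u' @ [i']) =
    res_common e u u' + (if u = u' \<and> i = i' then exp (V e (u @ [i])) else 0)"
proof -
  have "res_common e (u @ [i]) (u' @ [i']) = res_common e u (u' @ [i']) +
      (if u = u' \<and> i = i' then exp (V e (u @ [i])) else 0)"
    using assms by (auto simp: res_common_snoc)
  also have "res_common e u (u' @ [i']) = res_common e u u'"
    using assms unfolding res_common_commute[of e u] by (auto simp: res_common_snoc)
  finally show ?thesis .
qed

text \<open>
  Descendants of distinct vertices inherit the common resistance of their parents, and so do distinct
  siblings, whose common resistance is that of their parent; only a vertex paired with itself gains
  the resistance of its own edge, which contributes \<open>W\<close>.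
\<close>

lemma pair_energy_Suc:
  "pair_energy e (Suc r) =
    (\<Sum>(u, u')\<in>gen e r \<times> gen e r.
       res_common e u u' * exp (- V e u) * exp (- V e u') * (mass (e u) * mass (e u'))) + W e (Suc r)"
proof -
  let ?G = "gen e r"
  define a where "a u i = exp (- V e (u @ [i]))" for u i
  have a_sum: "(\<Sum>i<length (e u). a u i) = exp (- V e u) * mass (e u)" for u
    using sum_children_exp[of e u] by (simp add: sum_children a_def)
  have "pair_energy e (Suc r) =
      (\<Sum>u\<in>?G. \<Sum>i<length (e u). \<Sum>u'\<in>?G. \<Sum>i'<length (e u').
        res_common e (u @ [i]) (u' @ [i']) * a u i * a u' i')"
    unfolding pair_energy_def sum.cartesian_product[symmetric] sum_gen_Suc sum_children a_def ..
  also have "\<dots> = (\<Sum>u\<in>?G. \<Sum>i<length (e u). \<Sum>u'\<in>?G. \<Sum>i'<length (e u').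
        res_common e u u' * a u i * a u' i' + (if u' = u then if i' = i then a u i else 0 else 0))"
  proof (intro sum.cong refl)
    fix u i u' i' assume "u \<in> ?G" "u' \<in> ?G"
    then have "length u = length u'" by (auto dest: genD)
    then have eq: "res_common e (u @ [i]) (u' @ [i']) =
        res_common e u u' + (if u = u' \<and> i = i' then exp (V e (u @ [i])) else 0)"
      by (rule res_common_siblings)
    have "exp (V e (u @ [i])) * (a u i * a u i) = a u i"
      by (simp add: a_def flip: exp_add)
    then show "res_common e (u @ [i]) (u' @ [i']) * a u i * a u' i' =
        res_common e u u' * a u i * a u' i' + (if u' = u then if i' = i then a u i else 0 else 0)"
      unfolding eq by (auto simp: distrib_right mult.assoc)
  qed
  also have "\<dots> = (\<Sum>u\<in>?G. \<Sum>i<length (e u). \<Sum>u'\<in>?G. \<Sum>i'<length (e u').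
        res_common e u u' * a u i * a u' i') +
      (\<Sum>u\<in>?G. \<Sum>i<length (e u). \<Sum>u'\<in>?G. \<Sum>i'<length (e u'). if u' = u then if i' = i then a u i else 0 else 0)"
    by (simp add: sum.distrib)
  also have "(\<Sum>u\<in>?G. \<Sum>i<length (e u). \<Sum>u'\<in>?G. \<Sum>i'<length (e u'). if u' = u then if i' = i then a u i else 0 else 0) =
      (\<Sum>u\<in>?G. \<Sum>i<length (e u). a u i)"
  proof (intro sum.cong refl)
    fix u i assume ui: "u \<in> ?G" "i \<in> {..<length (e u)}"
    have "(\<Sum>u'\<in>?G. \<Sum>i'<length (e u'). if u' = u then if i' = i then a u i else 0 else 0) =
        (\<Sum>u'\<in>?G. if u' = u then a u i else 0)"
      using ui by (intro sum.cong) auto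
    also have "\<dots> = a u i" using ui by (simp add: finite_gen)
    finally show "(\<Sum>u'\<in>?G. \<Sum>i'<length (e u'). if u' = u then if i' = i then a u i else 0 else 0) = a u i" .
  qed
  also have "\<dots> = W e (Suc r)" by (simp add: a_sum W_Suc)
  also have "(\<Sum>u\<in>?G. \<Sum>i<length (e u). \<Sum>u'\<in>?G. \<Sum>i'<length (e u'). res_common e u u' * a u i * a u' i') =
      (\<Sum>(u, u')\<in>?G \<times> ?G. res_common e u u' * exp (- V e u) * exp (- V e u') * (mass (e u) * mass (e u')))"
  proof -
    have "(\<Sum>i<length (e u). \<Sum>u'\<in>?G. \<Sum>i'<length (e u'). res_common e u u' * a u i * a u' i') =
        (\<Sum>u'\<in>?G. res_common e u u' * exp (- V e u) * exp (- V e u') * (mass (e u) * mass (e u')))" for u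
    proof -
      have "(\<Sum>i<length (e u). \<Sum>u'\<in>?G. \<Sum>i'<length (e u'). res_common e u u' * a u i * a u' i') =
          (\<Sum>u'\<in>?G. \<Sum>i<length (e u). \<Sum>i'<length (e u'). res_common e u u' * (a u i * a u' i'))"
        by (subst sum.swap) (simp add: mult.assoc)
      also have "\<dots> = (\<Sum>u'\<in>?G. res_common e u u' * ((\<Sum>i<length (e u). a u i) * (\<Sum>i'<length (e u'). a u' i')))"
        by (intro sum.cong refl, subst sum_product) (simp only: sum_distrib_left)
      finally show ?thesis unfolding a_sum by (simp add: mult_ac)
    qed
    then show ?thesis by (simp add: sum.cartesian_product[symmetric])
  qed
  finally show ?thesis .
qed

lemma agree_below_mono: "agree_below n x y \<Longrightarrow> m \<le> n \<Longrightarrow> agree_below m x y"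
  by (auto simp: agree_below_def)

lemma ennreal_sum_mult:
  assumes "\<And>i. i \<in> I \<Longrightarrow> 0 \<le> a i" "\<And>i. i \<in> I \<Longrightarrow> 0 \<le> b i"
  shows "ennreal (\<Sum>i\<in>I. a i * b i) = (\<Sum>i\<in>I. ennreal (a i) * ennreal (b i))"
proof -
  have "ennreal (\<Sum>i\<in>I. a i * b i) = (\<Sum>i\<in>I. ennreal (a i * b i))"
    using assms by (intro sum_ennreal[symmetric]) auto
  also have "\<dots> = (\<Sum>i\<in>I. ennreal (a i) * ennreal (b i))"
    using assms by (intro sum.cong refl ennreal_mult) auto
  finally show ?thesis .
qed

lemma res_nonneg [simp]: "0 \<le> res e u"
  by (simp add: less_imp_le)

lemma W_nonneg: "0 \<le> W e r"
  unfolding W_def by (intro sum_nonneg) auto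

context branching_walk
begin

lemma mean_W: "(\<integral>\<^sup>+\<omega>. ennreal (W (Env \<omega>) r) \<partial>M) = 1"
proof (induction r)
  case 0
  show ?case by (simp add: W_def emeasure_space_1)
next
  case (Suc r)
  have "(\<integral>\<^sup>+\<omega>. ennreal (W (Env \<omega>) (Suc r)) \<partial>M) =
      (\<integral>\<^sup>+\<omega>. (\<Sum>u\<in>gen (Env \<omega>) r. ennreal (exp (- V (Env \<omega>) u)) * ennreal (mass (Env \<omega> u))) \<partial>M)"
    unfolding W_Suc by (intro nn_integral_cong ennreal_sum_mult) (auto intro: mass_nonneg)
  also have "\<dots> = (\<integral>\<^sup>+\<omega>. (\<Sum>u\<in>gen (Env \<omega>) r. ennreal (exp (- V (Env \<omega>) u))) \<partial>M) *
      (\<integral>\<^sup>+\<omega>. ennreal (mass (Env \<omega> [])) \<partial>M)"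
    by (rule nn_integral_gen_step[where \<kappa> = "\<lambda>xs. ennreal (mass xs)"
          and \<alpha> = "\<lambda>x u. ennreal (exp (- V x u))"]) (auto simp: agree_below_V)
  also have "\<dots> = 1"
    using Suc by (simp add: mean_mass W_def)
  finally show ?case .
qed

lemma mean_W2_Suc:
  assumes a [measurable]: "a \<in> borel_measurable env_space"
    and past: "\<And>x y. agree_below r x y \<Longrightarrow> a x = a y"
  shows "(\<integral>\<^sup>+\<omega>. a (Env \<omega>) * ennreal (W2 (Env \<omega>) (Suc r)) \<partial>M) =
    (\<integral>\<^sup>+\<omega>. a (Env \<omega>) * ennreal (W2 (Env \<omega>) r) \<partial>M) * ennreal q"
proof -
  have "(\<integral>\<^sup>+\<omega>. a (Env \<omega>) * ennreal (W2 (Env \<omega>) (Suc r)) \<partial>M) =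
      (\<integral>\<^sup>+\<omega>. (\<Sum>u\<in>gen (Env \<omega>) r. a (Env \<omega>) * ennreal (exp (- 2 * V (Env \<omega>) u)) *
        ennreal (mass2 (Env \<omega> u))) \<partial>M)"
    unfolding W2_Suc
    by (intro nn_integral_cong, subst ennreal_sum_mult) (auto intro: mass2_nonneg simp: sum_distrib_left mult.assoc)
  also have "\<dots> = (\<integral>\<^sup>+\<omega>. (\<Sum>u\<in>gen (Env \<omega>) r. a (Env \<omega>) * ennreal (exp (- 2 * V (Env \<omega>) u))) \<partial>M) *
      (\<integral>\<^sup>+\<omega>. ennreal (mass2 (Env \<omega> [])) \<partial>M)"
    by (rule nn_integral_gen_step[where \<kappa> = "\<lambda>xs. ennreal (mass2 xs)"
          and \<alpha> = "\<lambda>x u. a x * ennreal (exp (- 2 * V x u))"]) (auto simp: agree_below_V past)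
  finally show ?thesis
    by (simp add: mean_mass2 W2_def flip: sum_distrib_left)
qed

text \<open>
  The weight \<open>a\<close> will be the indicator of an event decided by generation \<open>m\<close>.
\<close>

lemma mean_W2_decreasing:
  assumes a [measurable]: "a \<in> borel_measurable env_space"
    and past: "\<And>x y. agree_below m x y \<Longrightarrow> a x = a y"
    and "m \<le> l"
  shows "(\<integral>\<^sup>+\<omega>. a (Env \<omega>) * ennreal (W2 (Env \<omega>) l) \<partial>M) \<le>
    (\<integral>\<^sup>+\<omega>. a (Env \<omega>) * ennreal (W2 (Env \<omega>) m) \<partial>M)"
  using \<open>m \<le> l\<close>
proof (induction l rule: dec_induct)
  case (step l)
  have "ennreal q \<le> 1" using q by simp
  have "(\<integral>\<^sup>+\<omega>. a (Env \<omega>) * ennreal (W2 (Env \<omega>) (Suc l)) \<partial>M) =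
      (\<integral>\<^sup>+\<omega>. a (Env \<omega>) * ennreal (W2 (Env \<omega>) l) \<partial>M) * ennreal q"
    using step by (intro mean_W2_Suc a past) (auto intro: agree_below_mono)
  also have "\<dots> \<le> (\<integral>\<^sup>+\<omega>. a (Env \<omega>) * ennreal (W2 (Env \<omega>) l) \<partial>M) * 1"
    by (intro mult_left_mono \<open>ennreal q \<le> 1\<close>) auto
  finally show ?case using step by simp
qed simp

lemma mean_W2: "(\<integral>\<^sup>+\<omega>. ennreal (W2 (Env \<omega>) r) \<partial>M) = ennreal (q ^ r)"
proof (induction r)
  case 0
  show ?case by (simp add: W2_def emeasure_space_1)
next
  case (Suc r)
  then show ?case
    using mean_W2_Suc[of "\<lambda>_. 1" r] q by (simp add: ennreal_mult' mult.commute)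
qed

lemma mean_res_W2: "(\<integral>\<^sup>+\<omega>. ennreal (res_W2 (Env \<omega>) r) \<partial>M) \<le> ennreal (1 / (1 - q))"
proof (induction r)
  case 0
  have "1 \<le> 1 / (1 - q)" using q by simp
  then show ?case by (simp add: res_W2_def emeasure_space_1)
next
  case (Suc r)
  have "(\<integral>\<^sup>+\<omega>. ennreal (res_W2 (Env \<omega>) (Suc r)) \<partial>M) =
      (\<integral>\<^sup>+\<omega>. (\<Sum>u\<in>gen (Env \<omega>) r. ennreal (res (Env \<omega>) u * exp (- 2 * V (Env \<omega>) u)) *
        ennreal (mass2 (Env \<omega> u))) + ennreal (W (Env \<omega>) (Suc r)) \<partial>M)"
    unfolding res_W2_Suc
    by (intro nn_integral_cong, subst ennreal_plus)
      (auto intro!: sum_nonneg mult_nonneg_nonneg mass2_nonneg W_nonneg ennreal_sum_mult)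
  also have "\<dots> = (\<integral>\<^sup>+\<omega>. (\<Sum>u\<in>gen (Env \<omega>) r. ennreal (res (Env \<omega>) u * exp (- 2 * V (Env \<omega>) u)) *
        ennreal (mass2 (Env \<omega> u))) \<partial>M) + 1"
    by (subst nn_integral_add) (auto simp: mean_W)
  also have "(\<integral>\<^sup>+\<omega>. (\<Sum>u\<in>gen (Env \<omega>) r. ennreal (res (Env \<omega>) u * exp (- 2 * V (Env \<omega>) u)) *
        ennreal (mass2 (Env \<omega> u))) \<partial>M) =
      (\<integral>\<^sup>+\<omega>. (\<Sum>u\<in>gen (Env \<omega>) r. ennreal (res (Env \<omega>) u * exp (- 2 * V (Env \<omega>) u))) \<partial>M) *
      (\<integral>\<^sup>+\<omega>. ennreal (mass2 (Env \<omega> [])) \<partial>M)"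
    by (rule nn_integral_gen_step[where \<kappa> = "\<lambda>xs. ennreal (mass2 xs)"
          and \<alpha> = "\<lambda>x u. ennreal (res x u * exp (- 2 * V x u))"]) (auto simp: agree_below_V agree_below_res)
  also have "(\<integral>\<^sup>+\<omega>. (\<Sum>u\<in>gen (Env \<omega>) r. ennreal (res (Env \<omega>) u * exp (- 2 * V (Env \<omega>) u))) \<partial>M) =
      (\<integral>\<^sup>+\<omega>. ennreal (res_W2 (Env \<omega>) r) \<partial>M)"
    unfolding res_W2_def
    by (intro nn_integral_cong sum_ennreal mult_nonneg_nonneg) (auto intro: less_imp_le)
  also have "\<dots> * (\<integral>\<^sup>+\<omega>. ennreal (mass2 (Env \<omega> [])) \<partial>M) + 1 \<le> ennreal (1 / (1 - q)) * ennreal q + 1"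
    unfolding mean_mass2 by (intro add_right_mono mult_right_mono Suc) auto
  also have "\<dots> = ennreal (1 / (1 - q) * q + 1)"
  proof -
    have "0 \<le> 1 / (1 - q)" "0 \<le> q" using q by auto
    then show ?thesis
      by (simp only: ennreal_plus ennreal_mult ennreal_1 mult_nonneg_nonneg zero_le_one)
  qed
  also have "1 / (1 - q) * q + 1 = 1 / (1 - q)" using q by (simp add: field_simps)
  finally show ?case .
qed

lemma mean_mass_pair:
  assumes "u \<noteq> v"
  shows "(\<integral>\<^sup>+\<omega>. ennreal (mass (Env \<omega> u) * mass (Env \<omega> v)) \<partial>M) = 1"
proof -
  have mm: "(\<integral>\<^sup>+\<omega>. ennreal (mass (Env \<omega> w)) \<partial>M) = 1" for w
    using nn_integral_coordinate[of "\<lambda>xs. ennreal (mass xs)" w] by (simp add: mean_mass)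
  have "(\<integral>\<^sup>+\<omega>. ennreal (mass (Env \<omega> u) * mass (Env \<omega> v)) \<partial>M) =
      (\<integral>\<^sup>+\<omega>. (\<integral>\<^sup>+\<omega>'. ennreal (mass (Env \<omega> u) * mass (Env \<omega>' v)) \<partial>M) \<partial>M)"
    using nn_integral_indep_restrict[OF indep, of "{u}" "{v}" "\<lambda>x y. ennreal (mass (x u) * mass (y v))"] assms
    by (simp add: split_beta)
  also have "\<dots> = (\<integral>\<^sup>+\<omega>. ennreal (mass (Env \<omega> u)) \<partial>M)"
    by (intro nn_integral_cong) (simp add: ennreal_mult mass_nonneg nn_integral_cmult mm)
  finally show ?thesis by (simp add: mm)
qed

text \<open>
  From one generation to the next the mean increases by at most \<open>\<sigma> / (1 - q)\<close>, for pairs with a common parent,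
  plus \<open>1\<close>, for vertices paired with themselves.
\<close>

lemma mean_pair_energy:
  "(\<integral>\<^sup>+\<omega>. ennreal (pair_energy (Env \<omega>) r) \<partial>M) \<le> ennreal ((1 + \<sigma> / (1 - q)) * (real r + 1))"
proof (induction r)
  case 0
  have "pair_energy e 0 = 1" for e by (simp add: pair_energy_def res_common_self)
  then show ?case using q \<sigma> by (simp add: emeasure_space_1)
next
  case (Suc r)
  define a where "a x u v = res_common x u v * exp (- V x u) * exp (- V x v)" for x u v
  have a: "0 \<le> a x u v" for x u v
    unfolding a_def by (intro mult_nonneg_nonneg res_common_nonneg) auto
  define F where "F x y = (\<Sum>u\<in>gen x r. \<Sum>v\<in>gen x r. ennreal (a x u v) * ennreal (mass (y u) * mass (y v)))" for x y :: env
  have a_meas [measurable]: "(\<lambda>p. a (fst p) u v) \<in> borel_measurable (env_space \<Otimes>\<^sub>M env_space)" for u v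
    unfolding a_def by measurable
  have "(\<integral>\<^sup>+\<omega>. ennreal (pair_energy (Env \<omega>) (Suc r)) \<partial>M) =
      (\<integral>\<^sup>+\<omega>. F (Env \<omega>) (Env \<omega>) + ennreal (W (Env \<omega>) (Suc r)) \<partial>M)"
  proof (intro nn_integral_cong)
    fix \<omega>
    let ?e = "Env \<omega>"
    have "pair_energy ?e (Suc r) = (\<Sum>u\<in>gen ?e r. \<Sum>v\<in>gen ?e r. a ?e u v * (mass (?e u) * mass (?e v))) + W ?e (Suc r)"
      unfolding pair_energy_Suc a_def sum.cartesian_product[symmetric] ..
    moreover have "F ?e ?e = ennreal (\<Sum>u\<in>gen ?e r. \<Sum>v\<in>gen ?e r. a ?e u v * (mass (?e u) * mass (?e v)))"
      unfolding F_def
      by (simp add: ennreal_mult a mass_nonneg sum_nonneg flip: sum_ennreal)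
    ultimately show "ennreal (pair_energy ?e (Suc r)) = F ?e ?e + ennreal (W ?e (Suc r))"
      by (simp add: ennreal_plus W_nonneg a mass_nonneg sum_nonneg)
  qed
  also have "\<dots> = (\<integral>\<^sup>+\<omega>. F (Env \<omega>) (Env \<omega>) \<partial>M) + 1"
  proof (subst nn_integral_add)
    show "(\<lambda>\<omega>. F (Env \<omega>) (Env \<omega>)) \<in> borel_measurable M" unfolding F_def a_def by measurable
  qed (auto simp: mean_W)
  also have "(\<integral>\<^sup>+\<omega>. F (Env \<omega>) (Env \<omega>) \<partial>M) = (\<integral>\<^sup>+\<omega>. (\<integral>\<^sup>+\<omega>'. F (Env \<omega>) (Env \<omega>') \<partial>M) \<partial>M)"
  proof (rule nn_integral_past_future[where r = r])
    show "case_prod F \<in> borel_measurable (env_space \<Otimes>\<^sub>M env_space)"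
      unfolding split_beta F_def by measurable
    show "F x y = F x' y" if "agree_below r x x'" for x x' y
    proof -
      have "a x u v = a x' u v" if "u \<in> gen x' r" "v \<in> gen x' r" for u v
        using agree_below_V[OF \<open>agree_below r x x'\<close>] agree_below_res_common[OF \<open>agree_below r x x'\<close>]
        by (simp add: a_def genD(2)[OF that(1)] genD(2)[OF that(2)])
      then show ?thesis
        unfolding F_def agree_below_gen[OF that order_refl] by simp
    qed
    show "F x y = F x y'" if "agree_from r y y'" for x y y'
    proof -
      have "y u = y' u" if "u \<in> gen x r" for u
        using \<open>agree_from r y y'\<close> genD(2)[OF that] by (simp add: agree_from_def)
      then show ?thesis unfolding F_def by simp
    qed
  qed
  also have "\<dots> \<le> (\<integral>\<^sup>+\<omega>. ennreal (pair_energy (Env \<omega>) r) + ennreal \<sigma> * ennreal (res_W2 (Env \<omega>) r) \<partial>M)"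
  proof (intro nn_integral_mono)
    fix \<omega>
    let ?e = "Env \<omega>" and ?G = "gen (Env \<omega>) r"
    have sq: "(\<integral>\<^sup>+\<omega>. ennreal (mass (Env \<omega> u) * mass (Env \<omega> u)) \<partial>M) \<le> ennreal \<sigma>" for u
      using nn_integral_coordinate[of "\<lambda>xs. ennreal (mass xs * mass xs)" u] mean_mass_sq
      by (simp add: power2_eq_square)
    have cov: "(\<integral>\<^sup>+\<omega>. ennreal (mass (Env \<omega> u) * mass (Env \<omega> v)) \<partial>M) \<le> 1 + (if v = u then ennreal \<sigma> else 0)" for u v
      using sq[of u] mean_mass_pair[of u v] by (cases "v = u") (auto intro: add_increasing)
    have "(\<integral>\<^sup>+\<omega>'. F ?e (Env \<omega>') \<partial>M) =
        (\<Sum>u\<in>?G. \<Sum>v\<in>?G. ennreal (a ?e u v) * (\<integral>\<^sup>+\<omega>'. ennreal (mass (Env \<omega>' u) * mass (Env \<omega>' v)) \<partial>M))"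
      unfolding F_def by (simp add: nn_integral_sum nn_integral_cmult)
    also have "\<dots> \<le> (\<Sum>u\<in>?G. \<Sum>v\<in>?G. ennreal (a ?e u v) * (1 + (if v = u then ennreal \<sigma> else 0)))"
      by (intro sum_mono mult_left_mono cov) auto
    also have "\<dots> = (\<Sum>u\<in>?G. \<Sum>v\<in>?G. ennreal (a ?e u v)) + (\<Sum>u\<in>?G. \<Sum>v\<in>?G. if v = u then ennreal (a ?e u v) * ennreal \<sigma> else 0)"
      unfolding sum.distrib[symmetric] by (intro sum.cong refl) (simp add: distrib_left)
    also have "(\<Sum>u\<in>?G. \<Sum>v\<in>?G. if v = u then ennreal (a ?e u v) * ennreal \<sigma> else 0) =
        (\<Sum>u\<in>?G. ennreal (a ?e u u) * ennreal \<sigma>)"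
      by (intro sum.cong refl) (simp add: finite_gen)
    also have "\<dots> = ennreal \<sigma> * ennreal (res_W2 ?e r)"
    proof -
      have "a ?e u u = res ?e u * exp (- 2 * V ?e u)" for u
        by (simp add: a_def res_common_self mult.assoc flip: exp_add)
      then have "res_W2 ?e r = (\<Sum>u\<in>?G. a ?e u u)" by (simp add: res_W2_def)
      then have "ennreal (res_W2 ?e r) = (\<Sum>u\<in>?G. ennreal (a ?e u u))"
        using a by (simp add: sum_ennreal)
      then show ?thesis by (simp add: sum_distrib_left mult.commute)
    qed
    also have "(\<Sum>u\<in>?G. \<Sum>v\<in>?G. ennreal (a ?e u v)) = ennreal (pair_energy ?e r)"
      unfolding pair_energy_def sum.cartesian_product[symmetric] a_def[symmetric]
      by (simp add: a sum_nonneg flip: sum_ennreal)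
    finally show "(\<integral>\<^sup>+\<omega>'. F ?e (Env \<omega>') \<partial>M) \<le> ennreal (pair_energy ?e r) + ennreal \<sigma> * ennreal (res_W2 ?e r)" .
  qed
  also have "\<dots> = (\<integral>\<^sup>+\<omega>. ennreal (pair_energy (Env \<omega>) r) \<partial>M) + ennreal \<sigma> * (\<integral>\<^sup>+\<omega>. ennreal (res_W2 (Env \<omega>) r) \<partial>M)"
    by (subst nn_integral_add) (auto simp: nn_integral_cmult)
  also have "\<dots> \<le> ennreal ((1 + \<sigma> / (1 - q)) * (real r + 1)) + ennreal \<sigma> * ennreal (1 / (1 - q))"
    by (intro add_mono mult_left_mono Suc mean_res_W2) auto
  also have "\<dots> + 1 = ennreal ((1 + \<sigma> / (1 - q)) * (real r + 1) + \<sigma> * (1 / (1 - q)) + 1)"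
  proof -
    have "0 \<le> (1 + \<sigma> / (1 - q)) * (real r + 1)" "0 \<le> 1 / (1 - q)" using q \<sigma> by auto
    then show ?thesis
      using \<sigma> by (simp only: ennreal_plus ennreal_mult ennreal_1 mult_nonneg_nonneg add_nonneg_nonneg zero_le_one)
  qed
  also have "(1 + \<sigma> / (1 - q)) * (real r + 1) + \<sigma> * (1 / (1 - q)) + 1 = (1 + \<sigma> / (1 - q)) * (real (Suc r) + 1)"
  proof -
    have "(1 + c) * (real r + 1) + c + 1 = (1 + c) * (real (Suc r) + 1)" for c :: real
      by (simp add: algebra_simps)
    from this[of "\<sigma> / (1 - q)"] show ?thesis by (simp only: times_divide_eq_right mult_1_right)
  qed
  finally show ?case by (simp only: add_right_mono)
qed

end

section \<open>Additive functionals of the resistances\<close>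

text \<open>
  Along a line of descent this is a Markov chain, \<open>h\<close> becoming \<open>1 + exp (- a) * h\<close> at a child with mark
  \<open>a\<close>. Moreover \<open>1 / res\<close> equals \<open>exp (- V) / pot\<close>, so \<open>green\<close> is an additive functional of the chain.
\<close>

definition pot :: "env \<Rightarrow> vertex \<Rightarrow> real" where
  "pot e u = res e u * exp (- V e u)"

definition offspring_sum :: "(real \<Rightarrow> real) \<Rightarrow> real \<Rightarrow> real list \<Rightarrow> real" where
  "offspring_sum g h xs = (\<Sum>i<length xs. exp (- (xs ! i)) * g (1 + exp (- (xs ! i)) * h))"

definition additive :: "env \<Rightarrow> nat \<Rightarrow> (real \<Rightarrow> real) \<Rightarrow> real" where
  "additive e r g = (\<Sum>u\<in>gen e r. exp (- V e u) * g (pot e u))"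

lemma pot_snoc: "pot e (u @ [i]) = 1 + exp (- (e u ! i)) * pot e u"
proof -
  have "pot e (u @ [i]) = res e u * exp (- V e (u @ [i])) + exp (V e (u @ [i])) * exp (- V e (u @ [i]))"
    by (simp add: pot_def res_snoc distrib_right)
  also have "exp (V e (u @ [i])) * exp (- V e (u @ [i])) = 1" by (simp flip: exp_add)
  also have "exp (- V e (u @ [i])) = exp (- V e u) * exp (- (e u ! i))" by (simp add: V_snoc flip: exp_add)
  finally show ?thesis by (simp add: pot_def mult_ac)
qed

lemma pot_ge_1: "1 \<le> pot e u"
proof -
  have "exp (V e u) * exp (- V e u) \<le> pot e u"
    unfolding pot_def by (intro mult_right_mono exp_V_le_res) auto
  then show ?thesis by (simp flip: exp_add)
qed

lemma additive_Suc: "additive e (Suc r) g = (\<Sum>u\<in>gen e r. exp (- V e u) * offspring_sum g (pot e u) (e u))"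
  unfolding additive_def sum_gen_Suc sum_children offspring_sum_def sum_distrib_left
  by (intro sum.cong refl) (simp add: pot_snoc V_snoc mult.assoc[symmetric] flip: exp_add)

lemma W_eq_additive: "W e r = additive e r (\<lambda>_. 1)"
  by (simp add: W_def additive_def)

lemma green_eq_additive: "green e r = additive e r (\<lambda>h. 1 / max 1 h)"
proof -
  have "1 / res e z = exp (- V e z) * (1 / max 1 (pot e z))" for z
    using pot_ge_1[of e z] by (simp add: pot_def max_absorb2)
  then show ?thesis by (simp add: green_def additive_def)
qed

definition unit_functions :: "(real \<Rightarrow> real) set" where
  "unit_functions = {g \<in> borel_measurable borel. \<forall>h. 0 \<le> g h \<and> g h \<le> 1}"

lemma unit_functionsD:
  assumes "g \<in> unit_functions"
  shows "g \<in> borel_measurable borel" "0 \<le> g h" "g h \<le> 1"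
  using assms by (auto simp: unit_functions_def)

lemma offspring_sum_bounds:
  assumes "g \<in> unit_functions"
  shows "0 \<le> offspring_sum g h xs" "offspring_sum g h xs \<le> mass xs"
  unfolding offspring_sum_def mass_def using unit_functionsD[OF assms]
  by (auto intro!: sum_nonneg sum_mono mult_left_le)

lemma measurable_offspring_sum [measurable (raw)]:
  assumes [measurable]: "f \<in> N \<rightarrow>\<^sub>M real_seqs" "h \<in> borel_measurable N" "g \<in> borel_measurable borel"
  shows "(\<lambda>w. offspring_sum g (h w) (f w)) \<in> borel_measurable N"
  unfolding offspring_sum_def by measurable

lemma measurable_pot [measurable (raw)]:
  assumes [measurable]: "f \<in> N \<rightarrow>\<^sub>M env_space"
  shows "(\<lambda>w. pot (f w) u) \<in> borel_measurable N"
  unfolding pot_def by measurable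

lemma measurable_additive [measurable (raw)]:
  assumes [measurable]: "f \<in> N \<rightarrow>\<^sub>M env_space" "g \<in> borel_measurable borel"
  shows "(\<lambda>w. additive (f w) r g) \<in> borel_measurable N"
  unfolding additive_def by measurable

context branching_walk
begin

text \<open>
  The mean one-generation transition: \<open>additive e r (T g)\<close> is the conditional expectation of
  \<open>additive e (Suc r) g\<close> given the generations up to \<open>r\<close>.
\<close>

definition T :: "(real \<Rightarrow> real) \<Rightarrow> real \<Rightarrow> real" where
  "T g h = (\<integral>\<omega>. offspring_sum g h (Env \<omega> []) \<partial>M)"

lemma integrable_mass: "integrable M (\<lambda>\<omega>. mass (Env \<omega> u))"
proof (rule integrableI_nonneg)
  show "(\<integral>\<^sup>+\<omega>. ennreal (mass (Env \<omega> u)) \<partial>M) < \<infinity>"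
    using nn_integral_coordinate[of "\<lambda>xs. ennreal (mass xs)" u] by (simp add: mean_mass)
qed (auto simp: mass_nonneg)

lemma integral_mass: "(\<integral>\<omega>. mass (Env \<omega> u) \<partial>M) = 1"
proof -
  have "ennreal (\<integral>\<omega>. mass (Env \<omega> u) \<partial>M) = (\<integral>\<^sup>+\<omega>. ennreal (mass (Env \<omega> u)) \<partial>M)"
    by (rule nn_integral_eq_integral[symmetric]) (auto simp: integrable_mass mass_nonneg)
  also have "\<dots> = ennreal 1"
    using nn_integral_coordinate[of "\<lambda>xs. ennreal (mass xs)" u] by (simp add: mean_mass)
  finally show ?thesis by (simp add: integral_nonneg_AE mass_nonneg)
qed

lemma integrable_mass_sq: "integrable M (\<lambda>\<omega>. (mass (Env \<omega> u))\<^sup>2)"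
proof (rule integrableI_nonneg)
  have "(\<integral>\<^sup>+\<omega>. ennreal ((mass (Env \<omega> u))\<^sup>2) \<partial>M) \<le> ennreal \<sigma>"
    using nn_integral_coordinate[of "\<lambda>xs. ennreal ((mass xs)\<^sup>2)" u] mean_mass_sq by simp
  then show "(\<integral>\<^sup>+\<omega>. ennreal ((mass (Env \<omega> u))\<^sup>2) \<partial>M) < \<infinity>"
    by (rule order.strict_trans1) simp
qed auto

lemma integral_mass_sq: "(\<integral>\<omega>. (mass (Env \<omega> u))\<^sup>2 \<partial>M) \<le> \<sigma>"
proof -
  have "ennreal (\<integral>\<omega>. (mass (Env \<omega> u))\<^sup>2 \<partial>M) = (\<integral>\<^sup>+\<omega>. ennreal ((mass (Env \<omega> u))\<^sup>2) \<partial>M)"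
    by (rule nn_integral_eq_integral[symmetric]) (auto simp: integrable_mass_sq)
  also have "\<dots> \<le> ennreal \<sigma>"
    using nn_integral_coordinate[of "\<lambda>xs. ennreal ((mass xs)\<^sup>2)" u] mean_mass_sq by simp
  finally show ?thesis using \<sigma> by (simp add: ennreal_le_iff)
qed

lemma integral_coordinate:
  fixes \<phi> :: "real list \<Rightarrow> real"
  assumes [measurable]: "\<phi> \<in> borel_measurable real_seqs"
  shows "(\<integral>\<omega>. \<phi> (Env \<omega> u) \<partial>M) = (\<integral>\<omega>. \<phi> (Env \<omega> []) \<partial>M)"
proof -
  have "(\<integral>\<omega>. \<phi> (Env \<omega> v) \<partial>M) = (\<integral>xs. \<phi> xs \<partial>distr M real_seqs (\<lambda>\<omega>. Env \<omega> v))" for v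
    by (rule integral_distr[symmetric]) auto
  then show ?thesis by (simp add: ident[of u])
qed

text \<open>
  Contributions of distinct vertices are independent, so only the diagonal terms remain.
\<close>

lemma variance_of_branching_sum:
  assumes \<phi> [measurable]: "\<And>u. \<phi> u \<in> borel_measurable real_seqs"
    and bounds: "\<And>u xs. 0 \<le> \<phi> u xs" "\<And>u xs. \<phi> u xs \<le> mass xs"
    and G: "finite G"
  shows "(\<integral>\<^sup>+\<omega>. ennreal ((\<Sum>u\<in>G. a u * (\<phi> u (Env \<omega> u) - (\<integral>\<omega>. \<phi> u (Env \<omega> []) \<partial>M)))\<^sup>2) \<partial>M) \<le>
    ennreal (\<sigma> * (\<Sum>u\<in>G. (a u)\<^sup>2))"
proof -
  define m where "m u = (\<integral>\<omega>. \<phi> u (Env \<omega> []) \<partial>M)" for u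
  define \<xi> where "\<xi> u \<omega> = \<phi> u (Env \<omega> u) - m u" for u \<omega>
  have \<phi>_int: "integrable M (\<lambda>\<omega>. \<phi> u (Env \<omega> u))" for u
    by (rule Bochner_Integration.integrable_bound[OF integrable_mass[of u]]) (auto simp: bounds mass_nonneg)
  have m: "(\<integral>\<omega>. \<phi> u (Env \<omega> u) \<partial>M) = m u" for u
    unfolding m_def by (rule integral_coordinate) simp
  have \<xi>_int: "integrable M (\<xi> u)" and \<xi>_mean: "(\<integral>\<omega>. \<xi> u \<omega> \<partial>M) = 0" for u
    unfolding \<xi>_def using \<phi>_int m by (auto simp: prob_space)
  have \<phi>2_int: "integrable M (\<lambda>\<omega>. (\<phi> u (Env \<omega> u))\<^sup>2)" for u
    by (rule Bochner_Integration.integrable_bound[OF integrable_mass_sq[of u]])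
      (auto simp: bounds intro!: power_mono)
  have \<xi>2_eq: "(\<xi> u \<omega>)\<^sup>2 = (\<phi> u (Env \<omega> u))\<^sup>2 - 2 * m u * \<phi> u (Env \<omega> u) + (m u)\<^sup>2" for u \<omega>
    by (simp add: \<xi>_def power2_diff)
  have \<xi>2_int: "integrable M (\<lambda>\<omega>. (\<xi> u \<omega>)\<^sup>2)" for u
    unfolding \<xi>2_eq using \<phi>2_int \<phi>_int by simp
  have \<xi>2_le: "(\<integral>\<omega>. (\<xi> u \<omega>)\<^sup>2 \<partial>M) \<le> \<sigma>" for u
  proof -
    have "(\<integral>\<omega>. (\<xi> u \<omega>)\<^sup>2 \<partial>M) = (\<integral>\<omega>. (\<phi> u (Env \<omega> u))\<^sup>2 \<partial>M) - 2 * m u * m u + (m u)\<^sup>2"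
      unfolding \<xi>2_eq using \<phi>2_int[of u] \<phi>_int[of u] m[of u] by (simp add: prob_space)
    also have "\<dots> \<le> (\<integral>\<omega>. (\<phi> u (Env \<omega> u))\<^sup>2 \<partial>M)" by (simp add: power2_eq_square)
    also have "\<dots> \<le> (\<integral>\<omega>. (mass (Env \<omega> u))\<^sup>2 \<partial>M)"
      by (intro integral_mono \<phi>2_int integrable_mass_sq power_mono bounds)
    also note integral_mass_sq
    finally show ?thesis .
  qed
  have prod_int: "integrable M (\<lambda>\<omega>. \<xi> u \<omega> * \<xi> v \<omega>)" for u v
  proof (rule Bochner_Integration.integrable_bound)
    show "integrable M (\<lambda>\<omega>. (\<xi> u \<omega>)\<^sup>2 + (\<xi> v \<omega>)\<^sup>2)" using \<xi>2_int by simp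
    show "(\<lambda>\<omega>. \<xi> u \<omega> * \<xi> v \<omega>) \<in> borel_measurable M" unfolding \<xi>_def by measurable
    show "AE \<omega> in M. norm (\<xi> u \<omega> * \<xi> v \<omega>) \<le> norm ((\<xi> u \<omega>)\<^sup>2 + (\<xi> v \<omega>)\<^sup>2)"
    proof (intro AE_I2)
      fix \<omega>
      have "0 \<le> (\<bar>\<xi> u \<omega>\<bar> - \<bar>\<xi> v \<omega>\<bar>)\<^sup>2" by simp
      then have "2 * (\<bar>\<xi> u \<omega>\<bar> * \<bar>\<xi> v \<omega>\<bar>) \<le> (\<xi> u \<omega>)\<^sup>2 + (\<xi> v \<omega>)\<^sup>2" by (simp add: power2_diff)
      moreover have "0 \<le> \<bar>\<xi> u \<omega>\<bar> * \<bar>\<xi> v \<omega>\<bar>" by simp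
      ultimately have "\<bar>\<xi> u \<omega>\<bar> * \<bar>\<xi> v \<omega>\<bar> \<le> (\<xi> u \<omega>)\<^sup>2 + (\<xi> v \<omega>)\<^sup>2" by linarith
      then show "norm (\<xi> u \<omega> * \<xi> v \<omega>) \<le> norm ((\<xi> u \<omega>)\<^sup>2 + (\<xi> v \<omega>)\<^sup>2)"
        by (simp add: abs_mult)
    qed
  qed
  have cov: "(\<integral>\<omega>. \<xi> u \<omega> * \<xi> v \<omega> \<partial>M) = 0" if "u \<noteq> v" for u v
  proof -
    have "indep_var borel ((\<lambda>x. \<phi> u (x u) - m u) \<circ> (\<lambda>\<omega>. restrict (Env \<omega>) {u}))
        borel ((\<lambda>x. \<phi> v (x v) - m v) \<circ> (\<lambda>\<omega>. restrict (Env \<omega>) {v}))"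
      using that by (intro indep_var_compose[OF indep_var_restrict[OF indep]]) auto
    then have "indep_var borel (\<xi> u) borel (\<xi> v)" by (simp add: \<xi>_def[abs_def] comp_def)
    then show ?thesis
      using \<xi>_int[of u] \<xi>_int[of v] \<xi>_mean[of u] by (simp add: indep_var_lebesgue_integral)
  qed
  have sq: "(\<Sum>u\<in>G. a u * \<xi> u \<omega>)\<^sup>2 = (\<Sum>u\<in>G. \<Sum>v\<in>G. a u * a v * (\<xi> u \<omega> * \<xi> v \<omega>))" for \<omega>
    by (simp add: power2_eq_square sum_product mult_ac)
  have int: "integrable M (\<lambda>\<omega>. (\<Sum>u\<in>G. a u * \<xi> u \<omega>)\<^sup>2)"
    unfolding sq using prod_int by (intro Bochner_Integration.integrable_sum integrable_mult_right)
  have "(\<integral>\<omega>. (\<Sum>u\<in>G. a u * \<xi> u \<omega>)\<^sup>2 \<partial>M) = (\<Sum>u\<in>G. \<Sum>v\<in>G. a u * a v * (\<integral>\<omega>. \<xi> u \<omega> * \<xi> v \<omega> \<partial>M))"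
    unfolding sq using prod_int by (simp add: Bochner_Integration.integral_sum)
  also have "\<dots> = (\<Sum>u\<in>G. \<Sum>v\<in>G. if v = u then (a u)\<^sup>2 * (\<integral>\<omega>. (\<xi> u \<omega>)\<^sup>2 \<partial>M) else 0)"
    using cov by (intro sum.cong refl) (auto simp: power2_eq_square)
  also have "\<dots> = (\<Sum>u\<in>G. (a u)\<^sup>2 * (\<integral>\<omega>. (\<xi> u \<omega>)\<^sup>2 \<partial>M))"
    using G by (intro sum.cong refl) simp
  also have "\<dots> \<le> (\<Sum>u\<in>G. (a u)\<^sup>2 * \<sigma>)"
    by (intro sum_mono mult_left_mono \<xi>2_le) auto
  also have "\<dots> = \<sigma> * (\<Sum>u\<in>G. (a u)\<^sup>2)" by (simp add: sum_distrib_left mult.commute)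
  finally have "(\<integral>\<omega>. (\<Sum>u\<in>G. a u * \<xi> u \<omega>)\<^sup>2 \<partial>M) \<le> \<sigma> * (\<Sum>u\<in>G. (a u)\<^sup>2)" .
  then show ?thesis
    using nn_integral_eq_integral[OF int] unfolding \<xi>_def m_def by (simp add: ennreal_leI)
qed

lemma integrable_offspring_sum:
  assumes "g \<in> unit_functions"
  shows "integrable M (\<lambda>\<omega>. offspring_sum g h (Env \<omega> u))"
proof -
  note [measurable] = unit_functionsD(1)[OF assms]
  show ?thesis
    by (rule Bochner_Integration.integrable_bound[OF integrable_mass[of u]])
      (auto simp: offspring_sum_bounds[OF assms] mass_nonneg)
qed

lemma T_unit_functions:
  assumes "g \<in> unit_functions"
  shows "T g \<in> unit_functions"
proof -
  note [measurable] = unit_functionsD(1)[OF assms]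
  have "0 \<le> T g h" "T g h \<le> 1" for h
  proof -
    show "0 \<le> T g h"
      unfolding T_def by (intro integral_nonneg_AE AE_I2 offspring_sum_bounds assms)
    have "T g h \<le> (\<integral>\<omega>. mass (Env \<omega> []) \<partial>M)"
      unfolding T_def by (intro integral_mono integrable_offspring_sum integrable_mass offspring_sum_bounds assms)
    then show "T g h \<le> 1" by (simp add: integral_mass)
  qed
  moreover have "T g \<in> borel_measurable borel"
    unfolding T_def by measurable
  ultimately show ?thesis by (simp add: unit_functions_def)
qed

lemma funpow_T_unit_functions: "g \<in> unit_functions \<Longrightarrow> (T ^^ n) g \<in> unit_functions"
  by (induction n) (auto intro: T_unit_functions)

lemma T_const_1: "T (\<lambda>_. 1) = (\<lambda>_. 1)"
  using integral_mass[of "[]"] by (simp add: T_def[abs_def] offspring_sum_def[abs_def] mass_def[abs_def])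

definition C\<^sub>0 :: real where "C\<^sub>0 = (1 + \<sigma>) / 2"

lemma C\<^sub>0_nonneg: "0 \<le> C\<^sub>0" using \<sigma> by (simp add: C\<^sub>0_def)

text \<open>
  Given the past, the difference is a centred sum of independent terms with weights \<open>exp (- V)\<close>; its second
  moment is at most \<open>\<sigma>\<close> times the mean of \<open>W2\<close>, which is \<open>q ^ r\<close>.
\<close>

lemma additive_step:
  assumes g: "g \<in> unit_functions"
  shows "(\<integral>\<^sup>+\<omega>. ennreal \<bar>additive (Env \<omega>) (Suc r) g - additive (Env \<omega>) r (T g)\<bar> \<partial>M) \<le>
    ennreal (C\<^sub>0 * sqrt q ^ r)"
proof -
  note [measurable] = unit_functionsD(1)[OF g] unit_functionsD(1)[OF T_unit_functions[OF g]]
  define D where "D x y = (\<Sum>u\<in>gen x r. exp (- V x u) * (offspring_sum g (pot x u) (y u) - T g (pot x u)))" for x y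
  have D_meas [measurable]: "(\<lambda>p. D (fst p) (snd p)) \<in> borel_measurable (env_space \<Otimes>\<^sub>M env_space)"
    unfolding D_def by measurable
  have D_Env [measurable]: "(\<lambda>\<omega>. D (Env \<omega>) (Env \<omega>)) \<in> borel_measurable M"
    unfolding D_def by measurable
  have "(\<integral>\<^sup>+\<omega>. ennreal ((D (Env \<omega>) (Env \<omega>))\<^sup>2) \<partial>M) =
      (\<integral>\<^sup>+\<omega>. (\<integral>\<^sup>+\<omega>'. ennreal ((D (Env \<omega>) (Env \<omega>'))\<^sup>2) \<partial>M) \<partial>M)"
  proof (rule nn_integral_past_future[where r = r and F = "\<lambda>x y. ennreal ((D x y)\<^sup>2)"])
    show "(\<lambda>(x, y). ennreal ((D x y)\<^sup>2)) \<in> borel_measurable (env_space \<Otimes>\<^sub>M env_space)"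
      unfolding split_beta by measurable
    show "ennreal ((D x y)\<^sup>2) = ennreal ((D x' y)\<^sup>2)" if "agree_below r x x'" for x x' y
    proof -
      have "V x u = V x' u" "pot x u = pot x' u" if "u \<in> gen x' r" for u
        using agree_below_V[OF \<open>agree_below r x x'\<close>] agree_below_res[OF \<open>agree_below r x x'\<close>]
        by (simp_all add: pot_def genD(2)[OF that])
      then show ?thesis unfolding D_def agree_below_gen[OF that order_refl] by simp
    qed
    show "ennreal ((D x y)\<^sup>2) = ennreal ((D x y')\<^sup>2)" if "agree_from r y y'" for x y y'
    proof -
      have "y u = y' u" if "u \<in> gen x r" for u
        using \<open>agree_from r y y'\<close> genD(2)[OF that] by (simp add: agree_from_def)
      then show ?thesis unfolding D_def by simp
    qed
  qed
  also have "\<dots> \<le> (\<integral>\<^sup>+\<omega>. ennreal \<sigma> * ennreal (W2 (Env \<omega>) r) \<partial>M)"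
  proof (intro nn_integral_mono)
    fix \<omega>
    have "(\<integral>\<^sup>+\<omega>'. ennreal ((D (Env \<omega>) (Env \<omega>'))\<^sup>2) \<partial>M) \<le>
        ennreal (\<sigma> * (\<Sum>u\<in>gen (Env \<omega>) r. (exp (- V (Env \<omega>) u))\<^sup>2))"
      unfolding D_def T_def
      by (rule variance_of_branching_sum[where \<phi> = "\<lambda>u. offspring_sum g (pot (Env \<omega>) u)"])
        (auto simp: finite_gen offspring_sum_bounds[OF g])
    also have "(\<Sum>u\<in>gen (Env \<omega>) r. (exp (- V (Env \<omega>) u))\<^sup>2) = W2 (Env \<omega>) r"
      unfolding W2_def by (simp add: power2_eq_square flip: exp_add)
    finally show "(\<integral>\<^sup>+\<omega>'. ennreal ((D (Env \<omega>) (Env \<omega>'))\<^sup>2) \<partial>M) \<le> ennreal \<sigma> * ennreal (W2 (Env \<omega>) r)"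
      using \<sigma> by (simp add: ennreal_mult W2_nonneg)
  qed
  also have "\<dots> = ennreal (\<sigma> * q ^ r)"
    using q \<sigma> by (simp add: nn_integral_cmult mean_W2 ennreal_mult)
  finally have D2: "(\<integral>\<^sup>+\<omega>. ennreal ((D (Env \<omega>) (Env \<omega>))\<^sup>2) \<partial>M) \<le> ennreal (\<sigma> * q ^ r)" .
  \<comment> \<open>A deterministic size for the difference, at which \<open>\<bar>d\<bar> \<le> (t + d\<^sup>2 / t) / 2\<close> is sharp up to a constant.\<close>
  define t where "t = sqrt q ^ r"
  have t: "0 < t" "t * t = q ^ r"
    using q by (auto simp: t_def simp flip: power_mult_distrib)
  have "(\<integral>\<^sup>+\<omega>. ennreal \<bar>additive (Env \<omega>) (Suc r) g - additive (Env \<omega>) r (T g)\<bar> \<partial>M) =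
      (\<integral>\<^sup>+\<omega>. ennreal \<bar>D (Env \<omega>) (Env \<omega>)\<bar> \<partial>M)"
    unfolding additive_Suc additive_def[of _ r] D_def by (simp add: right_diff_distrib sum_subtractf)
  also have "\<dots> \<le> (\<integral>\<^sup>+\<omega>. ennreal (t / 2) + ennreal (1 / (2 * t)) * ennreal ((D (Env \<omega>) (Env \<omega>))\<^sup>2) \<partial>M)"
  proof (intro nn_integral_mono)
    fix \<omega>
    let ?d = "D (Env \<omega>) (Env \<omega>)"
    have "0 \<le> (\<bar>?d\<bar> - t)\<^sup>2" by simp
    then have "2 * t * \<bar>?d\<bar> \<le> t * t + ?d\<^sup>2" by (simp add: power2_diff power2_eq_square[of t] mult_ac)
    then have "\<bar>?d\<bar> \<le> t / 2 + 1 / (2 * t) * ?d\<^sup>2" using t(1) by (simp add: field_simps)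
    then show "ennreal \<bar>?d\<bar> \<le> ennreal (t / 2) + ennreal (1 / (2 * t)) * ennreal (?d\<^sup>2)"
      using t(1) by (simp add: ennreal_leI flip: ennreal_mult ennreal_plus)
  qed
  also have "\<dots> = ennreal (t / 2) + ennreal (1 / (2 * t)) * (\<integral>\<^sup>+\<omega>. ennreal ((D (Env \<omega>) (Env \<omega>))\<^sup>2) \<partial>M)"
    by (subst nn_integral_add) (auto simp: nn_integral_cmult emeasure_space_1)
  also have "\<dots> \<le> ennreal (t / 2) + ennreal (1 / (2 * t)) * ennreal (\<sigma> * q ^ r)"
    by (intro add_left_mono mult_left_mono D2) auto
  also have "\<dots> = ennreal (t / 2 + 1 / (2 * t) * (\<sigma> * q ^ r))"
    using t(1) \<sigma> q by (simp flip: ennreal_mult ennreal_plus)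
  also have "t / 2 + 1 / (2 * t) * (\<sigma> * q ^ r) = C\<^sub>0 * t"
    unfolding t(2)[symmetric] C\<^sub>0_def using t(1) by (simp add: field_simps)
  finally show ?thesis by (simp add: t_def)
qed

lemma sqrt_q: "0 < sqrt q" "sqrt q < 1"
  using q by auto

lemma additive_steps:
  assumes g: "g \<in> unit_functions"
  shows "(\<integral>\<^sup>+\<omega>. ennreal \<bar>additive (Env \<omega>) (i + n) g - additive (Env \<omega>) i ((T ^^ n) g)\<bar> \<partial>M) \<le>
    ennreal (C\<^sub>0 * sqrt q ^ i / (1 - sqrt q))"
proof -
  have "(\<integral>\<^sup>+\<omega>. ennreal \<bar>additive (Env \<omega>) (i + n) g - additive (Env \<omega>) i ((T ^^ n) g)\<bar> \<partial>M) \<le>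
      ennreal (C\<^sub>0 * sqrt q ^ i * (\<Sum>j<n. sqrt q ^ j))"
    using g
  proof (induction n arbitrary: g)
    case (Suc n)
    note [measurable] = unit_functionsD(1)[OF Suc.prems] unit_functionsD(1)[OF T_unit_functions[OF Suc.prems]]
      unit_functionsD(1)[OF funpow_T_unit_functions[OF T_unit_functions[OF Suc.prems]]]
    have "(\<integral>\<^sup>+\<omega>. ennreal \<bar>additive (Env \<omega>) (i + Suc n) g - additive (Env \<omega>) i ((T ^^ Suc n) g)\<bar> \<partial>M) \<le>
        (\<integral>\<^sup>+\<omega>. ennreal \<bar>additive (Env \<omega>) (Suc (i + n)) g - additive (Env \<omega>) (i + n) (T g)\<bar> +
          ennreal \<bar>additive (Env \<omega>) (i + n) (T g) - additive (Env \<omega>) i ((T ^^ n) (T g))\<bar> \<partial>M)"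
      by (intro nn_integral_mono) (auto simp: funpow_swap1 ennreal_leI simp flip: ennreal_plus)
    also have "\<dots> = (\<integral>\<^sup>+\<omega>. ennreal \<bar>additive (Env \<omega>) (Suc (i + n)) g - additive (Env \<omega>) (i + n) (T g)\<bar> \<partial>M) +
          (\<integral>\<^sup>+\<omega>. ennreal \<bar>additive (Env \<omega>) (i + n) (T g) - additive (Env \<omega>) i ((T ^^ n) (T g))\<bar> \<partial>M)"
      by (rule nn_integral_add) auto
    also have "\<dots> \<le> ennreal (C\<^sub>0 * sqrt q ^ (i + n)) + ennreal (C\<^sub>0 * sqrt q ^ i * (\<Sum>j<n. sqrt q ^ j))"
      by (intro add_mono additive_step Suc T_unit_functions)
    also have "\<dots> = ennreal (C\<^sub>0 * sqrt q ^ (i + n) + C\<^sub>0 * sqrt q ^ i * (\<Sum>j<n. sqrt q ^ j))"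
      using C\<^sub>0_nonneg q by (intro ennreal_plus[symmetric] mult_nonneg_nonneg sum_nonneg) auto
    also have "C\<^sub>0 * sqrt q ^ (i + n) + C\<^sub>0 * sqrt q ^ i * (\<Sum>j<n. sqrt q ^ j) = C\<^sub>0 * sqrt q ^ i * (\<Sum>j<Suc n. sqrt q ^ j)"
      by (simp add: power_add algebra_simps)
    finally show ?case .
  qed simp
  also have "\<dots> \<le> ennreal (C\<^sub>0 * sqrt q ^ i / (1 - sqrt q))"
  proof (rule ennreal_leI)
    have "(\<Sum>j<n. sqrt q ^ j) = (1 - sqrt q ^ n) / (1 - sqrt q)"
      using sqrt_q by (subst sum_gp_strict) auto
    also have "\<dots> \<le> 1 / (1 - sqrt q)"
      using sqrt_q q by (intro divide_right_mono) auto
    finally have "C\<^sub>0 * sqrt q ^ i * (\<Sum>j<n. sqrt q ^ j) \<le> C\<^sub>0 * sqrt q ^ i * (1 / (1 - sqrt q))"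
      using C\<^sub>0_nonneg q by (intro mult_left_mono) auto
    then show "C\<^sub>0 * sqrt q ^ i * (\<Sum>j<n. sqrt q ^ j) \<le> C\<^sub>0 * sqrt q ^ i / (1 - sqrt q)" by simp
  qed
  finally show ?thesis .
qed

lemma const_1_unit: "(\<lambda>_. 1) \<in> unit_functions"
  by (simp add: unit_functions_def)

lemma funpow_T_const_1: "(T ^^ n) (\<lambda>_. 1) = (\<lambda>_. 1)"
  by (induction n) (auto simp: T_const_1)

lemma W_diff: "(\<integral>\<^sup>+\<omega>. ennreal \<bar>W (Env \<omega>) (i + n) - W (Env \<omega>) i\<bar> \<partial>M) \<le> ennreal (C\<^sub>0 * sqrt q ^ i / (1 - sqrt q))"
  using additive_steps[OF const_1_unit, of i n] by (simp add: W_eq_additive funpow_T_const_1)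

text \<open>
  The increments of \<open>W\<close> are the case \<open>g = 1\<close> of \<open>additive_step\<close>, hence summable in mean.
\<close>

lemma AE_W_tendsto: "AE \<omega> in M. (\<lambda>n. W (Env \<omega>) n) \<longlonglongrightarrow> W_inf (Env \<omega>)"
proof -
  have "(\<integral>\<^sup>+\<omega>. (\<Sum>n. ennreal \<bar>W (Env \<omega>) (Suc n) - W (Env \<omega>) n\<bar>) \<partial>M) =
      (\<Sum>n. \<integral>\<^sup>+\<omega>. ennreal \<bar>W (Env \<omega>) (Suc n) - W (Env \<omega>) n\<bar> \<partial>M)"
    by (rule nn_integral_suminf) simp
  also have "\<dots> \<le> (\<Sum>n. ennreal (C\<^sub>0 / (1 - sqrt q) * sqrt q ^ n))"
    using W_diff[of _ 1] by (intro suminf_le) auto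
  also have "\<dots> = ennreal (\<Sum>n. C\<^sub>0 / (1 - sqrt q) * sqrt q ^ n)"
    using sqrt_q C\<^sub>0_nonneg q
    by (intro suminf_ennreal2 summable_mult summable_geometric mult_nonneg_nonneg) auto
  also have "\<dots> < \<infinity>" by simp
  finally have "AE \<omega> in M. (\<Sum>n. ennreal \<bar>W (Env \<omega>) (Suc n) - W (Env \<omega>) n\<bar>) \<noteq> \<infinity>"
    by (intro nn_integral_PInf_AE) auto
  then show ?thesis
  proof eventually_elim
    case (elim \<omega>)
    then have "summable (\<lambda>n. \<bar>W (Env \<omega>) (Suc n) - W (Env \<omega>) n\<bar>)"
      by (intro summable_suminf_not_top) auto
    then have "summable (\<lambda>n. W (Env \<omega>) (Suc n) - W (Env \<omega>) n)"
      by (rule summable_rabs_cancel)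
    then have "convergent (\<lambda>n. \<Sum>i<n. W (Env \<omega>) (Suc i) - W (Env \<omega>) i)"
      by (simp add: summable_iff_convergent)
    then have "convergent (\<lambda>n. W (Env \<omega>) n - W (Env \<omega>) 0)"
      by (simp add: sum_lessThan_telescope)
    then have "convergent (W (Env \<omega>))"
      using convergent_add_const_iff[of "- W (Env \<omega>) 0" "W (Env \<omega>)"] by simp
    then show ?case by (simp add: W_inf_def convergent_LIMSEQ_iff)
  qed
qed

lemma measurable_W_inf [measurable]: "(\<lambda>\<omega>. W_inf (Env \<omega>)) \<in> borel_measurable M"
  unfolding W_inf_def by (rule borel_measurable_lim_metric) simp

lemma AE_W_bounded: "AE \<omega> in M. \<exists>C. \<forall>n. W (Env \<omega>) n \<le> C"
  using AE_W_tendsto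
proof eventually_elim
  case (elim \<omega>)
  then have "Bseq (W (Env \<omega>))" by (intro convergent_imp_Bseq convergentI)
  then show ?case unfolding Bseq_def by (metis W_nonneg abs_of_nonneg real_norm_def)
qed

lemma W_inf_diff: "(\<integral>\<^sup>+\<omega>. ennreal \<bar>W_inf (Env \<omega>) - W (Env \<omega>) i\<bar> \<partial>M) \<le> ennreal (C\<^sub>0 * sqrt q ^ i / (1 - sqrt q))"
proof -
  have "(\<integral>\<^sup>+\<omega>. ennreal \<bar>W_inf (Env \<omega>) - W (Env \<omega>) i\<bar> \<partial>M) =
      (\<integral>\<^sup>+\<omega>. liminf (\<lambda>n. ennreal \<bar>W (Env \<omega>) (i + n) - W (Env \<omega>) i\<bar>) \<partial>M)"
  proof (rule nn_integral_cong_AE)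
    show "AE \<omega> in M. ennreal \<bar>W_inf (Env \<omega>) - W (Env \<omega>) i\<bar> =
        liminf (\<lambda>n. ennreal \<bar>W (Env \<omega>) (i + n) - W (Env \<omega>) i\<bar>)"
      using AE_W_tendsto
    proof eventually_elim
      case (elim \<omega>)
      have "(\<lambda>n. W (Env \<omega>) (i + n)) \<longlonglongrightarrow> W_inf (Env \<omega>)"
        using LIMSEQ_ignore_initial_segment[OF elim, of i] by (simp add: add.commute)
      then have "(\<lambda>n. ennreal \<bar>W (Env \<omega>) (i + n) - W (Env \<omega>) i\<bar>) \<longlonglongrightarrow> ennreal \<bar>W_inf (Env \<omega>) - W (Env \<omega>) i\<bar>"
        by (intro tendsto_ennrealI tendsto_intros)
      then show ?case by (intro lim_imp_Liminf[symmetric]) auto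
    qed
  qed
  also have "\<dots> \<le> liminf (\<lambda>n. \<integral>\<^sup>+\<omega>. ennreal \<bar>W (Env \<omega>) (i + n) - W (Env \<omega>) i\<bar> \<partial>M)"
    by (rule nn_integral_liminf) simp
  also have "\<dots> \<le> limsup (\<lambda>n. \<integral>\<^sup>+\<omega>. ennreal \<bar>W (Env \<omega>) (i + n) - W (Env \<omega>) i\<bar> \<partial>M)"
    by (rule Liminf_le_Limsup) simp
  also have "\<dots> \<le> ennreal (C\<^sub>0 * sqrt q ^ i / (1 - sqrt q))"
    by (intro Limsup_bounded always_eventually allI W_diff)
  finally show ?thesis .
qed

lemma mean_W_inf: "(\<integral>\<^sup>+\<omega>. ennreal \<bar>W_inf (Env \<omega>)\<bar> \<partial>M) < \<infinity>"
proof -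
  have "(\<integral>\<^sup>+\<omega>. ennreal \<bar>W_inf (Env \<omega>)\<bar> \<partial>M) \<le>
      (\<integral>\<^sup>+\<omega>. ennreal \<bar>W_inf (Env \<omega>) - W (Env \<omega>) 0\<bar> + ennreal (W (Env \<omega>) 0) \<partial>M)"
  proof (intro nn_integral_mono)
    fix \<omega>
    have "\<bar>W_inf (Env \<omega>)\<bar> \<le> \<bar>W_inf (Env \<omega>) - W (Env \<omega>) 0\<bar> + W (Env \<omega>) 0"
      using W_nonneg[of "Env \<omega>" 0] by linarith
    then show "ennreal \<bar>W_inf (Env \<omega>)\<bar> \<le> ennreal \<bar>W_inf (Env \<omega>) - W (Env \<omega>) 0\<bar> + ennreal (W (Env \<omega>) 0)"
      by (simp add: ennreal_leI W_nonneg flip: ennreal_plus)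
  qed
  also have "\<dots> = (\<integral>\<^sup>+\<omega>. ennreal \<bar>W_inf (Env \<omega>) - W (Env \<omega>) 0\<bar> \<partial>M) + 1"
    by (subst nn_integral_add) (auto simp: mean_W)
  also have "\<dots> \<le> ennreal (C\<^sub>0 * sqrt q ^ 0 / (1 - sqrt q)) + 1"
    by (intro add_right_mono W_inf_diff)
  also have "\<dots> < \<infinity>" by simp
  finally show ?thesis .
qed

text \<open>
  Compare \<open>green (i + n)\<close> with a sum over the fixed generation \<open>i\<close>. For \<open>n\<close> tending to infinity this finite
  sum converges to \<open>c * W i\<close>, and all errors are of order \<open>sqrt q ^ i\<close>, uniformly in \<open>n\<close>.
\<close>

lemma green_tendsto:
  assumes c: "\<And>h. 1 \<le> h \<Longrightarrow> (\<lambda>n. (T ^^ n) (\<lambda>h. 1 / max 1 h) h) \<longlonglongrightarrow> c" and "0 \<le> c" "c \<le> 1"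
  shows "(\<lambda>l. \<integral>\<^sup>+\<omega>. ennreal \<bar>green (Env \<omega>) l - c * W_inf (Env \<omega>)\<bar> \<partial>M) \<longlonglongrightarrow> 0"
proof -
  define g\<^sub>0 :: "real \<Rightarrow> real" where "g\<^sub>0 = (\<lambda>h. 1 / max 1 h)"
  have g\<^sub>0: "g\<^sub>0 \<in> unit_functions" by (auto simp: g\<^sub>0_def unit_functions_def)
  note T_meas [measurable] = unit_functionsD(1)[OF funpow_T_unit_functions[OF g\<^sub>0]]
  define K where "K = 2 * C\<^sub>0 / (1 - sqrt q)"
  have K: "0 \<le> K" using C\<^sub>0_nonneg sqrt_q by (simp add: K_def)
  have main: "limsup (\<lambda>l. \<integral>\<^sup>+\<omega>. ennreal \<bar>green (Env \<omega>) l - c * W_inf (Env \<omega>)\<bar> \<partial>M) \<le> ennreal (K * sqrt q ^ i)" for i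
  proof -
    define E where "E n = (\<integral>\<^sup>+\<omega>. ennreal \<bar>additive (Env \<omega>) i ((T ^^ n) g\<^sub>0) - c * W (Env \<omega>) i\<bar> \<partial>M)" for n
    have "E \<longlonglongrightarrow> (\<integral>\<^sup>+\<omega>. 0 \<partial>M)"
      unfolding E_def
    proof (rule nn_integral_dominated_convergence[where w = "\<lambda>\<omega>. ennreal (W (Env \<omega>) i)"])
      show "(\<integral>\<^sup>+\<omega>. ennreal (W (Env \<omega>) i) \<partial>M) < \<infinity>" by (simp add: mean_W)
      show "AE \<omega> in M. ennreal \<bar>additive (Env \<omega>) i ((T ^^ n) g\<^sub>0) - c * W (Env \<omega>) i\<bar> \<le> ennreal (W (Env \<omega>) i)" for n
      proof (intro AE_I2 ennreal_leI)
        fix \<omega>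
        let ?a = "additive (Env \<omega>) i ((T ^^ n) g\<^sub>0)" and ?w = "W (Env \<omega>) i"
        have "0 \<le> ?a" "?a \<le> ?w"
          unfolding additive_def W_def using unit_functionsD[OF funpow_T_unit_functions[OF g\<^sub>0, of n]]
          by (auto intro!: sum_nonneg sum_mono mult_left_le)
        moreover have "0 \<le> c * ?w" "c * ?w \<le> ?w"
          using \<open>0 \<le> c\<close> \<open>c \<le> 1\<close> W_nonneg by (auto intro: mult_left_le_one_le)
        ultimately show "\<bar>?a - c * ?w\<bar> \<le> ?w" by linarith
      qed
      show "AE \<omega> in M. (\<lambda>n. ennreal \<bar>additive (Env \<omega>) i ((T ^^ n) g\<^sub>0) - c * W (Env \<omega>) i\<bar>) \<longlonglongrightarrow> 0"
      proof (intro AE_I2)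
        fix \<omega>
        have "(\<lambda>n. additive (Env \<omega>) i ((T ^^ n) g\<^sub>0)) \<longlonglongrightarrow> (\<Sum>u\<in>gen (Env \<omega>) i. exp (- V (Env \<omega>) u) * c)"
          unfolding additive_def g\<^sub>0_def by (intro tendsto_intros c pot_ge_1)
        then have "(\<lambda>n. additive (Env \<omega>) i ((T ^^ n) g\<^sub>0)) \<longlonglongrightarrow> c * W (Env \<omega>) i"
          by (simp add: W_def sum_distrib_left mult.commute)
        then have "(\<lambda>n. ennreal \<bar>additive (Env \<omega>) i ((T ^^ n) g\<^sub>0) - c * W (Env \<omega>) i\<bar>) \<longlonglongrightarrow>
            ennreal \<bar>c * W (Env \<omega>) i - c * W (Env \<omega>) i\<bar>"
          by (intro tendsto_ennrealI tendsto_intros)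
        then show "(\<lambda>n. ennreal \<bar>additive (Env \<omega>) i ((T ^^ n) g\<^sub>0) - c * W (Env \<omega>) i\<bar>) \<longlonglongrightarrow> 0" by simp
      qed
    qed simp_all
    then have E: "E \<longlonglongrightarrow> 0" by simp
    have le: "(\<integral>\<^sup>+\<omega>. ennreal \<bar>green (Env \<omega>) (i + n) - c * W_inf (Env \<omega>)\<bar> \<partial>M) \<le> E n + ennreal (K * sqrt q ^ i)" for n
    proof -
      let ?b = "C\<^sub>0 * sqrt q ^ i / (1 - sqrt q)"
      have b: "0 \<le> ?b" using C\<^sub>0_nonneg sqrt_q q by auto
      have "(\<integral>\<^sup>+\<omega>. ennreal \<bar>green (Env \<omega>) (i + n) - c * W_inf (Env \<omega>)\<bar> \<partial>M) \<le>
          (\<integral>\<^sup>+\<omega>. ennreal \<bar>additive (Env \<omega>) i ((T ^^ n) g\<^sub>0) - c * W (Env \<omega>) i\<bar> +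
            (ennreal \<bar>additive (Env \<omega>) (i + n) g\<^sub>0 - additive (Env \<omega>) i ((T ^^ n) g\<^sub>0)\<bar> +
              ennreal \<bar>W_inf (Env \<omega>) - W (Env \<omega>) i\<bar>) \<partial>M)"
      proof (intro nn_integral_mono)
        fix \<omega>
        let ?G = "green (Env \<omega>) (i + n)" and ?a = "additive (Env \<omega>) i ((T ^^ n) g\<^sub>0)"
          and ?w = "W (Env \<omega>) i" and ?W = "W_inf (Env \<omega>)"
        have "\<bar>c * (?W - ?w)\<bar> \<le> \<bar>?W - ?w\<bar>"
          using \<open>0 \<le> c\<close> \<open>c \<le> 1\<close> by (simp add: abs_mult mult_left_le_one_le)
        moreover have "?G - c * ?W = (?a - c * ?w) + (?G - ?a) - c * (?W - ?w)"
          by (simp add: algebra_simps)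
        ultimately have "\<bar>?G - c * ?W\<bar> \<le> \<bar>?a - c * ?w\<bar> + (\<bar>?G - ?a\<bar> + \<bar>?W - ?w\<bar>)" by linarith
        then show "ennreal \<bar>?G - c * ?W\<bar> \<le> ennreal \<bar>?a - c * ?w\<bar> +
            (ennreal \<bar>additive (Env \<omega>) (i + n) g\<^sub>0 - ?a\<bar> + ennreal \<bar>?W - ?w\<bar>)"
          unfolding green_eq_additive g\<^sub>0_def[symmetric] by (simp add: ennreal_leI flip: ennreal_plus)
      qed
      also have "\<dots> = E n + ((\<integral>\<^sup>+\<omega>. ennreal \<bar>additive (Env \<omega>) (i + n) g\<^sub>0 - additive (Env \<omega>) i ((T ^^ n) g\<^sub>0)\<bar> \<partial>M) +
          (\<integral>\<^sup>+\<omega>. ennreal \<bar>W_inf (Env \<omega>) - W (Env \<omega>) i\<bar> \<partial>M))"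
        unfolding E_def using unit_functionsD(1)[OF g\<^sub>0] by (simp add: nn_integral_add)
      also have "\<dots> \<le> E n + (ennreal ?b + ennreal ?b)"
        by (intro add_left_mono add_mono additive_steps g\<^sub>0 W_inf_diff)
      also have "ennreal ?b + ennreal ?b = ennreal (K * sqrt q ^ i)"
        using b by (simp add: K_def flip: ennreal_plus)
      finally show ?thesis .
    qed
    have "limsup (\<lambda>l. \<integral>\<^sup>+\<omega>. ennreal \<bar>green (Env \<omega>) l - c * W_inf (Env \<omega>)\<bar> \<partial>M) =
        limsup (\<lambda>n. \<integral>\<^sup>+\<omega>. ennreal \<bar>green (Env \<omega>) (n + i) - c * W_inf (Env \<omega>)\<bar> \<partial>M)"
      by (rule limsup_shift_k[symmetric])
    also have "\<dots> \<le> limsup (\<lambda>n. E n + ennreal (K * sqrt q ^ i))"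
      using le by (intro Limsup_mono always_eventually) (simp add: add.commute)
    also have "\<dots> = ennreal (K * sqrt q ^ i)"
    proof (rule lim_imp_Limsup)
      have "(\<lambda>n. E n + ennreal (K * sqrt q ^ i)) \<longlonglongrightarrow> 0 + ennreal (K * sqrt q ^ i)"
        by (intro tendsto_add E tendsto_const)
      then show "(\<lambda>n. E n + ennreal (K * sqrt q ^ i)) \<longlonglongrightarrow> ennreal (K * sqrt q ^ i)" by simp
    qed simp
    finally show ?thesis .
  qed
  have "(\<lambda>i. ennreal (K * sqrt q ^ i)) \<longlonglongrightarrow> ennreal (K * 0)"
    using sqrt_q by (intro tendsto_ennrealI tendsto_intros LIMSEQ_realpow_zero) auto
  then have "limsup (\<lambda>l. \<integral>\<^sup>+\<omega>. ennreal \<bar>green (Env \<omega>) l - c * W_inf (Env \<omega>)\<bar> \<partial>M) \<le> 0"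
    using main by (intro LIMSEQ_le_const) auto
  then show ?thesis
    by (intro tendsto_0_if_Limsup_eq_0_ennreal) simp
qed

end

section \<open>The constant and the associated walk\<close>

lemma sum_gen_1: "(\<Sum>x\<in>gen e 1. \<phi> x) = (\<Sum>i<length (e []). \<phi> [i])"
  using sum_gen_Suc[where e = e and n = 0 and g = \<phi>] by (simp add: sum_children)

lemma V_singleton [simp]: "V e [i] = e [] ! i"
  using V_snoc[of e "[]" i] by simp

lemma inverse_le_1_ennreal: "1 \<le> (x :: ennreal) \<Longrightarrow> inverse x \<le> 1"
proof (cases x)
  case (real r)
  assume "1 \<le> x"
  then have "1 \<le> r" using real by simp
  then show "inverse x \<le> 1" using real by (simp add: inverse_ennreal inverse_le_1_iff)
qed simp

text \<open>
  If the series converges, then its terms tend to zero and \<open>h\<close> is forgotten; if it diverges, then both sides tend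
  to zero.
\<close>

lemma tendsto_inverse_partial_sums:
  fixes a :: "nat \<Rightarrow> real"
  assumes a: "\<And>n. 0 < a n" and h: "0 \<le> h"
  shows "(\<lambda>n. inverse (ennreal ((\<Sum>j<n. a j) + a n * h))) \<longlonglongrightarrow> inverse (\<Sum>j. ennreal (a j))"
proof -
  have a0: "0 \<le> a n" for n using a[of n] by simp
  have P: "(\<lambda>n. ennreal (\<Sum>j<n. a j)) \<longlonglongrightarrow> (\<Sum>j. ennreal (a j))"
  proof -
    have "ennreal (\<Sum>j<n. a j) = (\<Sum>j<n. ennreal (a j))" for n
      using a0 by (intro sum_ennreal[symmetric])
    then show ?thesis using summable_LIMSEQ[OF summableI, of "\<lambda>j. ennreal (a j)"] by (simp only:)
  qed
  have "(\<lambda>n. ennreal ((\<Sum>j<n. a j) + a n * h)) \<longlonglongrightarrow> (\<Sum>j. ennreal (a j))"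
  proof (cases "summable a")
    case True
    have "(\<lambda>n. (\<Sum>j<n. a j) + a n * h) \<longlonglongrightarrow> suminf a + 0 * h"
      by (intro tendsto_intros summable_LIMSEQ True summable_LIMSEQ_zero)
    then have "(\<lambda>n. ennreal ((\<Sum>j<n. a j) + a n * h)) \<longlonglongrightarrow> ennreal (suminf a)"
      by (simp add: tendsto_ennrealI)
    then show ?thesis using True a0 by (simp add: suminf_ennreal2)
  next
    case False
    have "(\<Sum>j. ennreal (a j)) = \<top>"
    proof (rule ccontr)
      assume "(\<Sum>j. ennreal (a j)) \<noteq> \<top>"
      then have "summable a" using a0 by (intro summable_suminf_not_top) auto
      then show False using False by simp
    qed
    moreover have "(\<lambda>n. ennreal ((\<Sum>j<n. a j) + a n * h)) \<longlonglongrightarrow> \<top>"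
    proof (rule tendsto_sandwich[OF _ _ P[unfolded calculation] tendsto_const])
      show "\<forall>\<^sub>F n in sequentially. ennreal (\<Sum>j<n. a j) \<le> ennreal ((\<Sum>j<n. a j) + a n * h)"
        using a0 h by (intro always_eventually allI ennreal_leI) simp
    qed auto
    ultimately show ?thesis by simp
  qed
  moreover have "continuous_on UNIV (\<lambda>x :: ennreal. inverse x)"
    by (intro continuous_on_inverse_ennreal continuous_on_id)
  ultimately show ?thesis
    using continuous_on_tendsto_compose[of UNIV "\<lambda>x :: ennreal. inverse x"] by simp
qed

context branching_walk
begin

context
  fixes M' :: "'v measure" and S :: "nat \<Rightarrow> 'v \<Rightarrow> real"
  assumes walk: "assoc_walk M Env M' S"
begin

lemma prob_space_walk: "prob_space M'"
  using walk by (simp add: assoc_walk_def)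

lemma walk_increments:
  "prob_space.indep_vars M' (\<lambda>_. borel) (\<lambda>j \<omega>. S (Suc j) \<omega> - S j \<omega>) UNIV"
  using walk by (simp add: assoc_walk_def)

lemma measurable_walk_increment [measurable]: "(\<lambda>\<omega>. S (Suc j) \<omega> - S j \<omega>) \<in> borel_measurable M'"
proof -
  interpret M': prob_space M' by (rule prob_space_walk)
  show ?thesis using walk_increments unfolding M'.indep_vars_def by simp
qed

lemma walk_0: "\<omega> \<in> space M' \<Longrightarrow> S 0 \<omega> = 0"
  using walk by (simp add: assoc_walk_def)

lemma walk_eq_sum:
  assumes "\<omega> \<in> space M'"
  shows "S n \<omega> = (\<Sum>j<n. S (Suc j) \<omega> - S j \<omega>)"
  using walk_0[OF assms] sum_lessThan_telescope[of "\<lambda>j. S j \<omega>" n] by simp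

lemma measurable_walk [measurable]: "S n \<in> borel_measurable M'"
proof -
  have "(\<lambda>\<omega>. \<Sum>j<n. S (Suc j) \<omega> - S j \<omega>) \<in> borel_measurable M'" by measurable
  then show ?thesis by (rule iffD2[OF measurable_cong[OF walk_eq_sum], rotated])
qed

lemma T_eq_walk:
  assumes g: "g \<in> unit_functions"
  shows "(\<integral>\<^sup>+\<omega>. ennreal (g (1 + exp (- (S (Suc j) \<omega> - S j \<omega>)) * h)) \<partial>M') = ennreal (T g h)"
proof -
  interpret M': prob_space M' by (rule prob_space_walk)
  note [measurable] = unit_functionsD(1)[OF g]
  define f where "f x = g (1 + exp (- x) * h)" for x
  have f_meas [measurable]: "f \<in> borel_measurable borel" unfolding f_def by measurable
  have f_bounds: "0 \<le> f x" "f x \<le> 1" for x using unit_functionsD[OF g] by (auto simp: f_def)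
  have "bounded (range f)"
    unfolding bounded_iff using f_bounds by (intro exI[of _ 1]) auto
  have "(\<integral>\<^sup>+\<omega>. ennreal (f (S (Suc j) \<omega> - S j \<omega>)) \<partial>M') =
      (\<integral>\<^sup>+x. ennreal (f x) \<partial>distr M' borel (\<lambda>\<omega>. S (Suc j) \<omega> - S j \<omega>))"
    by (subst nn_integral_distr) auto
  also have "\<dots> = (\<integral>\<^sup>+x. ennreal (f x) \<partial>distr M' borel (S 1))"
    using walk unfolding assoc_walk_def by presburger
  also have "\<dots> = (\<integral>\<^sup>+\<omega>. ennreal (f (S 1 \<omega>)) \<partial>M')"
    by (subst nn_integral_distr) auto
  also have "\<dots> = ennreal (\<integral>\<omega>. f (S 1 \<omega>) \<partial>M')"
    by (intro nn_integral_eq_integral M'.integrable_const_bound[where B = 1]) (auto simp: f_bounds)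
  also have "(\<integral>\<omega>. f (S 1 \<omega>) \<partial>M') = (\<integral>\<omega>. (\<Sum>x\<in>gen (Env \<omega>) 1. f (V (Env \<omega>) x) * exp (- V (Env \<omega>) x)) \<partial>M)"
    using walk f_meas \<open>bounded (range f)\<close> unfolding assoc_walk_def by blast
  also have "\<dots> = T g h"
    unfolding T_def offspring_sum_def sum_gen_1 by (simp add: f_def mult.commute)
  finally show ?thesis by (simp add: f_def)
qed

text \<open>
  Peeling off the last increment \<open>x\<close> of the walk replaces \<open>h\<close> by \<open>1 + exp (- x) * h\<close>, which is one application
  of \<open>T\<close>.
\<close>

lemma funpow_T_eq_walk:
  assumes g: "g \<in> unit_functions"
  shows "(\<integral>\<^sup>+\<omega>. ennreal (g ((\<Sum>j<n. exp (- S j \<omega>)) + exp (- S n \<omega>) * h)) \<partial>M') = ennreal ((T ^^ n) g h)"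
proof (induction n arbitrary: h)
  case 0
  interpret M': prob_space M' by (rule prob_space_walk)
  have "(\<integral>\<^sup>+\<omega>. ennreal (g (exp (- S 0 \<omega>) * h)) \<partial>M') = (\<integral>\<^sup>+\<omega>. ennreal (g h) \<partial>M')"
    by (intro nn_integral_cong) (simp add: walk_0)
  then show ?case by (simp add: M'.emeasure_space_1)
next
  case (Suc n)
  interpret M': prob_space M' by (rule prob_space_walk)
  note [measurable] = unit_functionsD(1)[OF g]
  define Z :: "nat \<Rightarrow> real \<Rightarrow> (nat \<Rightarrow> real) \<Rightarrow> real"
    where "Z n h y = (\<Sum>j<n. exp (- (\<Sum>i<j. y i))) + exp (- (\<Sum>i<n. y i)) * h" for n h y
  define X where "X j \<omega> = S (Suc j) \<omega> - S j \<omega>" for j \<omega>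
  have Z_eq: "Z n h (\<lambda>j. X j \<omega>) = (\<Sum>j<n. exp (- S j \<omega>)) + exp (- S n \<omega>) * h" if "\<omega> \<in> space M'" for n h \<omega>
    using that by (simp add: Z_def X_def walk_eq_sum[symmetric])
  have Z_Suc: "Z (Suc n) h y = Z n (1 + exp (- y n) * h) y" for y
    by (simp add: Z_def algebra_simps exp_add exp_diff exp_minus field_simps)
  have Z_cong: "Z n h y = Z n h y'" if "\<And>i. i < n \<Longrightarrow> y i = y' i" for h y y'
    using that by (simp add: Z_def)
  define F where "F x y = ennreal (g (Z n (1 + exp (- x n) * h) y))" for x y :: "nat \<Rightarrow> real"
  have "(\<integral>\<^sup>+\<omega>. ennreal (g ((\<Sum>j<Suc n. exp (- S j \<omega>)) + exp (- S (Suc n) \<omega>) * h)) \<partial>M') =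
      (\<integral>\<^sup>+\<omega>. F (\<lambda>j\<in>{n}. X j \<omega>) (\<lambda>j\<in>{..<n}. X j \<omega>) \<partial>M')"
  proof (intro nn_integral_cong)
    fix \<omega> assume "\<omega> \<in> space M'"
    then have "(\<Sum>j<Suc n. exp (- S j \<omega>)) + exp (- S (Suc n) \<omega>) * h = Z (Suc n) h (\<lambda>j. X j \<omega>)"
      by (simp only: Z_eq)
    also have "\<dots> = Z n (1 + exp (- X n \<omega>) * h) (\<lambda>j\<in>{..<n}. X j \<omega>)"
      unfolding Z_Suc by (rule Z_cong) simp
    finally show "ennreal (g ((\<Sum>j<Suc n. exp (- S j \<omega>)) + exp (- S (Suc n) \<omega>) * h)) =
        F (\<lambda>j\<in>{n}. X j \<omega>) (\<lambda>j\<in>{..<n}. X j \<omega>)" by (simp add: F_def)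
  qed
  also have "\<dots> = (\<integral>\<^sup>+\<omega>. (\<integral>\<^sup>+\<omega>'. F (\<lambda>j\<in>{n}. X j \<omega>) (\<lambda>j\<in>{..<n}. X j \<omega>') \<partial>M') \<partial>M')"
    unfolding X_def
  proof (rule M'.nn_integral_indep_restrict[OF walk_increments])
    have c: "(\<lambda>p. snd p i) \<in> borel_measurable (PiM {n} (\<lambda>_. borel) \<Otimes>\<^sub>M PiM {..<n} (\<lambda>_. borel))"
      if "i < n" for i
      by (rule measurable_compose[OF measurable_snd measurable_component_singleton]) (use that in simp)
    have c': "(\<lambda>p. fst p n) \<in> borel_measurable (PiM {n} (\<lambda>_. borel) \<Otimes>\<^sub>M PiM {..<n} (\<lambda>_. borel))"
      by (rule measurable_compose[OF measurable_fst measurable_component_singleton]) simp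
    let ?N = "PiM {n} (\<lambda>_. borel :: real measure) \<Otimes>\<^sub>M PiM {..<n} (\<lambda>_. borel :: real measure)"
    have s: "(\<lambda>p. exp (- (\<Sum>i<j. snd p i))) \<in> borel_measurable ?N" if "j \<le> n" for j
    proof -
      have "(\<lambda>p. \<Sum>i<j. snd p i) \<in> borel_measurable ?N"
        by (rule borel_measurable_sum[where f = "\<lambda>i p. snd p i"]) (use that c in auto)
      from measurable_compose[OF borel_measurable_uminus[OF this] borel_measurable_exp] show ?thesis .
    qed
    have "(\<lambda>p. \<Sum>j<n. exp (- (\<Sum>i<j. snd p i))) \<in> borel_measurable ?N"
      by (rule borel_measurable_sum[where f = "\<lambda>j p. exp (- (\<Sum>i<j. snd p i))"]) (use s in auto)
    then have "(\<lambda>p. (\<Sum>j<n. exp (- (\<Sum>i<j. snd p i))) + exp (- (\<Sum>i<n. snd p i)) * (1 + exp (- fst p n) * h))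
        \<in> borel_measurable ?N"
      using c'
      by (intro borel_measurable_add borel_measurable_times s borel_measurable_const
          measurable_compose[OF borel_measurable_uminus borel_measurable_exp]) auto
    then show "case_prod F \<in> borel_measurable ?N"
      unfolding split_beta F_def Z_def by (intro measurable_compose[OF _ unit_functionsD(1)[OF g]]
          measurable_compose[OF _ measurable_ennreal])
  qed auto
  also have "\<dots> = (\<integral>\<^sup>+\<omega>. ennreal ((T ^^ n) g (1 + exp (- X n \<omega>) * h)) \<partial>M')"
  proof (intro nn_integral_cong)
    fix \<omega>
    let ?h = "1 + exp (- X n \<omega>) * h"
    have "(\<integral>\<^sup>+\<omega>'. F (\<lambda>j\<in>{n}. X j \<omega>) (\<lambda>j\<in>{..<n}. X j \<omega>') \<partial>M') =
        (\<integral>\<^sup>+\<omega>'. ennreal (g ((\<Sum>j<n. exp (- S j \<omega>')) + exp (- S n \<omega>') * ?h)) \<partial>M')"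
    proof (intro nn_integral_cong)
      fix \<omega>' assume "\<omega>' \<in> space M'"
      then have "Z n ?h (\<lambda>j\<in>{..<n}. X j \<omega>') = (\<Sum>j<n. exp (- S j \<omega>')) + exp (- S n \<omega>') * ?h"
        by (subst Z_eq[symmetric]) (auto intro: Z_cong)
      then show "F (\<lambda>j\<in>{n}. X j \<omega>) (\<lambda>j\<in>{..<n}. X j \<omega>') =
          ennreal (g ((\<Sum>j<n. exp (- S j \<omega>')) + exp (- S n \<omega>') * ?h))" by (simp add: F_def)
    qed
    also note Suc
    finally show "(\<integral>\<^sup>+\<omega>'. F (\<lambda>j\<in>{n}. X j \<omega>) (\<lambda>j\<in>{..<n}. X j \<omega>') \<partial>M') = ennreal ((T ^^ n) g ?h)" .
  qed
  also have "\<dots> = ennreal ((T ^^ Suc n) g h)"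
    unfolding X_def using T_eq_walk[OF funpow_T_unit_functions[OF g]] by simp
  finally show ?case .
qed

lemma walk_series_ge_1:
  assumes "\<omega> \<in> space M'"
  shows "1 \<le> (\<Sum>j. ennreal (exp (- S j \<omega>)))"
proof -
  have "(\<Sum>j<1. ennreal (exp (- S j \<omega>))) \<le> (\<Sum>j. ennreal (exp (- S j \<omega>)))"
    by (rule sum_le_suminf) auto
  then show ?thesis using walk_0[OF assms] by simp
qed

lemma c_inf_eq: "(\<integral>\<^sup>+\<omega>. inverse (\<Sum>j. ennreal (exp (- S j \<omega>))) \<partial>M') = ennreal (c_inf M' S)"
  and c_inf_bounds: "0 \<le> c_inf M' S" "c_inf M' S \<le> 1"
proof -
  interpret M': prob_space M' by (rule prob_space_walk)
  have "(\<integral>\<^sup>+\<omega>. inverse (\<Sum>j. ennreal (exp (- S j \<omega>))) \<partial>M') \<le> (\<integral>\<^sup>+\<omega>. 1 \<partial>M')"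
  proof (intro nn_integral_mono)
    fix \<omega> assume "\<omega> \<in> space M'"
    then show "inverse (\<Sum>j. ennreal (exp (- S j \<omega>))) \<le> 1"
      using inverse_le_1_ennreal walk_series_ge_1 by blast
  qed
  then have le: "(\<integral>\<^sup>+\<omega>. inverse (\<Sum>j. ennreal (exp (- S j \<omega>))) \<partial>M') \<le> 1"
    by (simp add: M'.emeasure_space_1)
  then have "(\<integral>\<^sup>+\<omega>. inverse (\<Sum>j. ennreal (exp (- S j \<omega>))) \<partial>M') \<noteq> \<top>"
    by (auto simp: top_unique)
  then show eq: "(\<integral>\<^sup>+\<omega>. inverse (\<Sum>j. ennreal (exp (- S j \<omega>))) \<partial>M') = ennreal (c_inf M' S)"
    by (simp add: c_inf_def less_top)
  show "0 \<le> c_inf M' S" by (simp add: c_inf_def)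
  show "c_inf M' S \<le> 1" using le unfolding eq by simp
qed

lemma funpow_T_tendsto_c_inf:
  assumes h: "1 \<le> h"
  shows "(\<lambda>n. (T ^^ n) (\<lambda>h. 1 / max 1 h) h) \<longlonglongrightarrow> c_inf M' S"
proof -
  interpret M': prob_space M' by (rule prob_space_walk)
  define g\<^sub>0 :: "real \<Rightarrow> real" where "g\<^sub>0 = (\<lambda>h. 1 / max 1 h)"
  have g\<^sub>0: "g\<^sub>0 \<in> unit_functions" by (auto simp: g\<^sub>0_def unit_functions_def)
  note [measurable] = unit_functionsD(1)[OF g\<^sub>0]
  have "(\<lambda>n. \<integral>\<^sup>+\<omega>. ennreal (g\<^sub>0 ((\<Sum>j<n. exp (- S j \<omega>)) + exp (- S n \<omega>) * h)) \<partial>M') \<longlonglongrightarrow>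
      (\<integral>\<^sup>+\<omega>. inverse (\<Sum>j. ennreal (exp (- S j \<omega>))) \<partial>M')"
  proof (rule nn_integral_dominated_convergence[where w = "\<lambda>_. 1"])
    show "AE \<omega> in M'. (\<lambda>n. ennreal (g\<^sub>0 ((\<Sum>j<n. exp (- S j \<omega>)) + exp (- S n \<omega>) * h))) \<longlonglongrightarrow>
        inverse (\<Sum>j. ennreal (exp (- S j \<omega>)))"
    proof (intro AE_I2)
      fix \<omega> assume \<omega>: "\<omega> \<in> space M'"
      have ge: "1 \<le> (\<Sum>j<n. exp (- S j \<omega>)) + exp (- S n \<omega>) * h" for n
      proof (cases n)
        case 0
        then show ?thesis using walk_0[OF \<omega>] h by simp
      next
        case (Suc m)
        have "exp (- S 0 \<omega>) \<le> (\<Sum>j<n. exp (- S j \<omega>))"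
          using Suc by (intro member_le_sum) auto
        moreover have "0 \<le> exp (- S n \<omega>) * h" using h by simp
        ultimately show ?thesis using walk_0[OF \<omega>] by simp
      qed
      have eq: "ennreal (g\<^sub>0 ((\<Sum>j<n. exp (- S j \<omega>)) + exp (- S n \<omega>) * h)) =
          inverse (ennreal ((\<Sum>j<n. exp (- S j \<omega>)) + exp (- S n \<omega>) * h))" for n
        using ge[of n] by (subst inverse_ennreal) (auto simp: g\<^sub>0_def inverse_eq_divide max_absorb2)
      show "(\<lambda>n. ennreal (g\<^sub>0 ((\<Sum>j<n. exp (- S j \<omega>)) + exp (- S n \<omega>) * h))) \<longlonglongrightarrow>
          inverse (\<Sum>j. ennreal (exp (- S j \<omega>)))"
        unfolding eq by (rule tendsto_inverse_partial_sums) (use h in auto)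
    qed
    show "AE \<omega> in M'. ennreal (g\<^sub>0 ((\<Sum>j<n. exp (- S j \<omega>)) + exp (- S n \<omega>) * h)) \<le> 1" for n
      using unit_functionsD[OF g\<^sub>0] by simp
  qed (auto simp: M'.emeasure_space_1)
  then have "(\<lambda>n. ennreal ((T ^^ n) g\<^sub>0 h)) \<longlonglongrightarrow> ennreal (c_inf M' S)"
    unfolding funpow_T_eq_walk[OF g\<^sub>0] c_inf_eq .
  then show ?thesis
    using unit_functionsD[OF funpow_T_unit_functions[OF g\<^sub>0]] c_inf_bounds
    by (simp add: g\<^sub>0_def)
qed

end

end

section \<open>Convergence of weighted averages of the range\<close>

text \<open>
  The bound on the mean distance between \<open>R / \<surd>n\<close> and its limit at one level: discovery noise, then the
  distance of \<open>green\<close> from its limit, then the effect of rounding \<open>\<surd>n\<close>.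
\<close>

definition level_bound :: "real \<Rightarrow> env \<Rightarrow> nat \<Rightarrow> nat \<Rightarrow> real \<Rightarrow> ennreal" where
  "level_bound c e n j \<eta> =
     ennreal (\<eta> * (1 + green e j) + (2 * pair_energy e j / sqrt (real n) + sqrt (real n) * W2 e j) / \<eta>) +
     ennreal \<bar>green e j - c * W_inf e\<bar> + ennreal (\<bar>W_inf e\<bar> / sqrt (real n))"

lemma quenched_level_bound:
  fixes e :: env and n j :: nat
  assumes W: "\<And>n. W e n \<le> C" and n: "0 < n" and j: "0 < j" and \<eta>: "0 < \<eta>" and c: "0 \<le> c" "c \<le> 1"
  shows "(\<integral>\<^sup>+X. ennreal \<bar>R e X n j / sqrt (real n) - c * W_inf e\<bar> \<partial>walk_law e) \<le> level_bound c e n j \<eta>"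
proof -
  interpret prob_space "walk_law e" by (rule prob_space_walk_law)
  define k where "k = nat \<lfloor>sqrt (real n)\<rfloor>"
  define s where "s = sqrt (real n)"
  have s: "1 \<le> s" using n by (simp add: s_def)
  have k: "1 \<le> real k" "real k \<le> s" "s - 1 \<le> real k"
  proof -
    have "1 \<le> \<lfloor>s\<rfloor>" using s by (simp add: le_floor_iff)
    moreover have "real k = of_int \<lfloor>s\<rfloor>" using calculation by (simp add: k_def s_def)
    moreover have "of_int \<lfloor>s\<rfloor> \<le> s" "s - 1 < of_int \<lfloor>s\<rfloor>" by linarith+
    ultimately show "1 \<le> real k" "real k \<le> s" "s - 1 \<le> real k" by linarith+
  qed
  let ?g = "green e j" and ?w = "W_inf e"
  have scale: "\<bar>t * y\<bar> \<le> \<bar>y\<bar>" if "0 \<le> t" "t \<le> 1" for t y :: real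
    using that by (simp add: abs_mult mult_left_le_one_le)
  have "(\<integral>\<^sup>+X. ennreal \<bar>R e X n j / s - c * ?w\<bar> \<partial>walk_law e) \<le>
      (\<integral>\<^sup>+X. ennreal \<bar>R e X n j / real k - ?g\<bar> + ennreal (\<bar>?g - c * ?w\<bar> + \<bar>?w\<bar> / s) \<partial>walk_law e)"
  proof (intro nn_integral_mono)
    fix X
    let ?r = "R e X n j / real k" and ?t = "real k / s"
    have "1 - ?t = (s - real k) / s" using s by (simp add: diff_divide_distrib)
    also have "\<dots> \<le> 1 / s" using k s by (intro divide_right_mono) auto
    finally have t: "0 \<le> ?t" "?t \<le> 1" "1 - ?t \<le> 1 / s" using k s by auto
    have tri: "\<bar>x + y - z\<bar> \<le> a + (b + d)" if "\<bar>x\<bar> \<le> a" "\<bar>y\<bar> \<le> b" "\<bar>z\<bar> \<le> d" for x y z a b d :: real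
      using that by linarith
    have alg: "t * r - x = t * (r - g) + t * (g - x) - (1 - t) * x" for t r g x :: real
      by (simp add: algebra_simps)
    have R_eq: "R e X n j / s = ?t * ?r" using k by simp
    have eq: "R e X n j / s - c * ?w = ?t * (?r - ?g) + ?t * (?g - c * ?w) - (1 - ?t) * (c * ?w)"
      unfolding R_eq by (rule alg)
    have "\<bar>?t * (?r - ?g)\<bar> \<le> \<bar>?r - ?g\<bar>" "\<bar>?t * (?g - c * ?w)\<bar> \<le> \<bar>?g - c * ?w\<bar>"
      by (rule scale[OF t(1,2)])+
    moreover have "\<bar>(1 - ?t) * (c * ?w)\<bar> \<le> 1 / s * \<bar>?w\<bar>"
    proof -
      have "\<bar>c * ?w\<bar> \<le> \<bar>?w\<bar>" by (rule scale[OF c])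
      then show ?thesis unfolding abs_mult[of "1 - ?t"] using t s by (intro mult_mono) auto
    qed
    ultimately have "\<bar>R e X n j / s - c * ?w\<bar> \<le> \<bar>?r - ?g\<bar> + (\<bar>?g - c * ?w\<bar> + \<bar>?w\<bar> / s)"
      unfolding eq using tri[of "?t * (?r - ?g)" "\<bar>?r - ?g\<bar>" "?t * (?g - c * ?w)" "\<bar>?g - c * ?w\<bar>"
        "(1 - ?t) * (c * ?w)" "\<bar>?w\<bar> / s"] by (simp only: times_divide_eq_left mult_1_left)
    then show "ennreal \<bar>R e X n j / s - c * ?w\<bar> \<le> ennreal \<bar>?r - ?g\<bar> + ennreal (\<bar>?g - c * ?w\<bar> + \<bar>?w\<bar> / s)"
      using s by (simp add: ennreal_leI flip: ennreal_plus)
  qed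
  also have "\<dots> = (\<integral>\<^sup>+X. ennreal \<bar>R e X n j / real k - ?g\<bar> \<partial>walk_law e) + ennreal (\<bar>?g - c * ?w\<bar> + \<bar>?w\<bar> / s)"
    using emeasure_space_1 by (subst nn_integral_add) auto
  also have "\<dots> \<le> ennreal (\<eta> * (1 + ?g) + (pair_energy e j / real k + real k * W2 e j) / \<eta>) +
      ennreal (\<bar>?g - c * ?w\<bar> + \<bar>?w\<bar> / s)"
    unfolding k_def by (intro add_right_mono quenched_L1_bound[OF W n j \<eta>])
  also have "\<dots> \<le> ennreal (\<eta> * (1 + ?g) + (2 * pair_energy e j / s + s * W2 e j) / \<eta>) +
      ennreal (\<bar>?g - c * ?w\<bar> + \<bar>?w\<bar> / s)"
  proof (intro add_right_mono ennreal_leI add_left_mono divide_right_mono add_mono)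
    have "s \<le> 2 * real k" using k by linarith
    then have "pair_energy e j * s \<le> pair_energy e j * (2 * real k)"
      by (intro mult_left_mono pair_energy_nonneg)
    then show "pair_energy e j / real k \<le> 2 * pair_energy e j / s"
      using k s by (simp add: field_simps)
    show "real k * W2 e j \<le> s * W2 e j" using k W2_nonneg by (intro mult_right_mono)
    show "0 \<le> \<eta>" using \<eta> by simp
  qed
  also have "\<dots> = level_bound c e n j \<eta>"
    unfolding level_bound_def s_def by (simp add: add.assoc)
  finally show ?thesis by (simp add: s_def)
qed

lemma green_le_W: "green e j \<le> W e j"
  unfolding green_def W_def by (intro sum_mono inverse_res_le)

definition high :: "nat \<Rightarrow> real \<Rightarrow> env set" where
  "high m a = {e. \<forall>z\<in>gen e m. a \<le> V e z}"

lemma measurable_high [measurable]: "(\<lambda>e. e \<in> high m a) \<in> env_space \<rightarrow>\<^sub>M count_space UNIV"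
  unfolding high_def mem_Collect_eq
  by (rule measurable_gen_functional[where f = "\<lambda>e. e" and \<Phi> = "\<lambda>G e. \<forall>z\<in>G. a \<le> V e z"])
    (auto intro!: pred_intros_finite)

context branching_walk
begin

lemma measurable_level_bound [measurable]: "(\<lambda>\<omega>. level_bound c (Env \<omega>) n j \<eta>) \<in> borel_measurable M"
  unfolding level_bound_def by measurable

text \<open>
  On the event one factor \<open>exp (- V)\<close> is at most \<open>exp (- a)\<close> at generation \<open>m\<close>, and the other factor leaves \<open>W\<close>,
  of mean one; later generations only decrease the mean.
\<close>

lemma mean_W2_high:
  assumes "m \<le> j"
  shows "(\<integral>\<^sup>+\<omega>. indicator (high m a) (Env \<omega>) * ennreal (W2 (Env \<omega>) j) \<partial>M) \<le> ennreal (exp (- a))"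
proof -
  have "(\<integral>\<^sup>+\<omega>. indicator (high m a) (Env \<omega>) * ennreal (W2 (Env \<omega>) j) \<partial>M) \<le>
      (\<integral>\<^sup>+\<omega>. indicator (high m a) (Env \<omega>) * ennreal (W2 (Env \<omega>) m) \<partial>M)"
  proof (rule mean_W2_decreasing[OF _ _ assms])
    show "indicator (high m a) \<in> borel_measurable env_space"
      by (rule borel_measurable_indicator') (use measurable_high[of m a] in \<open>simp add: pred_def space_PiM\<close>)
    show "indicator (high m a) x = (indicator (high m a) y :: ennreal)" if "agree_below m x y" for x y
    proof -
      have "V x u = V y u" if "u \<in> gen y m" for u
        using agree_below_V[OF \<open>agree_below m x y\<close>] genD(2)[OF that] by simp
      then have "x \<in> high m a \<longleftrightarrow> y \<in> high m a"
        unfolding high_def agree_below_gen[OF that order_refl] mem_Collect_eq by simp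
      then show ?thesis by (simp add: indicator_def)
    qed
  qed
  also have "\<dots> \<le> (\<integral>\<^sup>+\<omega>. ennreal (exp (- a)) * ennreal (W (Env \<omega>) m) \<partial>M)"
  proof (intro nn_integral_mono)
    fix \<omega>
    have "W2 (Env \<omega>) m \<le> exp (- a) * W (Env \<omega>) m" if "Env \<omega> \<in> high m a"
      unfolding W2_def W_def sum_distrib_left
    proof (intro sum_mono)
      fix z assume "z \<in> gen (Env \<omega>) m"
      then have "a \<le> V (Env \<omega>) z" using that by (simp add: high_def)
      then show "exp (- 2 * V (Env \<omega>) z) \<le> exp (- a) * exp (- V (Env \<omega>) z)" by (simp flip: exp_add)
    qed
    then show "indicator (high m a) (Env \<omega>) * ennreal (W2 (Env \<omega>) m) \<le> ennreal (exp (- a)) * ennreal (W (Env \<omega>) m)"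
      by (auto simp: indicator_def W_nonneg ennreal_leI simp flip: ennreal_mult)
  qed
  also have "\<dots> = ennreal (exp (- a))" by (simp add: nn_integral_cmult mean_W)
  finally show ?thesis .
qed

definition C\<^sub>1 :: real where "C\<^sub>1 = 1 + \<sigma> / (1 - q)"

lemma mean_level_bound:
  assumes mj: "m \<le> j" and n: "0 < n" and \<eta>: "0 < \<eta>"
  shows "(\<integral>\<^sup>+\<omega>. indicator (high m a) (Env \<omega>) * level_bound c (Env \<omega>) n j \<eta> \<partial>M) \<le>
    ennreal (2 * \<eta> + (2 * C\<^sub>1 * (real j + 1) / sqrt (real n) + sqrt (real n) * exp (- a)) / \<eta>) +
    (\<integral>\<^sup>+\<omega>. ennreal \<bar>green (Env \<omega>) j - c * W_inf (Env \<omega>)\<bar> \<partial>M) +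
    ennreal (1 / sqrt (real n)) * (\<integral>\<^sup>+\<omega>. ennreal \<bar>W_inf (Env \<omega>)\<bar> \<partial>M)"
proof -
  define s where "s = sqrt (real n)"
  have s: "1 \<le> s" using n by (simp add: s_def)
  have C1: "0 \<le> C\<^sub>1" using q \<sigma> by (simp add: C\<^sub>1_def)
  let ?I = "\<lambda>\<omega>. indicator (high m a) (Env \<omega>) :: ennreal"
  have I [measurable]: "?I \<in> borel_measurable M"
    by (rule borel_measurable_indicator'[where f = "\<lambda>\<omega>. Env \<omega>"])
      (use measurable_compose[OF measurable_Env measurable_high[of m a]] in \<open>simp add: pred_def\<close>)
  have "(\<integral>\<^sup>+\<omega>. ?I \<omega> * level_bound c (Env \<omega>) n j \<eta> \<partial>M) \<le>
      (\<integral>\<^sup>+\<omega>. (ennreal \<eta> + ennreal \<eta> * ennreal (W (Env \<omega>) j) +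
        ennreal (2 / (s * \<eta>)) * ennreal (pair_energy (Env \<omega>) j) +
        ennreal (s / \<eta>) * (?I \<omega> * ennreal (W2 (Env \<omega>) j))) +
        ennreal \<bar>green (Env \<omega>) j - c * W_inf (Env \<omega>)\<bar> +
        ennreal (1 / s) * ennreal \<bar>W_inf (Env \<omega>)\<bar> \<partial>M)"
  proof (intro nn_integral_mono)
    fix \<omega>
    let ?e = "Env \<omega>"
    show "?I \<omega> * level_bound c ?e n j \<eta> \<le> (ennreal \<eta> + ennreal \<eta> * ennreal (W ?e j) +
        ennreal (2 / (s * \<eta>)) * ennreal (pair_energy ?e j) +
        ennreal (s / \<eta>) * (?I \<omega> * ennreal (W2 ?e j))) +
        ennreal \<bar>green ?e j - c * W_inf ?e\<bar> + ennreal (1 / s) * ennreal \<bar>W_inf ?e\<bar>"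
    proof (cases "?e \<in> high m a")
      case True
      have "\<eta> * (1 + green ?e j) + (2 * pair_energy ?e j / s + s * W2 ?e j) / \<eta> \<le>
          \<eta> + \<eta> * W ?e j + 2 / (s * \<eta>) * pair_energy ?e j + s / \<eta> * W2 ?e j"
        using green_le_W[of ?e j] \<eta> by (simp add: distrib_left add_divide_distrib mult.commute)
      then have "ennreal (\<eta> * (1 + green ?e j) + (2 * pair_energy ?e j / s + s * W2 ?e j) / \<eta>) \<le>
          ennreal \<eta> + ennreal \<eta> * ennreal (W ?e j) + ennreal (2 / (s * \<eta>)) * ennreal (pair_energy ?e j) +
          ennreal (s / \<eta>) * ennreal (W2 ?e j)"
        using \<eta> s W_nonneg[of ?e j] pair_energy_nonneg[of ?e j] W2_nonneg[of ?e j]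
        by (simp add: ennreal_leI flip: ennreal_mult ennreal_plus)
      moreover have "ennreal (\<bar>W_inf ?e\<bar> / s) = ennreal (1 / s) * ennreal \<bar>W_inf ?e\<bar>"
        using s by (simp flip: ennreal_mult)
      ultimately show ?thesis
        using True unfolding level_bound_def s_def[symmetric] by (simp add: add_mono)
    qed simp
  qed
  also have "\<dots> = (ennreal \<eta> + ennreal \<eta> * 1 +
        ennreal (2 / (s * \<eta>)) * (\<integral>\<^sup>+\<omega>. ennreal (pair_energy (Env \<omega>) j) \<partial>M) +
        ennreal (s / \<eta>) * (\<integral>\<^sup>+\<omega>. ?I \<omega> * ennreal (W2 (Env \<omega>) j) \<partial>M)) +
        (\<integral>\<^sup>+\<omega>. ennreal \<bar>green (Env \<omega>) j - c * W_inf (Env \<omega>)\<bar> \<partial>M) +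
        ennreal (1 / s) * (\<integral>\<^sup>+\<omega>. ennreal \<bar>W_inf (Env \<omega>)\<bar> \<partial>M)"
    by (simp add: nn_integral_add nn_integral_cmult mean_W emeasure_space_1)
  also have "\<dots> \<le> (ennreal \<eta> + ennreal \<eta> * 1 +
        ennreal (2 / (s * \<eta>)) * ennreal (C\<^sub>1 * (real j + 1)) +
        ennreal (s / \<eta>) * ennreal (exp (- a))) +
        (\<integral>\<^sup>+\<omega>. ennreal \<bar>green (Env \<omega>) j - c * W_inf (Env \<omega>)\<bar> \<partial>M) +
        ennreal (1 / s) * (\<integral>\<^sup>+\<omega>. ennreal \<bar>W_inf (Env \<omega>)\<bar> \<partial>M)"
    unfolding C\<^sub>1_def by (intro add_right_mono add_mono order_refl mult_left_mono mean_pair_energy mean_W2_high mj) auto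
  also have "ennreal \<eta> + ennreal \<eta> * 1 + ennreal (2 / (s * \<eta>)) * ennreal (C\<^sub>1 * (real j + 1)) +
        ennreal (s / \<eta>) * ennreal (exp (- a)) =
      ennreal (2 * \<eta> + (2 * C\<^sub>1 * (real j + 1) / s + s * exp (- a)) / \<eta>)"
  proof -
    have "ennreal \<eta> + ennreal \<eta> * 1 + ennreal (2 / (s * \<eta>)) * ennreal (C\<^sub>1 * (real j + 1)) +
        ennreal (s / \<eta>) * ennreal (exp (- a)) =
      ennreal (\<eta> + \<eta> + 2 / (s * \<eta>) * (C\<^sub>1 * (real j + 1)) + s / \<eta> * exp (- a))"
      using \<eta> s C1 by (simp flip: ennreal_mult ennreal_plus)
    also have "\<eta> + \<eta> + 2 / (s * \<eta>) * (C\<^sub>1 * (real j + 1)) + s / \<eta> * exp (- a) =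
      2 * \<eta> + (2 * C\<^sub>1 * (real j + 1) / s + s * exp (- a)) / \<eta>"
      using \<eta> s by (simp add: field_simps)
    finally show ?thesis .
  qed
  finally show ?thesis by (simp add: s_def)
qed

lemma sets_survives: "{\<omega> \<in> space M. survives (Env \<omega>)} \<in> sets M"
proof -
  have [measurable]: "Measurable.pred M (\<lambda>\<omega>. gen (Env \<omega>) n \<noteq> {})" for n
    by (rule measurable_gen_functional[where f = Env and \<Phi> = "\<lambda>G w. G \<noteq> {}"]) auto
  show ?thesis unfolding survives_def by measurable
qed

text \<open>
  Conditioning on survival multiplies means by at most the inverse of its probability, and is trivial if this
  probability vanishes.
\<close>

lemma P_star_null_convergence:
  assumes U: "\<And>n. U n \<in> borel_measurable M"
    and le: "\<forall>\<^sub>F n in sequentially. (AE \<omega> in M. v n \<omega> \<le> U n \<omega>) \<and> (\<integral>\<^sup>+\<omega>. U n \<omega> \<partial>M) \<le> u n"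
    and u: "u \<longlonglongrightarrow> 0"
  shows "(\<lambda>n. \<integral>\<^sup>+\<omega>. v n \<omega> \<partial>P_star M Env) \<longlonglongrightarrow> (0 :: ennreal)"
proof -
  let ?A = "{\<omega> \<in> space M. survives (Env \<omega>)}"
  note [measurable] = U sets_survives
  have eq: "(\<integral>\<^sup>+\<omega>. U n \<omega> \<partial>P_star M Env) = (\<integral>\<^sup>+\<omega>. U n \<omega> * indicator ?A \<omega> \<partial>M) / emeasure M ?A" for n
    unfolding P_star_def by (rule nn_integral_uniform_measure) auto
  have le': "\<forall>\<^sub>F n in sequentially. (\<integral>\<^sup>+\<omega>. v n \<omega> \<partial>P_star M Env) \<le> (\<integral>\<^sup>+\<omega>. U n \<omega> * indicator ?A \<omega> \<partial>M) / emeasure M ?A"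
    using le
  proof eventually_elim
    case (elim n)
    then have "AE \<omega> in P_star M Env. v n \<omega> \<le> U n \<omega>"
      unfolding P_star_def by (intro AE_uniform_measureI sets_survives) auto
    then show ?case unfolding eq[symmetric] by (rule nn_integral_mono_AE)
  qed
  show ?thesis
  proof (cases "emeasure M ?A = 0")
    case True
    have "(\<integral>\<^sup>+\<omega>. U n \<omega> * indicator ?A \<omega> \<partial>M) = 0" for n
    proof -
      have "AE \<omega> in M. \<omega> \<notin> ?A" using True by (intro AE_not_in) (auto simp: null_sets_def)
      then show ?thesis by (subst nn_integral_0_iff_AE) auto
    qed
    then have "\<forall>\<^sub>F n in sequentially. (\<integral>\<^sup>+\<omega>. v n \<omega> \<partial>P_star M Env) = 0"
      using le' by (auto elim!: eventually_mono)
    then show ?thesis by (rule tendsto_eventually)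
  next
    case False
    have "\<forall>\<^sub>F n in sequentially. (\<integral>\<^sup>+\<omega>. v n \<omega> \<partial>P_star M Env) \<le> inverse (emeasure M ?A) * u n"
      using le le'
    proof eventually_elim
      case (elim n)
      have "(\<integral>\<^sup>+\<omega>. U n \<omega> * indicator ?A \<omega> \<partial>M) \<le> (\<integral>\<^sup>+\<omega>. U n \<omega> \<partial>M)"
        by (intro nn_integral_mono) (auto simp: indicator_def)
      also have "\<dots> \<le> u n" using elim by simp
      finally have "(\<integral>\<^sup>+\<omega>. U n \<omega> * indicator ?A \<omega> \<partial>M) / emeasure M ?A \<le> u n / emeasure M ?A"
        by (rule divide_right_mono_ennreal)
      also have "\<dots> = inverse (emeasure M ?A) * u n"
        by (simp add: divide_ennreal_def mult.commute)
      finally show ?case using elim by (auto intro: order_trans)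
    qed
    moreover have "(\<lambda>n. inverse (emeasure M ?A) * u n) \<longlonglongrightarrow> inverse (emeasure M ?A) * 0"
      using False by (intro ennreal_tendsto_cmult u) (simp add: less_top[symmetric])
    then have "(\<lambda>n. inverse (emeasure M ?A) * u n) \<longlonglongrightarrow> 0" by simp
    ultimately show ?thesis
      by (rule tendsto_sandwich[OF always_eventually[OF allI[OF zero_le]] _ tendsto_const])
  qed
qed

text \<open>
  Each level \<open>j\<close> of the window satisfies the same bound in mean, so any weights of total mass close to one can
  be used; the three statements of the theorem correspond to three choices. The parameter \<open>\<eta>\<close> of
  \<open>level_bound\<close> is \<open>sqrt (r n)\<close>, where \<open>r n\<close> bounds the discovery noise: this balances
  \<open>\<eta>\<close> against \<open>r n / \<eta>\<close>.
\<close>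

lemma range_converges:
  fixes l L :: "nat \<Rightarrow> nat" and w :: "nat \<Rightarrow> nat \<Rightarrow> real" and c \<delta> \<rho> :: real
  assumes green: "(\<lambda>j. \<integral>\<^sup>+\<omega>. ennreal \<bar>green (Env \<omega>) j - c * W_inf (Env \<omega>)\<bar> \<partial>M) \<longlonglongrightarrow> 0"
    and c: "0 \<le> c" "c \<le> 1"
    and \<delta>: "0 < \<delta>" and \<rho>: "0 < \<rho>"
    and high: "\<And>\<zeta>::nat. 1 \<le> \<zeta> \<Longrightarrow>
      1 - exp (- \<rho> * real \<zeta>) \<le> prob {\<omega> \<in> space M. Env \<omega> \<in> high (nat \<lceil>real \<zeta> / \<delta>\<rceil>) (3 * real \<zeta>)}"
    and l: "\<And>n. 1 \<le> n \<Longrightarrow> 0 < l n \<and> ln (real n) / \<delta> \<le> real (l n) \<and> l n \<le> L n"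
    and L: "(\<lambda>n. real (L n) / sqrt (real n)) \<longlonglongrightarrow> 0"
    and w: "\<And>n j. 0 \<le> w n j" "\<And>n. 1 \<le> n \<Longrightarrow> (\<Sum>j=l n..L n. w n j) \<le> 1" "(\<lambda>n. \<Sum>j=l n..L n. w n j) \<longlonglongrightarrow> 1"
  shows "converges_in_annealed_prob M Env
    (\<lambda>n \<omega> X. \<Sum>j=l n..L n. w n j * (R (Env \<omega>) X n j / sqrt (real n))) (\<lambda>\<omega>. c * W_inf (Env \<omega>))"
  unfolding converges_in_annealed_prob_def annealed_prob_def
proof (intro allI impI)
  fix \<epsilon> :: real assume \<epsilon>: "0 < \<epsilon>"
  \<comment> \<open>With this \<open>\<zeta>\<close> the generation \<open>m n\<close>, where the potential exceeds \<open>3 * \<zeta> n\<close>, precedes the window.\<close>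
  define \<zeta> where "\<zeta> n = nat \<lfloor>ln (real n)\<rfloor>" for n
  define m where "m n = nat \<lceil>real (\<zeta> n) / \<delta>\<rceil>" for n
  define G where "G n = high (m n) (3 * real (\<zeta> n))" for n
  define r where "r n = 2 * C\<^sub>1 * (real (L n) + 1) / sqrt (real n) + exp 3 / real n" for n
  define s where "s n = (\<Sum>j=l n..L n. w n j)" for n
  define d where "d j = (\<integral>\<^sup>+\<omega>. ennreal \<bar>green (Env \<omega>) j - c * W_inf (Env \<omega>)\<bar> \<partial>M)" for j
  define wb where "wb = (\<integral>\<^sup>+\<omega>. ennreal \<bar>W_inf (Env \<omega>)\<bar> \<partial>M)"
  have wb: "wb < \<top>" using mean_W_inf by (simp add: wb_def)
  have C1: "1 \<le> C\<^sub>1" using q \<sigma> by (simp add: C\<^sub>1_def)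
  have I_meas [measurable]: "(\<lambda>\<omega>. indicator (G n) (Env \<omega>) :: ennreal) \<in> borel_measurable M" for n
    unfolding G_def
    by (rule borel_measurable_indicator'[where f = "\<lambda>\<omega>. Env \<omega>"])
      (use measurable_compose[OF measurable_Env measurable_high] in \<open>simp add: pred_def\<close>)
  have [measurable]: "(\<lambda>\<omega>. indicator (- G n) (Env \<omega>) :: ennreal) \<in> borel_measurable M" for n
  proof -
    have "(\<lambda>\<omega>. indicator (- G n) (Env \<omega>) :: ennreal) = (\<lambda>\<omega>. 1 - indicator (G n) (Env \<omega>))"
      by (auto simp: indicator_def)
    then show ?thesis by simp
  qed
  have l_top: "filterlim l at_top sequentially"
  proof -
    have "filterlim (\<lambda>n. ln (real n) / \<delta>) at_top sequentially"
      using \<delta> by real_asymp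
    then have "filterlim (\<lambda>n. real (l n)) at_top sequentially"
      by (rule filterlim_at_top_mono) (use l in \<open>auto intro!: eventually_sequentiallyI[of 1]\<close>)
    then show ?thesis by (simp add: filterlim_sequentially_iff_filterlim_real)
  qed
  \<comment> \<open>The level of the window where the environment is worst.\<close>
  have "\<exists>i\<in>{l n..L n}. \<forall>j\<in>{l n..L n}. d j \<le> d i" if "1 \<le> n" for n
  proof -
    have "Max (d ` {l n..L n}) \<in> d ` {l n..L n}" using l[OF that] by (intro Max_in) auto
    then obtain i where "i \<in> {l n..L n}" "d i = Max (d ` {l n..L n})" by auto
    then show ?thesis by (intro bexI[of _ i]) auto
  qed
  then obtain i where i: "\<And>n. 1 \<le> n \<Longrightarrow> i n \<in> {l n..L n}" "\<And>n j. 1 \<le> n \<Longrightarrow> j \<in> {l n..L n} \<Longrightarrow> d j \<le> d (i n)"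
    by metis
  have "filterlim i at_top sequentially"
    by (rule filterlim_at_top_mono[OF l_top]) (use i in \<open>auto intro!: eventually_sequentiallyI[of 1]\<close>)
  then have di: "(\<lambda>n. d (i n)) \<longlonglongrightarrow> 0"
    using green unfolding d_def[symmetric] by (rule filterlim_compose[rotated])
  define b where "b n = ennreal (3 * sqrt (r n)) + d (i n) + ennreal (1 / sqrt (real n)) * wb" for n
  define U where "U n \<omega> = indicator (- G n) (Env \<omega>) + ennreal (1 / \<epsilon>) *
      ((\<Sum>j=l n..L n. ennreal (w n j) * (indicator (G n) (Env \<omega>) * level_bound c (Env \<omega>) n j (sqrt (r n)))) +
       ennreal (1 - s n) * ennreal \<bar>W_inf (Env \<omega>)\<bar>)" for n \<omega>
  define u where "u n = ennreal (exp (- \<rho> * real (\<zeta> n))) + ennreal (1 / \<epsilon>) * (b n + ennreal (1 - s n) * wb)" for n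
  have r_pos: "0 < r n" if "1 \<le> n" for n
  proof -
    have "0 \<le> 2 * C\<^sub>1 * (real (L n) + 1) / sqrt (real n)" using C1 by auto
    moreover have "0 < exp 3 / real n" using that by simp
    ultimately show ?thesis unfolding r_def by linarith
  qed
  show "(\<lambda>n. \<integral>\<^sup>+\<omega>. emeasure (walk_law (Env \<omega>)) {X \<in> space (walk_law (Env \<omega>)).
      \<epsilon> < \<bar>(\<Sum>j=l n..L n. w n j * (R (Env \<omega>) X n j / sqrt (real n))) - c * W_inf (Env \<omega>)\<bar>} \<partial>P_star M Env) \<longlonglongrightarrow> 0"
  proof (rule P_star_null_convergence[where U = U and u = u])
    show "U n \<in> borel_measurable M" for n
      unfolding U_def[abs_def] by measurable
    have "filterlim (\<lambda>n. real (\<zeta> n)) at_top sequentially"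
      unfolding \<zeta>_def by real_asymp
    then have "(\<lambda>n. exp (- \<rho> * real (\<zeta> n))) \<longlonglongrightarrow> 0"
      using \<rho> by (intro filterlim_compose[OF exp_at_bot] filterlim_tendsto_neg_mult_at_bot[OF tendsto_const]) auto
    then have 1: "(\<lambda>n. ennreal (exp (- \<rho> * real (\<zeta> n)))) \<longlonglongrightarrow> 0"
      using tendsto_ennrealI by fastforce
    have "r \<longlonglongrightarrow> 2 * C\<^sub>1 * (0 + 0) + 0"
    proof -
      have r_eq: "r = (\<lambda>n. 2 * C\<^sub>1 * (real (L n) / sqrt (real n) + 1 / sqrt (real n)) + exp 3 / real n)"
        by (auto simp: r_def add_divide_distrib distrib_left)
      have "(\<lambda>n. 1 / sqrt (real n)) \<longlonglongrightarrow> 0" "(\<lambda>n. exp 3 / real n) \<longlonglongrightarrow> 0" by real_asymp+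
      then show ?thesis unfolding r_eq by (intro tendsto_intros L)
    qed
    then have "(\<lambda>n. 3 * sqrt (r n)) \<longlonglongrightarrow> 3 * sqrt 0" by (intro tendsto_intros) simp
    then have 2: "(\<lambda>n. ennreal (3 * sqrt (r n))) \<longlonglongrightarrow> 0" using tendsto_ennrealI by fastforce
    have "(\<lambda>n. 1 / sqrt (real n)) \<longlonglongrightarrow> 0" by real_asymp
    then have "(\<lambda>n. wb * ennreal (1 / sqrt (real n))) \<longlonglongrightarrow> wb * ennreal 0"
      by (intro ennreal_tendsto_cmult wb tendsto_ennrealI)
    then have 3: "(\<lambda>n. ennreal (1 / sqrt (real n)) * wb) \<longlonglongrightarrow> 0" by (simp add: mult.commute)
    have "(\<lambda>n. 1 - s n) \<longlonglongrightarrow> 1 - 1" unfolding s_def by (intro tendsto_intros w)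
    then have "(\<lambda>n. wb * ennreal (1 - s n)) \<longlonglongrightarrow> wb * ennreal 0"
      by (intro ennreal_tendsto_cmult wb tendsto_ennrealI) simp
    then have 4: "(\<lambda>n. ennreal (1 - s n) * wb) \<longlonglongrightarrow> 0" by (simp add: mult.commute)
    have "(\<lambda>n. b n + ennreal (1 - s n) * wb) \<longlonglongrightarrow> 0 + 0 + 0 + 0"
      unfolding b_def by (intro tendsto_add 2 di 3 4)
    then have "(\<lambda>n. ennreal (1 / \<epsilon>) * (b n + ennreal (1 - s n) * wb)) \<longlonglongrightarrow> ennreal (1 / \<epsilon>) * 0"
      by (intro ennreal_tendsto_cmult) auto
    then have "u \<longlonglongrightarrow> 0 + ennreal (1 / \<epsilon>) * 0"
      unfolding u_def[abs_def] by (intro tendsto_add 1)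
    then show "u \<longlonglongrightarrow> 0" by simp
    show "\<forall>\<^sub>F n in sequentially. (AE \<omega> in M. emeasure (walk_law (Env \<omega>)) {X \<in> space (walk_law (Env \<omega>)).
        \<epsilon> < \<bar>(\<Sum>j=l n..L n. w n j * (R (Env \<omega>) X n j / sqrt (real n))) - c * W_inf (Env \<omega>)\<bar>} \<le> U n \<omega>) \<and>
        (\<integral>\<^sup>+\<omega>. U n \<omega> \<partial>M) \<le> u n"
    proof (rule eventually_sequentiallyI[of 3], intro conjI)
      fix n :: nat assume n: "3 \<le> n"
      have n1: "1 \<le> n" "0 < n" using n by auto
      have r0: "0 < sqrt (r n)" using r_pos[OF n1(1)] by simp
      have s: "0 \<le> s n" "s n \<le> 1" using w n1 by (auto simp: s_def sum_nonneg)
      show "AE \<omega> in M. emeasure (walk_law (Env \<omega>)) {X \<in> space (walk_law (Env \<omega>)).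
        \<epsilon> < \<bar>(\<Sum>j=l n..L n. w n j * (R (Env \<omega>) X n j / sqrt (real n))) - c * W_inf (Env \<omega>)\<bar>} \<le> U n \<omega>"
        using AE_W_bounded
      proof eventually_elim
        case (elim \<omega>)
        then obtain C where C: "\<And>n. W (Env \<omega>) n \<le> C" by blast
        let ?e = "Env \<omega>"
        let ?Q = "walk_law ?e"
        interpret Q: prob_space ?Q by (rule prob_space_walk_law)
        define Y where "Y X = (\<Sum>j=l n..L n. w n j * (R ?e X n j / sqrt (real n))) - c * W_inf ?e" for X
        have Y_meas [measurable]: "Y \<in> borel_measurable ?Q" unfolding Y_def by measurable
        show ?case
        proof (cases "?e \<in> G n")
          case False
          have "emeasure ?Q {X \<in> space ?Q. \<epsilon> < \<bar>Y X\<bar>} \<le> 1" by (rule Q.measure_le_1)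
          also have "\<dots> \<le> U n \<omega>" using False by (simp add: U_def)
          finally show ?thesis by (simp add: Y_def)
        next
          case True
          have Y_le: "ennreal \<bar>Y X\<bar> \<le> (\<Sum>j=l n..L n. ennreal (w n j) * ennreal \<bar>R ?e X n j / sqrt (real n) - c * W_inf ?e\<bar>) +
              ennreal (1 - s n) * ennreal \<bar>W_inf ?e\<bar>" for X
          proof -
            have "Y X = (\<Sum>j=l n..L n. w n j * (R ?e X n j / sqrt (real n) - c * W_inf ?e)) - (1 - s n) * (c * W_inf ?e)"
              by (simp add: Y_def s_def right_diff_distrib sum_subtractf sum_distrib_right left_diff_distrib)
            then have "\<bar>Y X\<bar> \<le> \<bar>\<Sum>j=l n..L n. w n j * (R ?e X n j / sqrt (real n) - c * W_inf ?e)\<bar> + \<bar>(1 - s n) * (c * W_inf ?e)\<bar>"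
              by linarith
            also have "\<bar>\<Sum>j=l n..L n. w n j * (R ?e X n j / sqrt (real n) - c * W_inf ?e)\<bar> \<le>
                (\<Sum>j=l n..L n. w n j * \<bar>R ?e X n j / sqrt (real n) - c * W_inf ?e\<bar>)"
              using w(1) by (intro order_trans[OF sum_abs] sum_mono) (simp add: abs_mult)
            also have "\<bar>(1 - s n) * (c * W_inf ?e)\<bar> \<le> (1 - s n) * \<bar>W_inf ?e\<bar>"
              using s c by (auto simp: abs_mult intro!: mult_left_mono mult_left_le_one_le)
            finally have "ennreal \<bar>Y X\<bar> \<le> ennreal ((\<Sum>j=l n..L n. w n j * \<bar>R ?e X n j / sqrt (real n) - c * W_inf ?e\<bar>) +
                (1 - s n) * \<bar>W_inf ?e\<bar>)" by (simp add: ennreal_leI)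
            also have "\<dots> = ennreal (\<Sum>j=l n..L n. w n j * \<bar>R ?e X n j / sqrt (real n) - c * W_inf ?e\<bar>) +
                ennreal ((1 - s n) * \<bar>W_inf ?e\<bar>)"
              using s w(1) by (intro ennreal_plus sum_nonneg mult_nonneg_nonneg) auto
            also have "ennreal ((1 - s n) * \<bar>W_inf ?e\<bar>) = ennreal (1 - s n) * ennreal \<bar>W_inf ?e\<bar>"
              using s by (intro ennreal_mult) auto
            also have "ennreal (\<Sum>j=l n..L n. w n j * \<bar>R ?e X n j / sqrt (real n) - c * W_inf ?e\<bar>) =
                (\<Sum>j=l n..L n. ennreal (w n j) * ennreal \<bar>R ?e X n j / sqrt (real n) - c * W_inf ?e\<bar>)"
              using w(1) by (intro ennreal_sum_mult) auto
            finally show ?thesis .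
          qed
          have "emeasure ?Q {X \<in> space ?Q. \<epsilon> < \<bar>Y X\<bar>} = (\<integral>\<^sup>+X. indicator {X \<in> space ?Q. \<epsilon> < \<bar>Y X\<bar>} X \<partial>?Q)"
            by (rule nn_integral_indicator[symmetric]) measurable
          also have "\<dots> \<le> (\<integral>\<^sup>+X. ennreal (1 / \<epsilon>) * ennreal \<bar>Y X\<bar> \<partial>?Q)"
          proof (intro nn_integral_mono)
            fix X
            show "indicator {X \<in> space ?Q. \<epsilon> < \<bar>Y X\<bar>} X \<le> ennreal (1 / \<epsilon>) * ennreal \<bar>Y X\<bar>"
            proof (cases "\<epsilon> < \<bar>Y X\<bar>")
              case True
              then have "1 \<le> 1 / \<epsilon> * \<bar>Y X\<bar>" using \<epsilon> by (simp add: field_simps)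
              then have "ennreal 1 \<le> ennreal (1 / \<epsilon>) * ennreal \<bar>Y X\<bar>"
                using \<epsilon> by (subst ennreal_mult[symmetric]) (auto intro: ennreal_leI)
              then show ?thesis using True by (simp add: indicator_def)
            qed simp
          qed
          also have "\<dots> = ennreal (1 / \<epsilon>) * (\<integral>\<^sup>+X. ennreal \<bar>Y X\<bar> \<partial>?Q)"
            by (rule nn_integral_cmult) measurable
          also have "\<dots> \<le> ennreal (1 / \<epsilon>) * (\<integral>\<^sup>+X. (\<Sum>j=l n..L n. ennreal (w n j) *
              ennreal \<bar>R ?e X n j / sqrt (real n) - c * W_inf ?e\<bar>) + ennreal (1 - s n) * ennreal \<bar>W_inf ?e\<bar> \<partial>?Q)"
            by (intro mult_left_mono nn_integral_mono Y_le) auto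
          also have "(\<integral>\<^sup>+X. (\<Sum>j=l n..L n. ennreal (w n j) *
              ennreal \<bar>R ?e X n j / sqrt (real n) - c * W_inf ?e\<bar>) + ennreal (1 - s n) * ennreal \<bar>W_inf ?e\<bar> \<partial>?Q) =
              (\<Sum>j=l n..L n. ennreal (w n j) * (\<integral>\<^sup>+X. ennreal \<bar>R ?e X n j / sqrt (real n) - c * W_inf ?e\<bar> \<partial>?Q)) +
              ennreal (1 - s n) * ennreal \<bar>W_inf ?e\<bar>"
            using Q.emeasure_space_1 by (subst nn_integral_add) (auto simp: nn_integral_sum nn_integral_cmult)
          also have "\<dots> \<le> (\<Sum>j=l n..L n. ennreal (w n j) * level_bound c ?e n j (sqrt (r n))) +
              ennreal (1 - s n) * ennreal \<bar>W_inf ?e\<bar>"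
          proof (intro add_right_mono sum_mono mult_left_mono)
            fix j assume "j \<in> {l n..L n}"
            then have "0 < j" using l[OF n1(1)] by auto
            then show "(\<integral>\<^sup>+X. ennreal \<bar>R ?e X n j / sqrt (real n) - c * W_inf ?e\<bar> \<partial>?Q) \<le> level_bound c ?e n j (sqrt (r n))"
              by (rule quenched_level_bound[OF C n1(2) _ r0 c])
          qed auto
          also have "ennreal (1 / \<epsilon>) * ((\<Sum>j=l n..L n. ennreal (w n j) * level_bound c ?e n j (sqrt (r n))) +
              ennreal (1 - s n) * ennreal \<bar>W_inf ?e\<bar>) = U n \<omega>"
            using True by (simp add: U_def)
          finally show ?thesis by (simp add: Y_def mult_left_mono)
        qed
      qed
      have "1 \<le> ln (real n)"
        using n exp_le by (subst ln_ge_iff) auto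
      then have \<zeta>: "1 \<le> \<zeta> n" "real (\<zeta> n) \<le> ln (real n)" "ln (real n) - 1 \<le> real (\<zeta> n)"
        unfolding \<zeta>_def by linarith+
      have m_le: "m n \<le> l n"
      proof -
        have "real (\<zeta> n) / \<delta> \<le> ln (real n) / \<delta>" using \<zeta>(2) \<delta> by (simp add: divide_right_mono)
        then have "real (\<zeta> n) / \<delta> \<le> real (l n)" using l[OF n1(1)] by linarith
        then show ?thesis unfolding m_def by linarith
      qed
      have exp_le: "sqrt (real n) * exp (- (3 * real (\<zeta> n))) \<le> exp 3 / real n"
      proof -
        have "exp (- (3 * real (\<zeta> n))) \<le> exp (3 - (ln (real n) + ln (real n)))"
          using \<zeta>(3) \<open>1 \<le> ln (real n)\<close> by simp
        also have "\<dots> = exp 3 / (real n * real n)" using n1 by (simp only: exp_diff exp_add exp_ln of_nat_0_less_iff)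
        finally have "sqrt (real n) * exp (- (3 * real (\<zeta> n))) \<le> sqrt (real n) * (exp 3 / (real n * real n))"
          by (intro mult_left_mono) auto
        also have "\<dots> \<le> real n * (exp 3 / (real n * real n))"
          using n1 by (intro mult_right_mono real_le_lsqrt) (auto simp: power2_eq_square)
        also have "\<dots> = exp 3 / real n" using n1 by simp
        finally show ?thesis .
      qed
      have level: "(\<integral>\<^sup>+\<omega>. indicator (G n) (Env \<omega>) * level_bound c (Env \<omega>) n j (sqrt (r n)) \<partial>M) \<le> b n"
        if j: "j \<in> {l n..L n}" for j
      proof -
        have "(\<integral>\<^sup>+\<omega>. indicator (G n) (Env \<omega>) * level_bound c (Env \<omega>) n j (sqrt (r n)) \<partial>M) \<le>
            ennreal (2 * sqrt (r n) + (2 * C\<^sub>1 * (real j + 1) / sqrt (real n) +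
              sqrt (real n) * exp (- (3 * real (\<zeta> n)))) / sqrt (r n)) + d j + ennreal (1 / sqrt (real n)) * wb"
          unfolding G_def d_def wb_def
          by (rule mean_level_bound) (use m_le j n1 r0 in auto)
        also have "\<dots> \<le> b n"
          unfolding b_def
        proof (intro add_right_mono add_mono ennreal_leI i n1 j)
          have "2 * C\<^sub>1 * (real j + 1) / sqrt (real n) + sqrt (real n) * exp (- (3 * real (\<zeta> n))) \<le> r n"
            unfolding r_def using j C1 exp_le
            by (intro add_mono divide_right_mono mult_left_mono) auto
          then have "(2 * C\<^sub>1 * (real j + 1) / sqrt (real n) + sqrt (real n) * exp (- (3 * real (\<zeta> n)))) / sqrt (r n) \<le>
              r n / sqrt (r n)" using r0 by (intro divide_right_mono) auto
          also have "\<dots> = sqrt (r n)" using r_pos[OF n1(1)] by (simp add: real_div_sqrt)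
          finally show "2 * sqrt (r n) + (2 * C\<^sub>1 * (real j + 1) / sqrt (real n) +
              sqrt (real n) * exp (- (3 * real (\<zeta> n)))) / sqrt (r n) \<le> 3 * sqrt (r n)" by linarith
        qed
        finally show ?thesis .
      qed
      have notG: "(\<integral>\<^sup>+\<omega>. indicator (- G n) (Env \<omega>) \<partial>M) \<le> ennreal (exp (- \<rho> * real (\<zeta> n)))"
      proof -
        have sets: "{\<omega> \<in> space M. Env \<omega> \<in> G n} \<in> sets M"
          unfolding G_def using measurable_compose[OF measurable_Env measurable_high] by (simp add: pred_def)
        have "(\<integral>\<^sup>+\<omega>. indicator (- G n) (Env \<omega>) \<partial>M) = (\<integral>\<^sup>+\<omega>. indicator (space M - {\<omega> \<in> space M. Env \<omega> \<in> G n}) \<omega> \<partial>M)"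
          by (intro nn_integral_cong) (auto simp: indicator_def)
        also have "\<dots> = emeasure M (space M - {\<omega> \<in> space M. Env \<omega> \<in> G n})"
          using sets by (intro nn_integral_indicator) auto
        also have "\<dots> = ennreal (1 - prob {\<omega> \<in> space M. Env \<omega> \<in> G n})"
          using prob_compl[OF sets] by (simp add: emeasure_eq_measure)
        also have "\<dots> \<le> ennreal (exp (- \<rho> * real (\<zeta> n)))"
          using high[OF \<zeta>(1)] by (intro ennreal_leI) (simp add: G_def m_def)
        finally show ?thesis .
      qed
      have "(\<integral>\<^sup>+\<omega>. U n \<omega> \<partial>M) = (\<integral>\<^sup>+\<omega>. indicator (- G n) (Env \<omega>) \<partial>M) + ennreal (1 / \<epsilon>) *
          ((\<Sum>j=l n..L n. ennreal (w n j) * (\<integral>\<^sup>+\<omega>. indicator (G n) (Env \<omega>) * level_bound c (Env \<omega>) n j (sqrt (r n)) \<partial>M)) +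
           ennreal (1 - s n) * wb)"
        unfolding U_def wb_def by (simp add: nn_integral_add nn_integral_cmult nn_integral_sum)
      also have "\<dots> \<le> ennreal (exp (- \<rho> * real (\<zeta> n))) + ennreal (1 / \<epsilon>) *
          ((\<Sum>j=l n..L n. ennreal (w n j) * b n) + ennreal (1 - s n) * wb)"
        by (intro add_mono notG mult_left_mono add_right_mono sum_mono level) auto
      also have "(\<Sum>j=l n..L n. ennreal (w n j) * b n) \<le> b n"
      proof -
        have "(\<Sum>j=l n..L n. ennreal (w n j) * b n) = ennreal (s n) * b n"
          using w(1) by (simp add: s_def flip: sum_distrib_right)
        also have "\<dots> \<le> 1 * b n" using s by (intro mult_right_mono) auto
        finally show ?thesis by simp
      qed
      finally show "(\<integral>\<^sup>+\<omega>. U n \<omega> \<partial>M) \<le> u n"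
        unfolding u_def by (simp add: mult_left_mono add_left_mono add_right_mono)
    qed
  qed
qed

end

section \<open>Moments of the first generation\<close>

definition offspring_laplace :: "real \<Rightarrow> real list \<Rightarrow> real" where
  "offspring_laplace t xs = (\<Sum>i<length xs. exp (- t * (xs ! i)))"

lemma offspring_laplace_1: "offspring_laplace 1 = mass" and offspring_laplace_2: "offspring_laplace 2 = mass2"
  by (auto simp: offspring_laplace_def mass_def mass2_def)

lemma offspring_laplace_nonneg: "0 \<le> offspring_laplace t xs"
  unfolding offspring_laplace_def by (intro sum_nonneg) auto

lemma measurable_offspring_laplace [measurable]: "offspring_laplace t \<in> borel_measurable real_seqs"
  unfolding offspring_laplace_def by measurable

lemma offspring_laplace_le:
  assumes "1 \<le> t" "t \<le> 2"
  shows "offspring_laplace t xs \<le> mass xs + mass2 xs"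
proof -
  have "exp (- t * a) \<le> exp (- a) + exp (- 2 * a)" for a :: real
  proof (cases "0 \<le> a")
    case True
    then have "exp (- t * a) \<le> exp (- a)" using assms mult_right_mono[of 1 t a] by simp
    then show ?thesis by (simp add: add_increasing2)
  next
    case False
    then have "exp (- t * a) \<le> exp (- 2 * a)" using assms mult_right_mono_neg[of t 2 a] by simp
    then show ?thesis by (simp add: add_increasing)
  qed
  then show ?thesis
    unfolding offspring_laplace_def mass_def mass2_def sum.distrib[symmetric] by (intro sum_mono)
qed

lemma laplace_eq: "laplace M Env t = (\<integral>\<^sup>+\<omega>. ennreal (offspring_laplace t (Env \<omega> [])) \<partial>M)"
  unfolding laplace_def sum_gen_1 offspring_laplace_def by (simp add: sum_ennreal)

text \<open>
  The square of a sum splits into ordered pairs of distinct children and the diagonal.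
\<close>

lemma mass_sq_le:
  "(mass (e []))\<^sup>2 \<le> (\<Sum>xs\<in>Delta1 e 2. exp (- (\<Sum>i<2. real ([1, 1] ! i) * V e (xs ! i)))) + mass2 (e [])"
proof -
  let ?I = "{..<length (e [])}" and ?a = "\<lambda>i. exp (- (e [] ! i))"
  let ?f = "\<lambda>(i, j). [[i], [j]] :: vertex list"
  let ?g = "\<lambda>xs. exp (- (\<Sum>i<2. real ([1, 1] ! i) * V e (xs ! i)))"
  let ?O = "{(i, j) \<in> ?I \<times> ?I. i \<noteq> j}"
  have fin: "finite (Delta1 e 2)"
    unfolding Delta1_def by (rule finite_subset[OF _ finite_lists_length_eq[OF finite_gen[of e 1], of 2]]) auto
  have "(mass (e []))\<^sup>2 = (\<Sum>(i, j)\<in>?I \<times> ?I. ?a i * ?a j)"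
    unfolding mass_def power2_eq_square sum_product sum.cartesian_product ..
  also have "?I \<times> ?I = ?O \<union> (\<lambda>i. (i, i)) ` ?I" by auto
  also have "(\<Sum>(i, j)\<in>?O \<union> (\<lambda>i. (i, i)) ` ?I. ?a i * ?a j) =
      (\<Sum>(i, j)\<in>?O. ?a i * ?a j) + (\<Sum>(i, j)\<in>(\<lambda>i. (i, i)) ` ?I. ?a i * ?a j)"
    by (rule sum.union_disjoint) (auto intro: finite_subset[of _ "?I \<times> ?I"])
  also have "(\<Sum>(i, j)\<in>(\<lambda>i. (i, i)) ` ?I. ?a i * ?a j) = mass2 (e [])"
    by (subst sum.reindex) (auto simp: inj_on_def mass2_def simp flip: exp_add intro!: sum.cong)
  also have "(\<Sum>(i, j)\<in>?O. ?a i * ?a j) = (\<Sum>xs\<in>?f ` ?O. ?g xs)"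
    by (subst sum.reindex) (auto simp: inj_on_def numeral_2_eq_2 simp flip: exp_add intro!: sum.cong)
  also have "\<dots> \<le> (\<Sum>xs\<in>Delta1 e 2. ?g xs)"
  proof (rule sum_mono2[OF fin])
    have "[i] \<in> gen e 1" if "i < length (e [])" for i
      using that by (simp add: gen_def tree_def)
    then show "?f ` ?O \<subseteq> Delta1 e 2" by (auto simp: Delta1_def)
  qed auto
  finally show ?thesis by simp
qed

text \<open>
  The point is \<open>psi 2 < 0\<close>. Just to the right of \<open>1\<close> the function \<open>psi\<close> is negative by the sign of its
  derivative; were it nonnegative at \<open>2\<close>, continuity would give a zero in \<open>(1, 2]\<close>, against the
  definition of \<open>kappa\<close>.
\<close>

lemma branching_walk_exists:
  assumes env: "branching_env M Env"
    and psi1: "psi M Env 1 = 0"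
    and deriv: "((\<lambda>t. real_of_ereal (psi M Env t)) has_real_derivative D) (at 1)" "D < 0"
    and kappa: "2 < kappa M Env"
    and psi2: "psi M Env 2 < \<infinity>"
    and c2: "c_beta M Env [1, 1] < \<infinity>"
  shows "\<exists>q \<sigma>. branching_walk M Env q \<sigma>"
proof -
  interpret prob_space M using env by (simp add: branching_env_def)
  have indep: "indep_vars (\<lambda>_. real_seqs) (\<lambda>u \<omega>. Env \<omega> u) UNIV"
    and ident: "\<And>u. distr M real_seqs (\<lambda>\<omega>. Env \<omega> u) = distr M real_seqs (\<lambda>\<omega>. Env \<omega> [])"
    using env by (auto simp: branching_env_def)
  have Env_meas: "(\<lambda>\<omega>. Env \<omega> u) \<in> M \<rightarrow>\<^sub>M real_seqs" for u
    using indep by (simp add: indep_vars_def)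
  note [measurable] = Env_meas
  have "Env \<in> M \<rightarrow>\<^sub>M env_space" by (rule measurable_PiM_single') auto
  note [measurable] = this
  define f where "f t \<omega> = offspring_laplace t (Env \<omega> [])" for t \<omega>
  define F where "F t = (\<integral>\<omega>. f t \<omega> \<partial>M)" for t
  have f_meas [measurable]: "f t \<in> borel_measurable M" for t unfolding f_def by measurable
  have f0: "0 \<le> f t \<omega>" for t \<omega> by (simp add: f_def offspring_laplace_nonneg)
  have f_le: "f t \<omega> \<le> f 1 \<omega> + f 2 \<omega>" if "1 \<le> t" "t \<le> 2" for t \<omega>
    using offspring_laplace_le[OF that] by (simp add: f_def offspring_laplace_1 offspring_laplace_2)
  have lap: "laplace M Env t = (\<integral>\<^sup>+\<omega>. ennreal (f t \<omega>) \<partial>M)" for t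
    by (simp add: laplace_eq f_def)
  have lap1: "laplace M Env 1 = 1"
  proof -
    have fin: "laplace M Env 1 \<noteq> \<infinity>" "laplace M Env 1 \<noteq> 0" "ln (enn2real (laplace M Env 1)) = 0"
      using psi1 by (auto simp: psi_def split: if_splits)
    then have "0 < enn2real (laplace M Env 1)" by (simp add: enn2real_positive_iff less_top zero_less_iff_neq_zero)
    then have "enn2real (laplace M Env 1) = 1" using fin(3) by simp
    then show ?thesis using fin(1) by (metis ennreal_1 ennreal_enn2real less_top infinity_ennreal_def)
  qed
  have lap2: "laplace M Env 2 < \<infinity>"
    using psi2 by (auto simp: psi_def less_top split: if_splits)
  have f_int: "integrable M (f t)" if "1 \<le> t" "t \<le> 2" for t
  proof -
    have "integrable M (f 1)" "integrable M (f 2)"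
      using lap[of 1] lap[of 2] lap1 lap2 f0 by (auto intro!: integrableI_nonneg)
    then have "integrable M (\<lambda>\<omega>. f 1 \<omega> + f 2 \<omega>)" by simp
    then show ?thesis
      by (rule Bochner_Integration.integrable_bound) (use f_le[OF that] f0 in auto)
  qed
  have lap_F: "laplace M Env t = ennreal (F t)" if "1 \<le> t" "t \<le> 2" for t
    unfolding lap F_def using f_int[OF that] f0 by (intro nn_integral_eq_integral) auto
  have F0: "0 \<le> F t" for t unfolding F_def using f0 by (intro integral_nonneg_AE) auto
  have F_pos: "0 < F t" if t: "1 \<le> t" "t \<le> 2" for t
  proof (rule ccontr)
    assume "\<not> 0 < F t"
    then have "(\<integral>\<^sup>+\<omega>. ennreal (f t \<omega>) \<partial>M) = 0" using lap_F[OF t] F0[of t] by (simp add: lap)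
    then have "AE \<omega> in M. ennreal (f t \<omega>) = 0" by (simp add: nn_integral_0_iff_AE)
    then have "AE \<omega> in M. ennreal (f 1 \<omega>) = 0"
    proof eventually_elim
      case (elim \<omega>)
      then have "f t \<omega> = 0" using f0[of t \<omega>] by simp
      then have "{..<length (Env \<omega> [])} = {}"
        unfolding f_def offspring_laplace_def by (subst (asm) sum_nonneg_eq_0_iff) auto
      then show ?case by (simp add: f_def offspring_laplace_def)
    qed
    then have "laplace M Env 1 = 0" by (simp add: lap nn_integral_0_iff_AE)
    then show False using lap1 by simp
  qed
  have psi_F: "psi M Env t = ereal (ln (F t))" if t: "1 \<le> t" "t \<le> 2" for t
    using F_pos[OF t] by (simp add: psi_def lap_F[OF t])
  have F_cont: "continuous_on {1..2} F"
    unfolding continuous_on_sequentially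
  proof (intro allI ballI impI, elim conjE)
    fix x :: "nat \<Rightarrow> real" and t :: real assume x: "\<forall>n. x n \<in> {1..2}" and t: "t \<in> {1..2}" "x \<longlonglongrightarrow> t"
    show "(F \<circ> x) \<longlonglongrightarrow> F t"
      unfolding F_def comp_def
    proof (rule integral_dominated_convergence[where w = "\<lambda>\<omega>. f 1 \<omega> + f 2 \<omega>"])
      show "integrable M (\<lambda>\<omega>. f 1 \<omega> + f 2 \<omega>)" using f_int[of 1] f_int[of 2] by simp
      show "AE \<omega> in M. (\<lambda>n. f (x n) \<omega>) \<longlonglongrightarrow> f t \<omega>"
        unfolding f_def offspring_laplace_def by (intro AE_I2 tendsto_intros t)
      show "AE \<omega> in M. norm (f (x n) \<omega>) \<le> f 1 \<omega> + f 2 \<omega>" for n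
        using f_le[of "x n"] f0 x by auto
    qed simp_all
  qed
  have F2: "F 2 < 1"
  proof (rule ccontr)
    assume "\<not> F 2 < 1"
    obtain d where d: "0 < d" "\<And>h. 0 < h \<Longrightarrow> h < d \<Longrightarrow>
        real_of_ereal (psi M Env (1 + h)) < real_of_ereal (psi M Env 1)"
      using DERIV_neg_dec_right[OF deriv] by blast
    define t\<^sub>0 where "t\<^sub>0 = 1 + min (d / 2) (1 / 2)"
    have t0: "1 < t\<^sub>0" "t\<^sub>0 \<le> 2" using d(1) by (auto simp: t\<^sub>0_def)
    have "real_of_ereal (psi M Env t\<^sub>0) < 0"
      unfolding t\<^sub>0_def using d(2)[of "min (d / 2) (1 / 2)"] d(1) psi1 by simp
    then have "ln (F t\<^sub>0) < 0" using psi_F[of t\<^sub>0] t0 by simp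
    then have "F t\<^sub>0 \<le> 1" using F_pos[of t\<^sub>0] t0 by simp
    moreover have "continuous_on {t\<^sub>0..2} F"
      by (rule continuous_on_subset[OF F_cont]) (use t0 in auto)
    ultimately obtain t where t: "t\<^sub>0 \<le> t" "t \<le> 2" "F t = 1"
      using IVT'[of F t\<^sub>0 1 2] \<open>\<not> F 2 < 1\<close> t0 by auto
    then have "psi M Env t = 0" using psi_F[of t] t0 by simp
    then have "kappa M Env \<le> ereal t"
      unfolding kappa_def using t t0 by (intro Inf_lower imageI) auto
    then have "2 < ereal t" using kappa by (rule order.strict_trans2[rotated])
    then show False using t(2) by (simp add: numeral_eq_ereal)
  qed
  define \<sigma> where "\<sigma> = enn2real (c_beta M Env [1, 1]) + F 2"
  have "branching_walk M Env (F 2) \<sigma>"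
  proof (unfold_locales)
    show "indep_vars (\<lambda>_. real_seqs) (\<lambda>u \<omega>. Env \<omega> u) UNIV" by (rule indep)
    show "distr M real_seqs (\<lambda>\<omega>. Env \<omega> u) = distr M real_seqs (\<lambda>\<omega>. Env \<omega> [])" for u by (rule ident)
    show "(\<integral>\<^sup>+\<omega>. ennreal (mass (Env \<omega> [])) \<partial>M) = 1"
      using lap1 by (simp add: laplace_eq offspring_laplace_1)
    show "(\<integral>\<^sup>+\<omega>. ennreal (mass2 (Env \<omega> [])) \<partial>M) = ennreal (F 2)"
      using lap_F[of 2] by (simp add: laplace_eq offspring_laplace_2)
    show "0 < F 2" "F 2 < 1" using F_pos[of 2] F2 by auto
    show "0 \<le> \<sigma>" using F0 by (simp add: \<sigma>_def)
    have "(\<integral>\<^sup>+\<omega>. ennreal ((mass (Env \<omega> []))\<^sup>2) \<partial>M) \<le>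
        (\<integral>\<^sup>+\<omega>. (\<Sum>xs\<in>Delta1 (Env \<omega>) 2. ennreal (exp (- (\<Sum>i<2. real ([1, 1] ! i) * V (Env \<omega>) (xs ! i))))) +
          ennreal (f 2 \<omega>) \<partial>M)"
    proof (intro nn_integral_mono)
      fix \<omega>
      have "ennreal ((mass (Env \<omega> []))\<^sup>2) \<le> ennreal ((\<Sum>xs\<in>Delta1 (Env \<omega>) 2.
          exp (- (\<Sum>i<2. real ([1, 1] ! i) * V (Env \<omega>) (xs ! i)))) + mass2 (Env \<omega> []))"
        by (intro ennreal_leI mass_sq_le)
      also have "\<dots> = (\<Sum>xs\<in>Delta1 (Env \<omega>) 2. ennreal (exp (- (\<Sum>i<2. real ([1, 1] ! i) * V (Env \<omega>) (xs ! i))))) +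
          ennreal (f 2 \<omega>)"
        by (subst ennreal_plus) (auto intro!: sum_nonneg mass2_nonneg simp: sum_ennreal f_def offspring_laplace_2)
      finally show "ennreal ((mass (Env \<omega> []))\<^sup>2) \<le>
          (\<Sum>xs\<in>Delta1 (Env \<omega>) 2. ennreal (exp (- (\<Sum>i<2. real ([1, 1] ! i) * V (Env \<omega>) (xs ! i))))) +
          ennreal (f 2 \<omega>)" .
    qed
    also have "\<dots> = c_beta M Env [1, 1] + ennreal (F 2)"
    proof (subst nn_integral_add)
      show "(\<lambda>\<omega>. \<Sum>xs\<in>Delta1 (Env \<omega>) 2. ennreal (exp (- (\<Sum>i<2. real ([1, 1] ! i) * V (Env \<omega>) (xs ! i))))) \<in>
          borel_measurable M"
        unfolding Delta1_def
        by (rule measurable_gen_functional[where f = Env and r = 1 and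
              \<Phi> = "\<lambda>G \<omega>. \<Sum>xs\<in>{xs. length xs = 2 \<and> distinct xs \<and> set xs \<subseteq> G}.
                ennreal (exp (- (\<Sum>i<2. real ([1, 1] ! i) * V (Env \<omega>) (xs ! i))))"]) measurable
    qed (use lap_F[of 2] in \<open>auto simp: c_beta_def lap numeral_2_eq_2\<close>)
    also have "\<dots> = ennreal \<sigma>"
      using c2 F0 by (simp add: \<sigma>_def ennreal_plus less_top)
    finally show "(\<integral>\<^sup>+\<omega>. ennreal ((mass (Env \<omega> []))\<^sup>2) \<partial>M) \<le> ennreal \<sigma>" .
  qed
  then show ?thesis by blast
qed

section \<open>The range over a window of levels\<close>

lemma iter_log_at_top:
  "filterlim x at_top F \<Longrightarrow> filterlim (\<lambda>n. iter_log i (x n)) at_top F"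
  by (induction i) (auto intro: filterlim_compose[OF ln_at_top])

lemma tendsto_0_of_times_at_top:
  fixes x y :: "nat \<Rightarrow> real"
  assumes "(\<lambda>n. x n * y n) \<longlonglongrightarrow> 0" "filterlim y at_top sequentially" "\<And>n. 0 \<le> x n"
  shows "x \<longlonglongrightarrow> 0"
proof (rule tendsto_sandwich[OF _ _ tendsto_const assms(1)])
  show "\<forall>\<^sub>F n in sequentially. x n \<le> x n * y n"
    using filterlim_at_top[THEN iffD1, OF assms(2), rule_format, of 1]
  proof eventually_elim
    case (elim n)
    then show ?case using mult_left_mono[of 1 "y n" "x n"] assms(3) by simp
  qed
qed (use assms(3) in simp)

theorem corollary1p3:
  fixes M :: "'w measure" and Env :: "'w \<Rightarrow> env"
    and M' :: "'v measure" and S :: "nat \<Rightarrow> 'v \<Rightarrow> real"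
    and \<delta>\<^sub>0 :: real and l L :: "nat \<Rightarrow> nat"
  assumes env: "branching_env M Env"
    and supercritical: "mean_offspring M Env > 1"
    and walk: "assoc_walk M Env M' S"
    and delta0: "\<delta>\<^sub>0 > 0"
      "\<exists>\<rho>\<^sub>1>1/2. \<forall>\<zeta>::nat. \<zeta> \<ge> 1 \<longrightarrow>
         \<P>(\<omega> in M. (INF z\<in>gen (Env \<omega>) (nat \<lceil>real \<zeta> / \<delta>\<^sub>0\<rceil>). ereal (V (Env \<omega>) z)) \<ge> ereal (3 * real \<zeta>))
           \<ge> 1 - exp (- \<rho>\<^sub>1 * real \<zeta>)"
    and h1: "(INF t\<in>{0..1}. psi M Env t) = psi M Env 1" "psi M Env 1 = 0"
      "\<exists>D<0. ((\<lambda>t. real_of_ereal (psi M Env t)) has_real_derivative D) (at 1)"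
      "2 < kappa M Env" "kappa M Env < \<infinity>"
    and h2: "\<exists>\<delta>\<^sub>1>0. let K = \<lceil>real_of_ereal (kappa M Env) + \<delta>\<^sub>1\<rceil> in
         (\<forall>t\<in>{1 - \<delta>\<^sub>1..real_of_int K}. psi M Env t < \<infinity>) \<and>
         (\<forall>j::nat. 1 \<le> j \<and> int j \<le> K \<longrightarrow>
            (\<forall>\<beta>::nat list. length \<beta> = j \<and> (\<forall>b\<in>set \<beta>. 1 \<le> b) \<and> int (sum_list \<beta>) \<le> K \<longrightarrow>
               c_beta M Env \<beta> < \<infinity>))"
    and h3: "\<exists>h>0. \<P>(\<omega> in M. (INF x\<in>tree (Env \<omega>) - {[]}.
         ereal (V (Env \<omega>) x - V (Env \<omega>) (butlast x))) \<ge> ereal (- h)) = 1"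
    and h4: "\<forall>n\<ge>1. 0 < l n \<and> ln (real n) / \<delta>\<^sub>0 \<le> real (l n) \<and> l n \<le> L n"
      "\<exists>l\<^sub>0. (\<lambda>n. real (L n) / sqrt (real n) * iter_log l\<^sub>0 (real (L n))) \<longlonglongrightarrow> 0"
  shows "converges_in_annealed_prob M Env
           (\<lambda>n \<omega> X. (\<Sum>k=l n..L n. R (Env \<omega>) X n k) / (sqrt (real n) * (real (L n) - real (l n) + 1)))
           (\<lambda>\<omega>. c_inf M' S * W_inf (Env \<omega>)) \<and>
         ((\<lambda>n. ln (real n)) \<in> o(\<lambda>n. real (L n)) \<longrightarrow>
         converges_in_annealed_prob M Env
           (\<lambda>n \<omega> X. R (Env \<omega>) X n (L n) / sqrt (real n))
           (\<lambda>\<omega>. c_inf M' S * W_inf (Env \<omega>)) \<and>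
         ((\<lambda>n. real (l n)) \<in> o(\<lambda>n. real (L n)) \<longrightarrow>
          converges_in_annealed_prob M Env
           (\<lambda>n \<omega> X. (\<Sum>k=l n..L n. R (Env \<omega>) X n k) / (sqrt (real n) * real (L n)))
           (\<lambda>\<omega>. c_inf M' S * W_inf (Env \<omega>))))"
proof -
  have moments: "psi M Env 2 < \<infinity> \<and> c_beta M Env [1, 1] < \<infinity>"
  proof -
    obtain \<delta>\<^sub>1 K where d: "0 < \<delta>\<^sub>1" "K = \<lceil>real_of_ereal (kappa M Env) + \<delta>\<^sub>1\<rceil>"
      "\<forall>t\<in>{1 - \<delta>\<^sub>1..real_of_int K}. psi M Env t < \<infinity>"
      "\<forall>j::nat. 1 \<le> j \<and> int j \<le> K \<longrightarrow>
            (\<forall>\<beta>::nat list. length \<beta> = j \<and> (\<forall>b\<in>set \<beta>. 1 \<le> b) \<and> int (sum_list \<beta>) \<le> K \<longrightarrow>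
               c_beta M Env \<beta> < \<infinity>)"
      using h2 by (auto simp: Let_def)
    have "2 < real_of_ereal (kappa M Env)"
      using h1(4,5) by (cases "kappa M Env") (auto simp: numeral_eq_ereal)
    then have "3 \<le> K" using d(1) unfolding d(2) by linarith
    then have "psi M Env 2 < \<infinity>" using d(1,3) by (intro bspec[OF d(3)]) auto
    moreover have "c_beta M Env [1, 1] < \<infinity>"
      using d(4)[rule_format, of 2 "[1, 1]"] \<open>3 \<le> K\<close> by simp
    ultimately show ?thesis ..
  qed
  obtain D where "D < 0" "((\<lambda>t. real_of_ereal (psi M Env t)) has_real_derivative D) (at 1)"
    using h1(3) by auto
  then obtain q \<sigma> where "branching_walk M Env q \<sigma>"
    using branching_walk_exists[OF env h1(2) _ _ h1(4)] moments by blast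
  then interpret branching_walk M Env q \<sigma> .
  note c = c_inf_bounds[OF walk]
  have green: "(\<lambda>j. \<integral>\<^sup>+\<omega>. ennreal \<bar>green (Env \<omega>) j - c_inf M' S * W_inf (Env \<omega>)\<bar> \<partial>M) \<longlonglongrightarrow> 0"
    by (rule green_tendsto[OF funpow_T_tendsto_c_inf[OF walk] c])
  obtain \<rho> where \<rho>: "1 / 2 < \<rho>" and "\<And>\<zeta>::nat. 1 \<le> \<zeta> \<Longrightarrow> 1 - exp (- \<rho> * real \<zeta>) \<le>
      \<P>(\<omega> in M. (INF z\<in>gen (Env \<omega>) (nat \<lceil>real \<zeta> / \<delta>\<^sub>0\<rceil>). ereal (V (Env \<omega>) z)) \<ge> ereal (3 * real \<zeta>))"
    using delta0(2) by blast
  then have high: "\<And>\<zeta>::nat. 1 \<le> \<zeta> \<Longrightarrow>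
      1 - exp (- \<rho> * real \<zeta>) \<le> prob {\<omega> \<in> space M. Env \<omega> \<in> high (nat \<lceil>real \<zeta> / \<delta>\<^sub>0\<rceil>) (3 * real \<zeta>)}"
    by (simp add: high_def le_INF_iff)
  have l: "0 < l n \<and> ln (real n) / \<delta>\<^sub>0 \<le> real (l n) \<and> l n \<le> L n" if "1 \<le> n" for n
    using h4(1) that by blast
  have L_top: "filterlim (\<lambda>n. real (L n)) at_top sequentially"
  proof (rule filterlim_at_top_mono)
    show "filterlim (\<lambda>n. ln (real n) / \<delta>\<^sub>0) at_top sequentially"
      using delta0(1) by real_asymp
    show "\<forall>\<^sub>F n in sequentially. ln (real n) / \<delta>\<^sub>0 \<le> real (L n)"
    proof (rule eventually_sequentiallyI[of 1])
      fix n :: nat assume "1 \<le> n"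
      then show "ln (real n) / \<delta>\<^sub>0 \<le> real (L n)" using l[of n] by linarith
    qed
  qed
  have L: "(\<lambda>n. real (L n) / sqrt (real n)) \<longlonglongrightarrow> 0"
  proof -
    obtain l\<^sub>0 where "(\<lambda>n. real (L n) / sqrt (real n) * iter_log l\<^sub>0 (real (L n))) \<longlonglongrightarrow> 0" using h4(2) by blast
    then show ?thesis by (rule tendsto_0_of_times_at_top) (auto intro: iter_log_at_top L_top)
  qed
  have \<rho>0: "0 < \<rho>" using \<rho> by simp
  note converges = range_converges[OF green c delta0(1) \<rho>0 high l L]
  show ?thesis
  proof (intro conjI impI)
    \<comment> \<open>The number of levels in truncated subtraction, so that the weights are nonnegative also for \<open>n = 0\<close>.\<close>
    define w where "w n (j :: nat) = 1 / real (Suc (L n - l n))" for n j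
    have sum_w: "(\<Sum>j=l n..L n. w n j) = 1" if "1 \<le> n" for n
    proof -
      have "card {l n..L n} = Suc (L n - l n)" using l[OF that] by (simp add: Suc_diff_le)
      then show ?thesis by (simp add: w_def)
    qed
    have "(\<lambda>n. \<Sum>j=l n..L n. w n j) \<longlonglongrightarrow> 1"
      by (rule tendsto_eventually) (use sum_w in \<open>auto intro: eventually_sequentiallyI[of 1]\<close>)
    then have "converges_in_annealed_prob M Env (\<lambda>n \<omega> X. \<Sum>j=l n..L n. w n j * (R (Env \<omega>) X n j / sqrt (real n)))
        (\<lambda>\<omega>. c_inf M' S * W_inf (Env \<omega>))"
      by (intro converges) (auto simp: sum_w, auto simp: w_def)
    moreover have "(\<Sum>j=l n..L n. w n j * (R (Env \<omega>) X n j / sqrt (real n))) =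
        (\<Sum>k=l n..L n. R (Env \<omega>) X n k) / (sqrt (real n) * (real (L n) - real (l n) + 1))" for n \<omega> X
    proof (cases "n = 0")
      case False
      then have "real (Suc (L n - l n)) = real (L n) - real (l n) + 1" using l[of n] by (simp add: of_nat_diff)
      then show ?thesis by (simp only: w_def) (simp add: sum_divide_distrib mult.commute)
    qed simp
    ultimately show "converges_in_annealed_prob M Env
           (\<lambda>n \<omega> X. (\<Sum>k=l n..L n. R (Env \<omega>) X n k) / (sqrt (real n) * (real (L n) - real (l n) + 1)))
           (\<lambda>\<omega>. c_inf M' S * W_inf (Env \<omega>))" by simp
  next
    define w :: "nat \<Rightarrow> nat \<Rightarrow> real" where "w n j = (if j = L n then 1 else 0)" for n j
    have sum_w: "(\<Sum>j=l n..L n. w n j * a j) = a (L n)" if "1 \<le> n" for n a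
    proof -
      have "(\<Sum>j=l n..L n. w n j * a j) = (\<Sum>j=l n..L n. if j = L n then a j else 0)"
        by (intro sum.cong) (auto simp: w_def)
      then show ?thesis using l[OF that] by simp
    qed
    then have sum_w1: "(\<Sum>j=l n..L n. w n j) = 1" if "1 \<le> n" for n
      using sum_w[OF that, of "\<lambda>_. 1"] by simp
    have "(\<lambda>n. \<Sum>j=l n..L n. w n j) \<longlonglongrightarrow> 1"
      by (rule tendsto_eventually) (use sum_w1 in \<open>auto intro: eventually_sequentiallyI[of 1]\<close>)
    then have "converges_in_annealed_prob M Env (\<lambda>n \<omega> X. \<Sum>j=l n..L n. w n j * (R (Env \<omega>) X n j / sqrt (real n)))
        (\<lambda>\<omega>. c_inf M' S * W_inf (Env \<omega>))"
      by (intro converges) (auto simp: sum_w1, auto simp: w_def)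
    moreover have "(\<Sum>j=l n..L n. w n j * (R (Env \<omega>) X n j / sqrt (real n))) = R (Env \<omega>) X n (L n) / sqrt (real n)"
      for n \<omega> X
    proof (cases "n = 0")
      case False
      then show ?thesis by (intro sum_w) simp
    qed simp
    ultimately show "converges_in_annealed_prob M Env (\<lambda>n \<omega> X. R (Env \<omega>) X n (L n) / sqrt (real n))
           (\<lambda>\<omega>. c_inf M' S * W_inf (Env \<omega>))" by simp
  next
    assume o: "(\<lambda>n. real (l n)) \<in> o(\<lambda>n. real (L n))"
    define w where "w n (j :: nat) = 1 / real (L n)" for n j
    have sum_w: "(\<Sum>j=l n..L n. w n j) = 1 - real (l n) / real (L n) + 1 / real (L n)" if "1 \<le> n" for n
    proof -
      have "l n \<le> L n" "0 < L n" using l[OF that] by auto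
      then show ?thesis by (simp add: w_def Suc_diff_le of_nat_diff field_simps)
    qed
    have "(\<lambda>n. real (l n) / real (L n)) \<longlonglongrightarrow> 0"
      by (rule smalloD_tendsto[OF o])
    moreover have "(\<lambda>n. 1 / real (L n)) \<longlonglongrightarrow> 0"
      using tendsto_inverse_0_at_top[OF L_top] by (simp add: inverse_eq_divide)
    ultimately have "(\<lambda>n. 1 - real (l n) / real (L n) + 1 / real (L n)) \<longlonglongrightarrow> 1 - 0 + 0"
      by (intro tendsto_intros)
    then have "(\<lambda>n. 1 - real (l n) / real (L n) + 1 / real (L n)) \<longlonglongrightarrow> 1" by simp
    moreover have "\<forall>\<^sub>F n in sequentially. 1 - real (l n) / real (L n) + 1 / real (L n) = (\<Sum>j=l n..L n. w n j)"
      by (rule eventually_sequentiallyI[of 1]) (simp add: sum_w)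
    ultimately have "(\<lambda>n. \<Sum>j=l n..L n. w n j) \<longlonglongrightarrow> 1"
      by (rule Lim_transform_eventually)
    moreover have "(\<Sum>j=l n..L n. w n j) \<le> 1" if "1 \<le> n" for n
    proof -
      have "1 / real (L n) \<le> real (l n) / real (L n)" using l[OF that] by (intro divide_right_mono) auto
      then show ?thesis by (simp add: sum_w[OF that])
    qed
    ultimately have "converges_in_annealed_prob M Env (\<lambda>n \<omega> X. \<Sum>j=l n..L n. w n j * (R (Env \<omega>) X n j / sqrt (real n)))
        (\<lambda>\<omega>. c_inf M' S * W_inf (Env \<omega>))"
      by (intro converges) (auto simp: w_def)
    moreover have "(\<Sum>j=l n..L n. w n j * (R (Env \<omega>) X n j / sqrt (real n))) =
        (\<Sum>k=l n..L n. R (Env \<omega>) X n k) / (sqrt (real n) * real (L n))" for n \<omega> X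
      by (simp add: w_def sum_divide_distrib mult.commute)
    ultimately show "converges_in_annealed_prob M Env
           (\<lambda>n \<omega> X. (\<Sum>k=l n..L n. R (Env \<omega>) X n k) / (sqrt (real n) * real (L n)))
           (\<lambda>\<omega>. c_inf M' S * W_inf (Env \<omega>))" by simp
  qed
qed

end
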